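(* Let $n\ge 1$ and let $\Gamma\subset\mathrm{SO}^+(n+1,1)$ be a non-elementary convex cocompact Kleinian group of the second kind, with limit set $\Lambda_\Gamma\subset\mathbb S^n$, Patterson-Sullivan measure $\mu$ on $\Lambda_\Gamma$, and chordal distance $d(x,y)=\|x-y\|$. Let $\delta$ be the Hausdorff dimension of $\Lambda_\Gamma$ with respect to $d$, let $\Delta:\operatorname{Dom}\Delta\to L^2(\Lambda_\Gamma,\mu)$ be the logarithmic Dirichlet Laplacian of the Ahlfors $\delta$-regular metric-measure space $(\Lambda_\Gamma,d,\mu)$, and let $\gamma\in\Gamma$. Let $U(\gamma)$ be the unitary operator on $L^2(\Lambda_\Gamma,\mu)$ given by $$U(\gamma)f(x)=|(\gamma^{-1})'(x)|^{\delta/2}f(\gamma^{-1}x).$$ Then $U(\gamma)$ preserves $\operatorname{Dom}\Delta$ and the commutator $[\Delta,U(\gamma)]:\operatorname{Dom}\Delta\to L^2(\Lambda_\Gamma,\mu)$ extends to a bounded operator.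
   Context: The open unit ball $\mathbb B^{n+1}\subset\mathbb R^{n+1}$ with the Poincaré metric $d\rho=\frac{2\,dx}{1-\|x\|^2}$ is a model of hyperbolic $(n+1)$-space. $\mathrm{SO}^+(n+1,1)$ is identified with its isometry group, and its action extends to an action by conformal diffeomorphisms on the boundary $\mathbb S^n$. For a conformal diffeomorphism $\gamma$ of $\mathbb S^n$, $|\gamma'(x)|$ is the unique positive number such that $\gamma'(x)/|\gamma'(x)|$ is orthogonal, where $\gamma'(x)$ is the derivative of $\gamma$ at $x$ with respect to the round metric. A Kleinian group is a discrete subgroup $\Gamma\subset\mathrm{SO}^+(n+1,1)$. Its limit set is $\Lambda_\Gamma=\overline{\Gamma x}\cap\mathbb S^n$, for any $x\in\mathbb B^{n+1}$. $\Gamma$ is of the first kind if $\Lambda_\Gamma=\mathbb S^n$ and of the second kind otherwise. The convex core $\mathcal C(\Gamma)\subset\mathbb B^{n+1}$ is the union of all hyperbolic geodesics both of whose endpoints lie in $\Lambda_\Gamma$; $\Gamma$ is convex cocompact if $\mathcal C(\Gamma)/\Gamma$ is compact. $\Gamma$ is non-elementary if $\Lambda_\Gamma$ is infinite. For $\Gamma$ non-elementary and convex cocompact, the Hausdorff dimension $\delta>0$ of $\Lambda_\Gamma$ equals the critical exponent of the Poincaré series $\sum_{\gamma\in\Gamma}e^{-s\rho(0,\gamma 0)}$, and the Patterson-Sullivan measure $\mu$ is the finite Borel measure on $\Lambda_\Gamma$ obtained as weak-$*$ limit, as $s\downarrow\delta$, of the probability measures $\big(\sum_{\gamma\in\Gamma}e^{-s\rho(0,\gamma0)}\big)^{-1}\sum_{\gamma\in\Gamma}e^{-s\rho(0,\gamma0)}\delta_{\gamma0}$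 on $\overline{\mathbb B^{n+1}}$ (here $\delta_{\gamma 0}$ denotes the point mass at $\gamma0$). Known facts: $d\mu(\gamma(x))=|\gamma'(x)|^\delta d\mu(x)$ for $\gamma\in\Gamma$, and $(\Lambda_\Gamma,d,\mu)$ is Ahlfors $\delta$-regular, i.e. there is $C\ge1$ with $C^{-1}r^\delta\le\mu(\overline B(x,r))\le Cr^\delta$ for all $x\in\Lambda_\Gamma$, $0\le r<\operatorname{diam}\Lambda_\Gamma$. All Hilbert spaces are real. Write $X=\Lambda_\Gamma$. Let $$\operatorname{Dom}\mathcal E=\Big\{f\in L^2(X,\mu):\int_X\int_X\frac{|f(x)-f(y)|^2}{d(x,y)^\delta}\,d\mu(y)\,d\mu(x)<\infty\Big\},$$ $$\mathcal E(f,g)=\frac12\int_X\int_X\frac{(f(x)-f(y))(g(x)-g(y))}{d(x,y)^\delta}\,d\mu(y)\,d\mu(x),$$ the integrals being over the complement of the diagonal; this is a densely defined closed form. The logarithmic Dirichlet Laplacian $\Delta$ is the associated positive self-adjoint operator: if $R:L^2(X,\mu)\to\operatorname{Dom}\mathcal E$ is determined by $\langle Rf,g\rangle_{L^2}+\mathcal E(Rf,g)=\langle f,g\rangle_{L^2}$ for all $g\in\operatorname{Dom}\mathcal E$, then $\operatorname{Dom}\Delta=\operatorname{Im}R$ and $\Delta Rf=f-Rf$; thus $R=(1+\Delta)^{-1}$, $\operatorname{Dom}\mathcal E=\operatorname{Dom}\Delta^{1/2}$ and $\mathcal E(f,g)=\langle\Delta^{1/2}f,\Delta^{1/2}g\rangle_{L^2}$.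 *)

theory Defs
  imports "HOL-Analysis.Analysis" "HOL-Probability.Probability_Measure"
begin

section \<open>The group and its actions on the ball and on the sphere\<close>

text \<open>
  Minkowski space of dimension $CARD('n) + 1$ is \<^typ>\<open>real ^ 'n option\<close>: the index \<^term>\<open>None\<close> is the
  time coordinate, the indices \<^term>\<open>Some i\<close> are the space coordinates.
\<close>

definition minkowski :: "real ^ 'n \<Rightarrow> real \<Rightarrow> real ^ ('n::finite) option" where
  "minkowski v t = (\<chi> i. case i of None \<Rightarrow> t | Some k \<Rightarrow> v $ k)"

definition space_part :: "real ^ ('n::finite) option \<Rightarrow> real ^ 'n" where
  "space_part w = (\<chi> k. w $ Some k)"

definition time_part :: "real ^ ('n::finite) option \<Rightarrow> real" where
  "time_part w = w $ None"

definition lorentz_gram :: "real ^ (('n::finite) option) ^ 'n option" where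
  "lorentz_gram = (\<chi> i j. if i = j then (if i = None then -1 else 1) else 0)"

definition SO_plus :: "(real ^ (('n::finite) option) ^ 'n option) set" where
  "SO_plus = {A. transpose A ** lorentz_gram ** A = lorentz_gram \<and> det A = 1 \<and> A $ None $ None > 0}"

text \<open>
  The ball is identified with the upper sheet of the hyperboloid by stereographic projection from
  the point $(0,-1)$ (space, time); this is an isometry for the metric
  $4 \|dx\|^2 / (1 - \|x\|^2)^2$ on the ball. The boundary sphere is identified with the set of
  future light rays, a point $x$ corresponding to the ray through $(x, 1)$.
\<close>

definition ball_to_hyperboloid :: "real ^ 'n \<Rightarrow> real ^ ('n::finite) option" where
  "ball_to_hyperboloid x =
     minkowski ((2 / (1 - (norm x)\<^sup>2)) *\<^sub>R x) ((1 + (norm x)\<^sup>2) / (1 - (norm x)\<^sup>2))"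

definition hyperboloid_to_ball :: "real ^ ('n::finite) option \<Rightarrow> real ^ 'n" where
  "hyperboloid_to_ball w = (1 / (1 + time_part w)) *\<^sub>R space_part w"

definition ball_act :: "real ^ (('n::finite) option) ^ 'n option \<Rightarrow> real ^ 'n \<Rightarrow> real ^ 'n" where
  "ball_act A x = hyperboloid_to_ball (A *v ball_to_hyperboloid x)"

definition sphere_act :: "real ^ (('n::finite) option) ^ 'n option \<Rightarrow> real ^ 'n \<Rightarrow> real ^ 'n" where
  "sphere_act A x = (let w = A *v minkowski x 1 in (1 / time_part w) *\<^sub>R space_part w)"

text \<open>
  The number $|f'(x)|$ for a conformal map $f$ of the unit sphere. The tangent space at $x$ is the
  orthogonal complement of $x$; only the restriction of \<open>D\<close> to it is determined by \<open>f\<close>.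
\<close>

definition conformal_factor :: "('a::real_inner \<Rightarrow> 'a) \<Rightarrow> 'a \<Rightarrow> real" where
  "conformal_factor f x =
     (THE c. c > 0 \<and> (\<exists>D. (f has_derivative D) (at x within sphere 0 1) \<and>
        (\<forall>v w. v \<bullet> x = 0 \<longrightarrow> w \<bullet> x = 0 \<longrightarrow> (D v /\<^sub>R c) \<bullet> (D w /\<^sub>R c) = v \<bullet> w)))"


section \<open>Hyperbolic distance and geodesics\<close>

definition hyperbolic_length :: "(real \<Rightarrow> 'a::real_inner) \<Rightarrow> real" where
  "hyperbolic_length g =
     integral {0..1} (\<lambda>t. 2 * norm (vector_derivative g (at t)) / (1 - (norm (g t))\<^sup>2))"

definition hyperbolic_dist :: "'a::real_inner \<Rightarrow> 'a \<Rightarrow> real" where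
  "hyperbolic_dist x y =
     Inf {hyperbolic_length g | g. g C1_differentiable_on {0..1} \<and> g ` {0..1} \<subseteq> ball 0 1 \<and>
                                   g 0 = x \<and> g 1 = y}"

definition hyperbolic_geodesic :: "(real \<Rightarrow> 'a::real_inner) \<Rightarrow> bool" where
  "hyperbolic_geodesic c \<longleftrightarrow>
     range c \<subseteq> ball 0 1 \<and> (\<forall>s t. hyperbolic_dist (c s) (c t) = \<bar>s - t\<bar>)"


section \<open>Kleinian groups\<close>

definition kleinian_group :: "(real ^ (('n::finite) option) ^ 'n option) set \<Rightarrow> bool" where
  "kleinian_group \<Gamma> \<longleftrightarrow>
     \<Gamma> \<subseteq> SO_plus \<and> mat 1 \<in> \<Gamma> \<and> (\<forall>A\<in>\<Gamma>. \<forall>B\<in>\<Gamma>. A ** B \<in> \<Gamma>) \<and> (\<forall>A\<in>\<Gamma>. matrix_inv A \<in> \<Gamma>) \<and>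
     discrete \<Gamma>"

text \<open>The limit set does not depend on the base point; we take the centre of the ball.\<close>

definition limit_set :: "(real ^ (('n::finite) option) ^ 'n option) set \<Rightarrow> (real ^ 'n) set" where
  "limit_set \<Gamma> = closure ((\<lambda>A. ball_act A 0) ` \<Gamma>) \<inter> sphere 0 1"

definition second_kind :: "(real ^ (('n::finite) option) ^ 'n option) set \<Rightarrow> bool" where
  "second_kind \<Gamma> \<longleftrightarrow> limit_set \<Gamma> \<noteq> sphere 0 1"

definition non_elementary :: "(real ^ (('n::finite) option) ^ 'n option) set \<Rightarrow> bool" where
  "non_elementary \<Gamma> \<longleftrightarrow> infinite (limit_set \<Gamma>)"

definition convex_core :: "(real ^ (('n::finite) option) ^ 'n option) set \<Rightarrow> (real ^ 'n) set" where
  "convex_core \<Gamma> =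
     \<Union>{range c | c. hyperbolic_geodesic c \<and>
        (\<exists>\<xi>\<in>limit_set \<Gamma>. \<exists>\<eta>\<in>limit_set \<Gamma>. (c \<longlongrightarrow> \<xi>) at_bot \<and> (c \<longlongrightarrow> \<eta>) at_top)}"

definition quotient_topology :: "'a topology \<Rightarrow> ('a \<Rightarrow> 'b) \<Rightarrow> 'b topology" where
  "quotient_topology X q =
     topology (\<lambda>U. U \<subseteq> q ` topspace X \<and> openin X {x \<in> topspace X. q x \<in> U})"

lemma openin_quotient_topology:
  "openin (quotient_topology X q) U \<longleftrightarrow>
     U \<subseteq> q ` topspace X \<and> openin X {x \<in> topspace X. q x \<in> U}"
proof -
  have "istopology (\<lambda>U. U \<subseteq> q ` topspace X \<and> openin X {x \<in> topspace X. q x \<in> U})"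
    unfolding istopology_def
  proof (intro conjI allI impI)
    fix S T
    assume S: "S \<subseteq> q ` topspace X \<and> openin X {x \<in> topspace X. q x \<in> S}"
      and T: "T \<subseteq> q ` topspace X \<and> openin X {x \<in> topspace X. q x \<in> T}"
    have "{x \<in> topspace X. q x \<in> S \<inter> T} = {x \<in> topspace X. q x \<in> S} \<inter> {x \<in> topspace X. q x \<in> T}"
      by auto
    then show "openin X {x \<in> topspace X. q x \<in> S \<inter> T}"
      using S T by auto
    show "S \<inter> T \<subseteq> q ` topspace X" using S by auto
  next
    fix \<K>
    assume K: "\<forall>S\<in>\<K>. S \<subseteq> q ` topspace X \<and> openin X {x \<in> topspace X. q x \<in> S}"
    have "{x \<in> topspace X. q x \<in> \<Union>\<K>} = (\<Union>S\<in>\<K>. {x \<in> topspace X. q x \<in> S})"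
      by auto
    then show "openin X {x \<in> topspace X. q x \<in> \<Union>\<K>}"
      using K by auto
    show "\<Union>\<K> \<subseteq> q ` topspace X" using K by auto
  qed
  then show ?thesis
    by (simp add: quotient_topology_def topology_inverse')
qed

lemma quotient_map_quotient_topology: "quotient_map X (quotient_topology X q) q"
proof -
  have "{x \<in> topspace X. q x \<in> q ` topspace X} = topspace X"
    by auto
  then have "openin (quotient_topology X q) (q ` topspace X)"
    by (simp add: openin_quotient_topology)
  then have "topspace (quotient_topology X q) = q ` topspace X"
    by (meson openin_quotient_topology openin_subset openin_topspace subset_antisym)
  then show ?thesis
    by (simp add: quotient_map_def openin_quotient_topology)
qed

definition orbit :: "(real ^ (('n::finite) option) ^ 'n option) set \<Rightarrow> real ^ 'n \<Rightarrow> (real ^ 'n) set" where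
  "orbit \<Gamma> x = (\<lambda>A. ball_act A x) ` \<Gamma>"

definition convex_cocompact :: "(real ^ (('n::finite) option) ^ 'n option) set \<Rightarrow> bool" where
  "convex_cocompact \<Gamma> \<longleftrightarrow>
     compact_space (quotient_topology (top_of_set (convex_core \<Gamma>)) (orbit \<Gamma>))"


section \<open>Hausdorff dimension\<close>

definition hausdorff_premeasure :: "real \<Rightarrow> real \<Rightarrow> 'a::metric_space set \<Rightarrow> ennreal" where
  "hausdorff_premeasure s \<epsilon> S =
     Inf {(\<Sum>i. ennreal (diameter (U i) powr s)) | U :: nat \<Rightarrow> 'a set.
            S \<subseteq> (\<Union>i. U i) \<and> (\<forall>i. bounded (U i) \<and> diameter (U i) \<le> \<epsilon>)}"

definition hausdorff_measure :: "real \<Rightarrow> 'a::metric_space set \<Rightarrow> ennreal" where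
  "hausdorff_measure s S = (SUP \<epsilon>\<in>{0<..}. hausdorff_premeasure s \<epsilon> S)"

text \<open>
  Only exponents $s > 0$ are used, so that the convention \<open>0 powr 0 = 0\<close> plays no role. For a subset
  of a Euclidean space the set of exponents is nonempty.
\<close>

definition hausdorff_dim :: "'a::metric_space set \<Rightarrow> real" where
  "hausdorff_dim S = Inf {s. s > 0 \<and> hausdorff_measure s S = 0}"


section \<open>The Patterson--Sullivan measure\<close>

definition poincare_series :: "(real ^ (('n::finite) option) ^ 'n option) set \<Rightarrow> real \<Rightarrow> ennreal" where
  "poincare_series \<Gamma> s =
     (\<integral>\<^sup>+A. ennreal (exp (- s * hyperbolic_dist 0 (ball_act A 0))) \<partial>count_space \<Gamma>)"

text \<open>
  The weighted sum of point masses at the points $A 0$, $A \<in> \<Gamma>$, is the image of the weighted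
  counting measure on the group. It is the zero measure if the Poincare series diverges.
\<close>

definition orbit_measure :: "(real ^ (('n::finite) option) ^ 'n option) set \<Rightarrow> real \<Rightarrow> (real ^ 'n) measure" where
  "orbit_measure \<Gamma> s =
     distr
       (density (count_space \<Gamma>)
          (\<lambda>A. ennreal (exp (- s * hyperbolic_dist 0 (ball_act A 0))) / poincare_series \<Gamma> s))
       (restrict_space borel (cball 0 1))
       (\<lambda>A. ball_act A 0)"

definition patterson_sullivan_measure ::
    "(real ^ (('n::finite) option) ^ 'n option) set \<Rightarrow> real \<Rightarrow> (real ^ 'n) measure \<Rightarrow> bool" where
  "patterson_sullivan_measure \<Gamma> \<delta> \<mu> \<longleftrightarrow>
     sets \<mu> = sets (restrict_space borel (limit_set \<Gamma>)) \<and> finite_measure \<mu> \<and>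
     (\<forall>s>\<delta>. prob_space (orbit_measure \<Gamma> s)) \<and>
     (\<forall>\<phi> :: real ^ 'n \<Rightarrow> real. continuous_on (cball 0 1) \<phi> \<longrightarrow>
        ((\<lambda>s. \<integral>x. \<phi> x \<partial>orbit_measure \<Gamma> s) \<longlongrightarrow> (\<integral>x. \<phi> x \<partial>\<mu>)) (at_right \<delta>))"


section \<open>The logarithmic Dirichlet Laplacian\<close>

text \<open>
  Elements of $L^2$ are represented by square integrable functions. The operators below respect
  equality almost everywhere, and identities between elements of $L^2$ are stated almost everywhere.
\<close>

definition L2 :: "'a measure \<Rightarrow> ('a \<Rightarrow> real) set" where
  "L2 \<mu> = {f \<in> borel_measurable \<mu>. integrable \<mu> (\<lambda>x. (f x)\<^sup>2)}"

definition L2_inner :: "'a measure \<Rightarrow> ('a \<Rightarrow> real) \<Rightarrow> ('a \<Rightarrow> real) \<Rightarrow> real" where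
  "L2_inner \<mu> f g = (\<integral>x. f x * g x \<partial>\<mu>)"

definition L2_norm :: "'a measure \<Rightarrow> ('a \<Rightarrow> real) \<Rightarrow> real" where
  "L2_norm \<mu> f = sqrt (L2_inner \<mu> f f)"

text \<open>The integrands of the following double integrals vanish on the diagonal.\<close>

definition form_dom :: "real \<Rightarrow> 'a::metric_space measure \<Rightarrow> ('a \<Rightarrow> real) set" where
  "form_dom \<delta> \<mu> =
     {f \<in> L2 \<mu>. (\<integral>\<^sup>+x. \<integral>\<^sup>+y. ennreal (\<bar>f x - f y\<bar>\<^sup>2 / dist x y powr \<delta>) \<partial>\<mu> \<partial>\<mu>) < \<infinity>}"

definition form :: "real \<Rightarrow> 'a::metric_space measure \<Rightarrow> ('a \<Rightarrow> real) \<Rightarrow> ('a \<Rightarrow> real) \<Rightarrow> real" where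
  "form \<delta> \<mu> f g =
     1/2 * (\<integral>x. \<integral>y. (f x - f y) * (g x - g y) / dist x y powr \<delta> \<partial>\<mu> \<partial>\<mu>)"

text \<open>\<open>is_resolvent \<delta> \<mu> f u\<close> says that $u = R f$ in $L^2$.\<close>

definition is_resolvent ::
    "real \<Rightarrow> 'a::metric_space measure \<Rightarrow> ('a \<Rightarrow> real) \<Rightarrow> ('a \<Rightarrow> real) \<Rightarrow> bool" where
  "is_resolvent \<delta> \<mu> f u \<longleftrightarrow>
     f \<in> L2 \<mu> \<and> u \<in> form_dom \<delta> \<mu> \<and>
     (\<forall>g\<in>form_dom \<delta> \<mu>. L2_inner \<mu> u g + form \<delta> \<mu> u g = L2_inner \<mu> f g)"

definition laplacian_dom :: "real \<Rightarrow> 'a::metric_space measure \<Rightarrow> ('a \<Rightarrow> real) set" where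
  "laplacian_dom \<delta> \<mu> = {u. \<exists>f. is_resolvent \<delta> \<mu> f u}"

text \<open>Since the form is densely defined, the chosen function is unique up to a null set.\<close>

definition laplacian :: "real \<Rightarrow> 'a::metric_space measure \<Rightarrow> ('a \<Rightarrow> real) \<Rightarrow> 'a \<Rightarrow> real" where
  "laplacian \<delta> \<mu> u = (SOME w. \<exists>f. is_resolvent \<delta> \<mu> f u \<and> w = (\<lambda>x. f x - u x))"

definition bounded_operator_L2 :: "'a measure \<Rightarrow> (('a \<Rightarrow> real) \<Rightarrow> 'a \<Rightarrow> real) \<Rightarrow> bool" where
  "bounded_operator_L2 \<mu> T \<longleftrightarrow>
     (\<forall>f\<in>L2 \<mu>. T f \<in> L2 \<mu>) \<and>
     (\<forall>f\<in>L2 \<mu>. \<forall>g\<in>L2 \<mu>. AE x in \<mu>. T (\<lambda>y. f y + g y) x = T f x + T g x) \<and>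
     (\<forall>c. \<forall>f\<in>L2 \<mu>. AE x in \<mu>. T (\<lambda>y. c * f y) x = c * T f x) \<and>
     (\<exists>C. \<forall>f\<in>L2 \<mu>. L2_norm \<mu> (T f) \<le> C * L2_norm \<mu> f)"

definition boundary_unitary ::
    "real \<Rightarrow> real ^ (('n::finite) option) ^ 'n option \<Rightarrow> (real ^ 'n \<Rightarrow> real) \<Rightarrow> real ^ 'n \<Rightarrow> real" where
  "boundary_unitary \<delta> A f =
     (\<lambda>x. conformal_factor (sphere_act (matrix_inv A)) x powr (\<delta> / 2) *
          f (sphere_act (matrix_inv A) x))"

end

theory Submission
  imports Defs
begin

text \<open>
  Put \<open>g = \<gamma>\<^sup>-\<^sup>1\<close> and \<open>a = |g'| powr (\<delta>/2)\<close>, so that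
  \<open>U(\<gamma>) f = a \<cdot> (f \<circ> g)\<close>. The proof shows that the commutator is a multiplication
  operator after \<open>U(\<gamma>)\<close>: \<open>[\<Delta>, U(\<gamma>)] f = b \<cdot> U(\<gamma>) f\<close> with the
  bounded function \<open>b(x) = (1 / a(x)) \<integral> (a(x) - a(y)) / d(x,y) powr \<delta> d\<mu>(y)\<close>.

  The map \<open>g\<close> scales the kernel and the measure in opposite ways: \<open>d(gx,gy) powr \<delta> = a(x) a(y)
  d(x,y) powr \<delta>\<close>, and \<open>g\<close> maps the measure \<open>a\<^sup>2 \<mu>\<close> to
  \<open>\<mu>\<close>. Write \<open>F\<close>, \<open>F'\<close> for \<open>f(gx)\<close>, \<open>f(gy)\<close>, write
  \<open>H\<close>, \<open>H'\<close> for \<open>h(gx)\<close>, \<open>h(gy)\<close>, and write \<open>a\<close>,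
  \<open>a'\<close> for \<open>a(x)\<close>, \<open>a(y)\<close>. Then \<open>(aF - a'F')(aH - a'H') = aa'(F - F')(H -
  H') + (aFH - a'F'H')(a - a')\<close>. Divided by \<open>d(x,y) powr \<delta>\<close> and integrated, the first summand
  gives \<open>\<E>(f,h)\<close> by the two scaling laws. In the second summand the kernel \<open>(a - a') / d(x,y) powr
  \<delta>\<close> is antisymmetric, so its two parts contribute equally, and together they give the inner product of
  \<open>b \<cdot> U f\<close> and \<open>U h\<close>. Hence \<open>\<E>(Uf,Uh) = \<E>(f,h) + \<langle>b Uf,
  Uh\<rangle>\<close> (\<open>form_weighted_composition\<close>). Every element of the form domain is of the shape
  \<open>Uh\<close>, because \<open>\<gamma>\<close> also acts in this way, so the identity moves a resolvent equation
  for \<open>f\<close> to one for \<open>Uf\<close> (\<open>is_resolvent_weighted_composition\<close>).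

  All integrals converge, and \<open>b\<close> is bounded, because \<open>a\<close> is Lipschitz and \<open>\<integral>
  d(x,y) powr (1 - \<delta>) d\<mu>(y)\<close> is bounded uniformly in \<open>x\<close>. For \<open>\<delta> < 1\<close>
  the integrand is bounded; for \<open>\<delta> \<ge> 1\<close> the bound comes from \<open>\<mu>(B(x,r)) \<le> C r powr
  \<delta>\<close>, summed over dyadic annuli.

  Two facts on \<open>\<mu>\<close> thus carry the proof, and both are derived from its definition as a limit of orbit
  measures. The scaling law of \<open>\<mu>\<close> (\<open>mu_measure_scaling\<close>) holds because the left
  translation by a group element permutes the point masses and changes the weight \<open>exp (- s \<rho>(0, B0))\<close>
  by a power of a function that extends continuously to the closed ball and equals the conformal factor on the sphere.
  The bound on balls (\<open>upper_regular\<close>) uses that, by convex cocompactness, each point of a geodesic between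
  two limit points is moved into a fixed smaller ball by a group element. For the point at distance about
  \<open>r\<close> from the endpoint \<open>x\<close> this gives an \<open>A\<close> with \<open>|A'| \<ge> c/r\<close>
  on \<open>B(x,r)\<close>, and then the scaling law bounds \<open>(c/r) powr \<delta> \<mu>(B(x,r))\<close> by the
  total mass.
\<close>

section \<open>Hyperbolic distance and geodesics in the unit ball\<close>

text \<open>
  Half the difference of the Busemann functions of the boundary points \<open>y\<close> and \<open>x\<close>. It is
  1-Lipschitz for the hyperbolic distance and restricts to the arc length parameter on the geodesic from
  \<open>y\<close> to \<open>x\<close>, so it certifies that this geodesic minimises length.
\<close>

definition endpoint_ratio :: "'a::real_inner \<Rightarrow> 'a \<Rightarrow> 'a \<Rightarrow> real" where
  "endpoint_ratio x y p = (ln ((p - y) \<bullet> (p - y)) - ln ((p - x) \<bullet> (p - x))) / 2"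

text \<open>
  Up to an orthogonal map the vector is the image of \<open>x\<close> under the hyperbolic isometry that moves
  \<open>p\<close> to the centre, which is why it lies on the unit sphere.
\<close>

lemma inversion_unit_vector:
  fixes x p :: "'a::real_inner"
  assumes x: "norm x = 1" and p: "p \<noteq> x"
  shows "norm (((1 - (norm p)\<^sup>2) / (norm (p - x))\<^sup>2) *\<^sub>R (p - x) + p) = 1"
proof -
  define v where "v = p - x"
  define q where "q = (norm v)\<^sup>2"
  define D where "D = 1 - (norm p)\<^sup>2"
  have q: "q > 0" using p by (simp add: q_def v_def)
  have xx: "x \<bullet> x = 1" using x by (simp add: dot_square_norm)
  have pp: "p \<bullet> p = 1 - D" by (simp add: D_def dot_square_norm)
  have vv: "v \<bullet> v = q" by (simp add: q_def dot_square_norm)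
  have "x = p - v" by (simp add: v_def)
  then have "(p - v) \<bullet> (p - v) = 1" using xx by simp
  then have vp: "v \<bullet> p = (q - D) / 2"
    by (simp add: inner_diff_left inner_diff_right pp vv inner_commute)

  have "(w + p) \<bullet> (w + p) = w \<bullet> w + 2 * (w \<bullet> p) + p \<bullet> p" for w
    by (simp add: inner_add_left inner_add_right inner_commute[of p w])
  then have "((D / q) *\<^sub>R v + p) \<bullet> ((D / q) *\<^sub>R v + p) =
      (D / q) * (D / q) * (v \<bullet> v) + 2 * ((D / q) * (v \<bullet> p)) + p \<bullet> p"
    by simp
  also have "\<dots> = (D / q) * (D / q) * q + 2 * ((D / q) * ((q - D) / 2)) + (1 - D)"
    by (simp only: vv vp pp)
  also have "(D / q) * (D / q) * q = D * (D / q)" using q by simp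
  also have "2 * ((D / q) * ((q - D) / 2)) = D - D * (D / q)" using q by (simp add: field_simps)
  also have "D * (D / q) + (D - D * (D / q)) + (1 - D) = 1" by simp
  finally show ?thesis unfolding norm_eq_1 v_def[symmetric] q_def[symmetric] D_def[symmetric] .
qed

text \<open>
  The left side is the Euclidean gradient of \<open>endpoint_ratio x y\<close> at \<open>p\<close>. Multiplied by
  \<open>1 - |p|\<^sup>2\<close> it is the difference of two unit vectors, so its hyperbolic norm is at most 1.
\<close>

lemma endpoint_ratio_gradient_bound:
  fixes x y p :: "'a::real_inner"
  assumes "norm x = 1" "norm y = 1" "norm p < 1"
  shows "norm (((p - y) /\<^sub>R (norm (p - y))\<^sup>2) - ((p - x) /\<^sub>R (norm (p - x))\<^sup>2)) \<le> 2 / (1 - (norm p)\<^sup>2)"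
proof -
  let ?w = "\<lambda>z. ((1 - (norm p)\<^sup>2) / (norm (p - z))\<^sup>2) *\<^sub>R (p - z) + p"
  let ?d = "((p - y) /\<^sub>R (norm (p - y))\<^sup>2) - ((p - x) /\<^sub>R (norm (p - x))\<^sup>2)"
  have D: "1 - (norm p)\<^sup>2 > 0" using assms(3) by (simp add: abs_square_less_1)
  have "?w y - ?w x = (1 - (norm p)\<^sup>2) *\<^sub>R ?d"
    by (simp add: scaleR_diff_right divide_inverse)
  then have "(1 - (norm p)\<^sup>2) * norm ?d = norm (?w y - ?w x)"
    using D by simp
  also have "\<dots> \<le> norm (?w y) + norm (?w x)" by (rule norm_triangle_ineq4)
  also have "\<dots> = 2"
    using inversion_unit_vector[of y p] inversion_unit_vector[of x p] assms by force
  finally show ?thesis using D by (simp add: field_simps)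
qed

lemma endpoint_ratio_le_length:
  fixes g :: "real \<Rightarrow> 'a::euclidean_space"
  assumes x: "norm x = 1" and y: "norm y = 1"
    and g: "g C1_differentiable_on {0..1}" and ball: "g ` {0..1} \<subseteq> ball 0 1"
  shows "endpoint_ratio x y (g 1) - endpoint_ratio x y (g 0) \<le> hyperbolic_length g"
proof -
  obtain D where D: "\<And>t. t \<in> {0..1} \<Longrightarrow> (g has_vector_derivative D t) (at t)"
      and cD: "continuous_on {0..1} D"
    using g unfolding C1_differentiable_on_def by blast
  have cg: "continuous_on {0..1} g"
    using D by (meson continuous_at_imp_continuous_on has_vector_derivative_continuous)
  have n1: "norm (g t) < 1" if "t \<in> {0..1}" for t
  proof -
    have "g t \<in> ball 0 1" using ball that by blast
    then show ?thesis by simp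
  qed
  have n2: "1 - (norm (g t))\<^sup>2 > 0" if "t \<in> {0..1}" for t
    using n1[OF that] by (simp add: abs_square_less_1)
  define G where "G = (\<lambda>t. ((g t - y) /\<^sub>R (norm (g t - y))\<^sup>2) - ((g t - x) /\<^sub>R (norm (g t - x))\<^sup>2))"
  have der: "((\<lambda>t. endpoint_ratio x y (g t)) has_vector_derivative (G t \<bullet> D t)) (at t within {0..1})"
    if t: "t \<in> {0..1}" for t
  proof -
    have nz: "g t \<noteq> y" "g t \<noteq> x" using n1[OF t] x y by auto
    have d: "(g has_derivative (\<lambda>h. h *\<^sub>R D t)) (at t within {0..1})"
      using D[OF t] has_vector_derivative_at_within unfolding has_vector_derivative_def by blast
    have *: "((\<lambda>t. ln ((g t - z) \<bullet> (g t - z))) has_derivative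
        (\<lambda>h. h * (2 * (((g t - z) /\<^sub>R (norm (g t - z))\<^sup>2) \<bullet> D t)))) (at t within {0..1})"
      if z: "g t \<noteq> z" for z
    proof -
      have pos: "(g t - z) \<bullet> (g t - z) > 0" using z by simp
      have "((\<lambda>t. (g t - z) \<bullet> (g t - z)) has_derivative (\<lambda>h. h * (2 * ((g t - z) \<bullet> D t)))) (at t within {0..1})"
        by (rule derivative_eq_intros d refl)+ (simp add: inner_commute fun_eq_iff)
      from has_derivative_ln[OF pos this] show ?thesis
        by (simp add: power2_norm_eq_inner divide_inverse mult_ac)
    qed
    have "((\<lambda>t. (1 / 2) * (ln ((g t - y) \<bullet> (g t - y)) - ln ((g t - x) \<bullet> (g t - x)))) has_derivative
        (\<lambda>h. (1 / 2) * (h * (2 * (((g t - y) /\<^sub>R (norm (g t - y))\<^sup>2) \<bullet> D t)) -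
          h * (2 * (((g t - x) /\<^sub>R (norm (g t - x))\<^sup>2) \<bullet> D t))))) (at t within {0..1})"
      by (intro has_derivative_mult_right has_derivative_diff *[OF nz(1)] *[OF nz(2)])
    moreover have "(\<lambda>h. (1 / 2) * (h * (2 * (((g t - y) /\<^sub>R (norm (g t - y))\<^sup>2) \<bullet> D t)) -
          h * (2 * (((g t - x) /\<^sub>R (norm (g t - x))\<^sup>2) \<bullet> D t)))) = (\<lambda>h. h *\<^sub>R (G t \<bullet> D t))"
      unfolding G_def inner_diff_left by (rule ext) (simp add: algebra_simps)
    ultimately show ?thesis
      unfolding has_vector_derivative_def endpoint_ratio_def by simp
  qed
  have int: "((\<lambda>t. G t \<bullet> D t) has_integral
      endpoint_ratio x y (g 1) - endpoint_ratio x y (g 0)) {0..1}"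
    by (rule fundamental_theorem_of_calculus) (use der in auto)
  let ?L = "\<lambda>t. 2 * norm (vector_derivative g (at t)) / (1 - (norm (g t))\<^sup>2)"
  have vd: "vector_derivative g (at t) = D t" if "t \<in> {0..1}" for t
    using D[OF that] by (rule vector_derivative_at)
  have "continuous_on {0..1} (\<lambda>t. 2 * norm (D t) / (1 - (norm (g t))\<^sup>2))"
    using n2 by (intro continuous_intros cg cD) fastforce
  then have "?L integrable_on {0..1}"
    using continuous_on_cong[OF refl, of "{0..1}" ?L] vd by (intro integrable_continuous_interval) auto
  then have "(?L has_integral hyperbolic_length g) {0..1}"
    unfolding hyperbolic_length_def by (rule integrable_integral)
  with int show ?thesis
  proof (rule has_integral_le)
    fix t :: real assume t: "t \<in> {0..1}"
    have "G t \<bullet> D t \<le> norm (G t) * norm (D t)" by (rule norm_cauchy_schwarz)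
    also have "\<dots> \<le> 2 / (1 - (norm (g t))\<^sup>2) * norm (D t)"
      unfolding G_def using endpoint_ratio_gradient_bound[OF x y n1[OF t]]
      by (rule mult_right_mono) simp
    finally show "G t \<bullet> D t \<le> ?L t" using vd[OF t] by simp
  qed
qed

text \<open>
  In the hyperboloid model this is \<open>(e\<^sup>t X + e\<^sup>-\<^sup>t Y) / |x - y|\<close>, where \<open>X =
  (x,1)\<close> and \<open>Y = (y,1)\<close> are the light rays of the endpoints; the quotient below is its image in the
  ball.
\<close>

definition geodesic_between :: "'a::real_inner \<Rightarrow> 'a \<Rightarrow> real \<Rightarrow> 'a" where
  "geodesic_between x y t = (exp t *\<^sub>R x + exp (- t) *\<^sub>R y) /\<^sub>R (norm (x - y) + exp t + exp (- t))"

context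
  fixes x y :: "'a::euclidean_space" and m :: real
  assumes x: "norm x = 1" and y: "norm y = 1" and xy: "x \<noteq> y"
  defines "m \<equiv> norm (x - y)"
begin

lemma chord_pos: "m > 0" using xy by (simp add: m_def)

lemma chord_inner: "2 * (x \<bullet> y) = 2 - m\<^sup>2"
  using x y by (simp add: m_def power2_norm_eq_inner inner_diff_left inner_diff_right norm_eq_1 inner_commute)

lemma exp_mult_exp_minus: "exp t * exp (- t) = (1::real)"
  by (simp add: exp_add[symmetric])

lemma geodesic_denominator_pos: "m + exp t + exp (- t) > 0"
  using chord_pos exp_gt_zero[of t] exp_gt_zero[of "- t"] by linarith

lemma geodesic_between_norm:
  "1 - (norm (geodesic_between x y t))\<^sup>2 = 2 * m / (m + exp t + exp (- t))"
proof -
  let ?e = "exp t" and ?f = "exp (- t)"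
  have ef: "?e * ?f = 1" by (rule exp_mult_exp_minus)
  have xx: "x \<bullet> x = 1" "y \<bullet> y = 1" using x y by (simp_all add: dot_square_norm)
  have "(norm (?e *\<^sub>R x + ?f *\<^sub>R y))\<^sup>2 = ?e * ?e + ?f * ?f + (?e * ?f) * (2 * (x \<bullet> y))"
    by (simp add: power2_norm_eq_inner inner_add_left inner_add_right inner_commute[of y x] xx algebra_simps)
  also have "\<dots> = (?e + ?f)\<^sup>2 - m\<^sup>2"
    using ef unfolding chord_inner by (simp add: power2_eq_square algebra_simps)
  finally have N: "(norm (?e *\<^sub>R x + ?f *\<^sub>R y))\<^sup>2 = (?e + ?f)\<^sup>2 - m\<^sup>2" .
  have "(norm (geodesic_between x y t))\<^sup>2 = ((?e + ?f)\<^sup>2 - m\<^sup>2) / (m + ?e + ?f)\<^sup>2"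
    unfolding geodesic_between_def m_def[symmetric]
    by (simp add: power_mult_distrib power_divide N divide_inverse mult.commute power_inverse)
  then have eq: "1 - (norm (geodesic_between x y t))\<^sup>2 = 1 - ((?e + ?f)\<^sup>2 - m\<^sup>2) / (m + ?e + ?f)\<^sup>2"
    by simp
  have "1 - (S\<^sup>2 - m\<^sup>2) / (m + S)\<^sup>2 = 2 * m / (m + S)" if "m + S > 0" for S
  proof -
    have "(S\<^sup>2 - m\<^sup>2) / (m + S)\<^sup>2 = (S - m) / (m + S)"
      using that by (simp add: frac_eq_eq) (simp add: power2_eq_square algebra_simps)
    moreover have "1 - (S - m) / (m + S) = 2 * m / (m + S)"
      using that by (simp add: field_simps)
    ultimately show ?thesis by simp
  qed
  from this[of "?e + ?f"] show ?thesis
    unfolding eq using geodesic_denominator_pos[of t] by (simp add: add.assoc)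
qed

lemma geodesic_between_in_ball: "norm (geodesic_between x y t) < 1"
proof -
  have "1 - (norm (geodesic_between x y t))\<^sup>2 > 0"
    unfolding geodesic_between_norm using chord_pos geodesic_denominator_pos by simp
  then show ?thesis by (simp add: abs_square_less_1)
qed

definition geodesic_velocity :: "real \<Rightarrow> 'a" where
  "geodesic_velocity t =
     (exp t *\<^sub>R x - exp (- t) *\<^sub>R y) /\<^sub>R (m + exp t + exp (- t)) -
     ((exp t - exp (- t)) / (m + exp t + exp (- t))\<^sup>2) *\<^sub>R (exp t *\<^sub>R x + exp (- t) *\<^sub>R y)"

lemma geodesic_between_derivative:
  "(geodesic_between x y has_vector_derivative geodesic_velocity t) (at t within T)"
proof -
  let ?h = "\<lambda>t. inverse (m + exp t + exp (- t))"
  have nz: "m + exp t + exp (- t) \<noteq> 0" using geodesic_denominator_pos[of t] by simp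
  have 1: "(?h has_real_derivative - ((exp t - exp (- t)) / (m + exp t + exp (- t))\<^sup>2)) (at t within T)"
    by (rule derivative_eq_intros refl nz)+ (use nz in \<open>simp add: field_simps power2_eq_square\<close>)
  have 2: "((\<lambda>t. exp t *\<^sub>R x + exp (- t) *\<^sub>R y) has_vector_derivative (exp t *\<^sub>R x - exp (- t) *\<^sub>R y))
      (at t within T)"
    by (auto intro!: derivative_eq_intros simp: has_vector_derivative_def scaleR_diff_right mult.commute
        algebra_simps)
  show ?thesis
    using has_vector_derivative_scaleR[OF 1 2]
    unfolding geodesic_between_def[abs_def] geodesic_velocity_def m_def[symmetric] by simp
qed

lemma geodesic_between_speed:
  "2 * norm (geodesic_velocity t) / (1 - (norm (geodesic_between x y t))\<^sup>2) = 1"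
proof -
  let ?e = "exp t" and ?f = "exp (- t)"
  define S where "S = ?e + ?f"
  define d where "d = ?e - ?f"
  define N where "N = ?e *\<^sub>R x + ?f *\<^sub>R y"
  define N' where "N' = ?e *\<^sub>R x - ?f *\<^sub>R y"
  have ef: "?e * ?f = 1" by (rule exp_mult_exp_minus)
  have xx: "x \<bullet> x = 1" "y \<bullet> y = 1" using x y by (simp_all add: dot_square_norm)
  have W: "m + S > 0" using geodesic_denominator_pos[of t] by (simp add: S_def)
  have "N \<bullet> N = ?e * ?e + ?f * ?f + (?e * ?f) * (2 * (x \<bullet> y))"
    unfolding N_def by (simp add: inner_add_left inner_add_right inner_commute[of y x] xx algebra_simps)
  then have NN: "N \<bullet> N = S\<^sup>2 - m\<^sup>2"
    using ef unfolding chord_inner S_def by (simp add: power2_eq_square algebra_simps)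
  have "N' \<bullet> N' = ?e * ?e + ?f * ?f - (?e * ?f) * (2 * (x \<bullet> y))"
    unfolding N'_def by (simp add: inner_diff_left inner_diff_right inner_commute[of y x] xx algebra_simps)
  then have N'N': "N' \<bullet> N' = d\<^sup>2 + m\<^sup>2"
    using ef unfolding chord_inner d_def by (simp add: power2_eq_square algebra_simps)
  have NN': "N' \<bullet> N = S * d"
    unfolding N_def N'_def S_def d_def
    by (simp add: inner_diff_left inner_add_right inner_commute[of y x] xx algebra_simps)
  have v: "geodesic_velocity t = (1 / (m + S)) *\<^sub>R N' - (d / (m + S)\<^sup>2) *\<^sub>R N"
    unfolding geodesic_velocity_def N_def N'_def S_def d_def by (simp add: divide_inverse add.assoc)
  have Sd: "S\<^sup>2 = d\<^sup>2 + 4"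
    using ef unfolding S_def d_def by (simp add: power2_eq_square algebra_simps)
  have "(norm (geodesic_velocity t))\<^sup>2 =
      (1 / (m + S))\<^sup>2 * (d\<^sup>2 + m\<^sup>2) - 2 * (1 / (m + S)) * (d / (m + S)\<^sup>2) * (S * d) + (d / (m + S)\<^sup>2)\<^sup>2 * (S\<^sup>2 - m\<^sup>2)"
    unfolding v power2_norm_eq_inner
    by (simp add: inner_diff_left inner_diff_right inner_commute[of N N'] NN NN' N'N' power2_eq_square
        ring_distribs add_divide_distrib diff_divide_distrib mult_ac)
  also have "\<dots> = (m / (m + S))\<^sup>2"
  proof -
    have *: "(1 / W)\<^sup>2 * (d\<^sup>2 + m\<^sup>2) - 2 * (1 / W) * (d / W\<^sup>2) * (S * d) + (d / W\<^sup>2)\<^sup>2 * (S\<^sup>2 - m\<^sup>2) =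
          ((d\<^sup>2 + m\<^sup>2) * W\<^sup>2 - 2 * d\<^sup>2 * S * W + d\<^sup>2 * (S\<^sup>2 - m\<^sup>2)) / W ^ 4" if "W > 0" for W
      using that by (simp add: field_simps power2_eq_square power4_eq_xxxx)
    have "(d\<^sup>2 + m\<^sup>2) * (m + S)\<^sup>2 - 2 * d\<^sup>2 * S * (m + S) + d\<^sup>2 * (S\<^sup>2 - m\<^sup>2) = m\<^sup>2 * (m + S)\<^sup>2"
      by (simp add: power2_eq_square algebra_simps)
    then show ?thesis
      unfolding *[OF W] using W by (simp add: power_divide power4_eq_xxxx power2_eq_square)
  qed
  finally have "norm (geodesic_velocity t) = m / (m + S)"
    using W chord_pos by (simp add: power2_eq_iff_nonneg)
  then show ?thesis
    unfolding geodesic_between_norm using W chord_pos by (simp add: S_def add.assoc)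
qed

lemma endpoint_ratio_geodesic: "endpoint_ratio x y (geodesic_between x y t) = t"
proof -
  let ?e = "exp t" and ?f = "exp (- t)"
  define W where "W = m + ?e + ?f"
  have W: "W > 0" using geodesic_denominator_pos[of t] by (simp add: W_def)
  have ef: "?e * ?f = 1" by (rule exp_mult_exp_minus)
  have xx: "x \<bullet> x = 1" "y \<bullet> y = 1" using x y by (simp_all add: dot_square_norm)
  let ?c = "geodesic_between x y t"
  have cc: "?c \<bullet> ?c = 1 - 2 * m / W"
    using geodesic_between_norm[of t] by (simp add: dot_square_norm W_def)
  have c: "?c = (?e / W) *\<^sub>R x + (?f / W) *\<^sub>R y"
    unfolding geodesic_between_def m_def[symmetric] W_def[symmetric]
    by (simp add: scaleR_add_right divide_inverse mult.commute)
  have xy': "x \<bullet> y = 1 - m\<^sup>2 / 2" using chord_inner by simp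
  have gen: "2 - 2 * m / W - 2 * (\<alpha> / W + \<beta> / W * (1 - m\<^sup>2 / 2)) = \<beta> * m\<^sup>2 / W"
    if "W = m + \<alpha> + \<beta>" for \<alpha> \<beta>
  proof -
    have "2 - 2 * m / W - 2 * (\<alpha> / W + \<beta> / W * (1 - m\<^sup>2 / 2)) = (2 * W - 2 * m - 2 * \<alpha> - 2 * \<beta> + \<beta> * m\<^sup>2) / W"
      using W by (simp add: field_simps)
    then show ?thesis by (simp add: that)
  qed
  have "(?c - x) \<bullet> (?c - x) = 2 - 2 * m / W - 2 * (?c \<bullet> x)"
    by (simp add: inner_diff_left inner_diff_right inner_commute[of x ?c] cc xx)
  also have "?c \<bullet> x = ?e / W + ?f / W * (1 - m\<^sup>2 / 2)"
    unfolding c by (simp add: inner_add_left inner_commute[of y x] xx xy')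
  also have "2 - 2 * m / W - 2 * (?e / W + ?f / W * (1 - m\<^sup>2 / 2)) = ?f * m\<^sup>2 / W"
    by (rule gen) (simp add: W_def)
  finally have 1: "(?c - x) \<bullet> (?c - x) = ?f * m\<^sup>2 / W" .
  have "(?c - y) \<bullet> (?c - y) = 2 - 2 * m / W - 2 * (?c \<bullet> y)"
    by (simp add: inner_diff_left inner_diff_right inner_commute[of y ?c] cc xx)
  also have "?c \<bullet> y = ?f / W + ?e / W * (1 - m\<^sup>2 / 2)"
    unfolding c by (simp add: inner_add_left xx xy')
  also have "2 - 2 * m / W - 2 * (?f / W + ?e / W * (1 - m\<^sup>2 / 2)) = ?e * m\<^sup>2 / W"
    by (rule gen) (simp add: W_def)
  finally have 2: "(?c - y) \<bullet> (?c - y) = ?e * m\<^sup>2 / W" .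
  show ?thesis
    unfolding endpoint_ratio_def 1 2 using W chord_pos by (simp add: ln_div ln_mult)
qed

text \<open>
  The segment itself has length \<open>|s - t|\<close> since it has unit speed, and every other curve is at least as
  long because \<open>endpoint_ratio\<close> increases by \<open>t - s\<close> along it. For a decrease the roles of the
  endpoints are exchanged, which changes the sign of \<open>endpoint_ratio\<close>.
\<close>

lemma hyperbolic_dist_geodesic:
  "hyperbolic_dist (geodesic_between x y s) (geodesic_between x y t) = \<bar>s - t\<bar>"
proof -
  let ?c = "geodesic_between x y"
  let ?A = "{hyperbolic_length g | g. g C1_differentiable_on {0..1} \<and> g ` {0..1} \<subseteq> ball 0 1 \<and>
                                   g 0 = ?c s \<and> g 1 = ?c t}"
  have lower: "\<bar>s - t\<bar> \<le> l" if l: "l \<in> ?A" for l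
  proof -
    obtain g where g: "l = hyperbolic_length g" "g C1_differentiable_on {0..1}" "g ` {0..1} \<subseteq> ball 0 1"
        "g 0 = ?c s" "g 1 = ?c t" using l by blast
    have "endpoint_ratio y x p = - endpoint_ratio x y p" for p
      by (simp add: endpoint_ratio_def field_simps)
    then show ?thesis
      using endpoint_ratio_le_length[OF x y g(2,3)] endpoint_ratio_le_length[OF y x g(2,3)] g(1,4,5)
      by (simp add: endpoint_ratio_geodesic)
  qed
  \<comment> \<open>The segment of the geodesic, parametrised over the unit interval.\<close>
  define g where "g = (\<lambda>\<tau>. ?c (s + \<tau> * (t - s)))"
  have gd: "(g has_vector_derivative (t - s) *\<^sub>R geodesic_velocity (s + \<tau> * (t - s))) (at \<tau>)" for \<tau>
    unfolding g_def
  proof -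
    have "((\<lambda>\<tau>. s + \<tau> * (t - s)) has_vector_derivative (t - s)) (at \<tau>)"
      by (auto intro!: derivative_eq_intros simp: has_vector_derivative_def)
    from vector_diff_chain_at[OF this geodesic_between_derivative]
    show "((\<lambda>\<tau>. ?c (s + \<tau> * (t - s))) has_vector_derivative
        (t - s) *\<^sub>R geodesic_velocity (s + \<tau> * (t - s))) (at \<tau>)"
      by (simp add: o_def)
  qed
  have "continuous_on UNIV geodesic_velocity"
  proof -
    have "m + exp t + exp (- t) \<noteq> 0" for t using geodesic_denominator_pos[of t] by simp
    then show ?thesis
      unfolding geodesic_velocity_def[abs_def] by (intro continuous_intros) auto
  qed
  then have "continuous_on {0..1} (\<lambda>\<tau>. (t - s) *\<^sub>R geodesic_velocity (s + \<tau> * (t - s)))"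
    by (intro continuous_on_scaleR continuous_on_const
        continuous_on_compose2[of UNIV geodesic_velocity "{0..1}" "\<lambda>\<tau>. s + \<tau> * (t - s)"] continuous_intros) auto
  then have C1: "g C1_differentiable_on {0..1}"
    unfolding C1_differentiable_on_def
    by (intro exI[of _ "\<lambda>\<tau>. (t - s) *\<^sub>R geodesic_velocity (s + \<tau> * (t - s))"] conjI ballI gd)
  have "hyperbolic_length g = integral {0..1} (\<lambda>\<tau>::real. \<bar>t - s\<bar>)"
    unfolding hyperbolic_length_def
  proof (rule integral_cong)
    fix \<tau> :: real
    have "vector_derivative g (at \<tau>) = (t - s) *\<^sub>R geodesic_velocity (s + \<tau> * (t - s))"
      by (rule vector_derivative_at[OF gd])
    then show "2 * norm (vector_derivative g (at \<tau>)) / (1 - (norm (g \<tau>))\<^sup>2) = \<bar>t - s\<bar>"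
      using arg_cong[OF geodesic_between_speed[of "s + \<tau> * (t - s)"], of "\<lambda>u. \<bar>t - s\<bar> * u"]
      by (simp add: g_def mult.left_commute)
  qed
  then have "hyperbolic_length g = \<bar>s - t\<bar>" by (simp add: abs_minus_commute)
  moreover have "g ` {0..1} \<subseteq> ball 0 1" using geodesic_between_in_ball by (auto simp: g_def)
  moreover have "g 0 = ?c s" "g 1 = ?c t" by (simp_all add: g_def)
  ultimately have mem: "\<bar>s - t\<bar> \<in> ?A"
    unfolding mem_Collect_eq using C1 by (intro exI[of _ g]) simp
  show ?thesis unfolding hyperbolic_dist_def
    by (rule cInf_eq_minimum[OF mem lower])
qed

lemma geodesic_between_at_top: "(geodesic_between x y \<longlongrightarrow> x) at_top"
proof -
  have lim: "((\<lambda>t::real. exp (- t)) \<longlongrightarrow> 0) at_top"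
    using filterlim_compose[OF exp_at_bot filterlim_uminus_at_bot_at_top] by simp
  have "geodesic_between x y t = (x + exp (- t) *\<^sub>R (exp (- t) *\<^sub>R y)) /\<^sub>R (m * exp (- t) + 1 + exp (- t) * exp (- t))"
    for t
  proof -
    have "x + exp (- t) *\<^sub>R (exp (- t) *\<^sub>R y) = exp (- t) *\<^sub>R (exp t *\<^sub>R x + exp (- t) *\<^sub>R y)"
      using exp_mult_exp_minus[of t] by (simp add: scaleR_add_right mult.commute)
    moreover have "m * exp (- t) + 1 + exp (- t) * exp (- t) = exp (- t) * (m + exp t + exp (- t))"
      using exp_mult_exp_minus[of t] by (simp add: algebra_simps)
    ultimately show ?thesis
      unfolding geodesic_between_def m_def[symmetric] by (simp add: inverse_mult_distrib)
  qed
  then have eq: "geodesic_between x y = (\<lambda>t. (x + exp (- t) *\<^sub>R (exp (- t) *\<^sub>R y)) /\<^sub>R (m * exp (- t) + 1 + exp (- t) * exp (- t)))"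
    by (simp add: fun_eq_iff)
  have "((\<lambda>t. (x + exp (- t) *\<^sub>R (exp (- t) *\<^sub>R y)) /\<^sub>R (m * exp (- t) + 1 + exp (- t) * exp (- t))) \<longlongrightarrow>
      (x + 0 *\<^sub>R (0 *\<^sub>R y)) /\<^sub>R (m * 0 + 1 + 0 * 0)) at_top"
    by (intro tendsto_intros lim) simp
  then show ?thesis unfolding eq by simp
qed

end

lemma geodesic_between_flip: "geodesic_between x y (- t) = geodesic_between y x t"
  by (simp add: geodesic_between_def norm_minus_commute add_ac)

lemma hyperbolic_geodesic_between:
  fixes x y :: "'a::euclidean_space"
  assumes "norm x = 1" "norm y = 1" "x \<noteq> y"
  shows "hyperbolic_geodesic (geodesic_between x y)"
    and "(geodesic_between x y \<longlongrightarrow> x) at_top" and "(geodesic_between x y \<longlongrightarrow> y) at_bot"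
proof -
  show "hyperbolic_geodesic (geodesic_between x y)"
    unfolding hyperbolic_geodesic_def
    using geodesic_between_in_ball[OF assms] hyperbolic_dist_geodesic[OF assms] by auto
  show "(geodesic_between x y \<longlongrightarrow> x) at_top" by (rule geodesic_between_at_top[OF assms])
  have "(geodesic_between y x \<longlongrightarrow> y) at_top"
    using assms by (intro geodesic_between_at_top) auto
  then show "(geodesic_between x y \<longlongrightarrow> y) at_bot"
    by (simp add: filterlim_at_bot_mirror geodesic_between_flip)
qed

text \<open>
  The diameter through \<open>p\<close> is the geodesic between the antipodal endpoints \<open>p/|p|\<close> and
  \<open>-p/|p|\<close>.
\<close>

lemma exp_hyperbolic_dist_0:
  fixes p :: "'a::euclidean_space"
  assumes p: "norm p < 1"
  shows "exp (- hyperbolic_dist 0 p) = (1 - norm p) / (1 + norm p)"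
proof -
  obtain u where u: "norm u = 1" "p = norm p *\<^sub>R u"
  proof (cases "p = 0")
    case True
    obtain b :: 'a where "b \<in> Basis" using nonempty_Basis by blast
    then show ?thesis using that[of b] True by simp
  next
    case False
    then show ?thesis using that[of "p /\<^sub>R norm p"] by simp
  qed
  define r where "r = norm p"
  define t where "t = ln ((1 + r) / (1 - r))"
  have r: "0 \<le> r" "r < 1" using p by (simp_all add: r_def)
  have e: "exp t = (1 + r) / (1 - r)" "exp (- t) = (1 - r) / (1 + r)"
    using r by (simp_all add: t_def exp_minus)
  have t: "t \<ge> 0" unfolding t_def using r by (intro ln_ge_zero) (simp add: field_simps)
  have nu: "norm (- u) = 1" "u \<noteq> - u" "norm (u - - u) = 2"
  proof -
    show "u \<noteq> - u"
    proof
      assume "u = - u"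
      then have "2 *\<^sub>R u = 0" by (simp add: scaleR_2 eq_neg_iff_add_eq_0)
      then show False using u(1) by simp
    qed
    show "norm (u - - u) = 2" using u(1) by (simp flip: scaleR_2)
  qed (use u in simp)
  have c0: "geodesic_between u (- u) 0 = 0" by (simp add: geodesic_between_def)
  have "geodesic_between u (- u) t = ((exp t - exp (- t)) / (2 + exp t + exp (- t))) *\<^sub>R u"
    unfolding geodesic_between_def nu
    by (simp add: scaleR_diff_left scaleR_diff_right left_diff_distrib divide_inverse mult.commute[of "inverse _"])
  also have "(exp t - exp (- t)) / (2 + exp t + exp (- t)) = r"
  proof -
    have "exp t - exp (- t) = 4 * r / ((1 - r) * (1 + r))"
      unfolding e using r by (simp add: field_simps)
    moreover have "2 + exp t + exp (- t) = 4 / ((1 - r) * (1 + r))"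
      unfolding e using r by (simp add: field_simps)
    ultimately show ?thesis using r by simp
  qed
  finally have ct: "geodesic_between u (- u) t = p" using u(2) by (simp add: r_def)
  have "hyperbolic_dist 0 p = t"
    using hyperbolic_dist_geodesic[OF u(1) nu(1,2), of 0 t] t by (simp add: c0 ct)
  then show ?thesis by (simp add: e r_def)
qed

section \<open>Lorentz transformations on the boundary sphere\<close>

definition lorentz_inner :: "real ^ ('n::finite) option \<Rightarrow> real ^ 'n option \<Rightarrow> real" where
  "lorentz_inner u v = space_part u \<bullet> space_part v - time_part u * time_part v"

lemma inner_space_time:
  "u \<bullet> v = space_part u \<bullet> space_part v + time_part u * time_part (v :: real ^ ('n::finite) option)"
proof -
  have "(\<Sum>i\<in>range Some. u $ i \<bullet> v $ i) = (\<Sum>k\<in>UNIV. u $ Some k \<bullet> v $ Some k)"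
    by (simp add: sum.reindex)
  then show ?thesis
    by (simp add: inner_vec_def UNIV_option_conv space_part_def time_part_def)
qed

lemma lorentz_gram_mult:
  "space_part (lorentz_gram *v v) = space_part v" "time_part (lorentz_gram *v v) = - time_part v"
  by (simp_all add: vec_eq_iff space_part_def time_part_def lorentz_gram_def matrix_vector_mult_def
      if_distrib[of "\<lambda>z. z * _"] cong: if_cong)

lemma lorentz_inner_gram: "lorentz_inner u v = u \<bullet> (lorentz_gram *v v)"
  by (simp add: lorentz_inner_def inner_space_time lorentz_gram_mult)

lemma minkowski_eqI:
  assumes "space_part u = space_part w" "time_part u = time_part w"
  shows "u = w"
  unfolding vec_eq_iff
proof
  fix i show "u $ i = w $ i"
    using assms by (cases i) (auto simp: space_part_def time_part_def vec_eq_iff)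
qed

lemma lorentz_gram_square: "lorentz_gram ** lorentz_gram = mat 1"
proof -
  have "lorentz_gram *v (lorentz_gram *v v) = v" for v :: "real ^ 'a option"
    by (rule minkowski_eqI) (simp_all add: lorentz_gram_mult)
  then show ?thesis
    by (simp add: matrix_eq flip: matrix_vector_mul_assoc)
qed

lemma space_part_linear: "linear space_part"
  by (rule linearI) (simp_all add: space_part_def vec_eq_iff)

lemma time_part_linear: "linear time_part"
  by (rule linearI) (simp_all add: time_part_def)

lemma space_part_minkowski [simp]: "space_part (minkowski v t) = v"
  by (simp add: space_part_def minkowski_def vec_eq_iff)

lemma time_part_minkowski [simp]: "time_part (minkowski v t) = t"
  by (simp add: time_part_def minkowski_def)

lemma space_part_simps [simp]:
  "space_part (u + v) = space_part u + space_part v" "space_part (u - v) = space_part u - space_part v"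
  "space_part (c *\<^sub>R u) = c *\<^sub>R space_part u"
  by (simp_all add: space_part_def vec_eq_iff)

lemma time_part_simps [simp]:
  "time_part (u + v) = time_part u + time_part v" "time_part (u - v) = time_part u - time_part v"
  "time_part (c *\<^sub>R u) = c * time_part u"
  by (simp_all add: time_part_def)

lemma SO_plus_isometry:
  assumes "A \<in> SO_plus"
  shows "lorentz_inner (A *v u) (A *v v) = lorentz_inner u v"
proof -
  have "(A *v u) \<bullet> w = u \<bullet> (transpose A *v w)" for w
    using dot_lmul_matrix[of u "transpose A" w] unfolding vector_transpose_matrix .
  then have "lorentz_inner (A *v u) (A *v v) = u \<bullet> ((transpose A ** lorentz_gram ** A) *v v)"
    unfolding lorentz_inner_gram by (simp only: matrix_vector_mul_assoc matrix_mul_assoc)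
  then show ?thesis
    using assms by (simp add: SO_plus_def lorentz_inner_gram)
qed

text \<open>
  Besides \<open>A\<^sup>T J A = J\<close> also \<open>A J A\<^sup>T = J\<close> holds, because a left inverse of a
  square matrix is a right inverse. Its time-time entry says that the first row of \<open>A\<close> is timelike.
\<close>

lemma SO_plus_row:
  assumes "A \<in> SO_plus"
  shows "norm (space_part (A $ None)) < time_part (A $ None)"
proof -
  have A: "transpose A ** lorentz_gram ** A = lorentz_gram" "A $ None $ None > 0"
    using assms by (auto simp: SO_plus_def)
  have "(lorentz_gram ** (transpose A ** lorentz_gram)) ** A = mat 1"
    using A(1) by (simp add: lorentz_gram_square flip: matrix_mul_assoc)
  then have "A ** (lorentz_gram ** (transpose A ** lorentz_gram)) = mat 1"
    by (simp add: matrix_left_right_inverse)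
  then have "A ** (lorentz_gram ** (transpose A ** lorentz_gram)) ** lorentz_gram = lorentz_gram"
    by simp
  then have AJ: "A ** lorentz_gram ** transpose A = lorentz_gram"
    by (simp add: lorentz_gram_square flip: matrix_mul_assoc)
  have "(A ** lorentz_gram ** transpose A) $ None $ None = lorentz_inner (A $ None) (A $ None)"
  proof -
    have "(A ** lorentz_gram ** transpose A) $ None $ None =
          (\<Sum>k\<in>UNIV. (\<Sum>l\<in>UNIV. A $ None $ l * lorentz_gram $ l $ k) * A $ None $ k)"
      by (simp add: matrix_matrix_mult_def transpose_def)
    also have "\<dots> = (\<Sum>k\<in>UNIV. (\<Sum>l\<in>UNIV. lorentz_gram $ k $ l * A $ None $ l) * A $ None $ k)"
    proof -
      have "lorentz_gram $ l $ k = lorentz_gram $ k $ l" for k l :: "'a option"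
        by (simp add: lorentz_gram_def)
      then show ?thesis by (simp add: mult.commute)
    qed
    also have "\<dots> = lorentz_inner (A $ None) (A $ None)"
      by (simp add: lorentz_inner_gram inner_vec_def matrix_vector_mult_def mult.commute)
    finally show ?thesis .
  qed
  then have "lorentz_inner (A $ None) (A $ None) = -1"
    unfolding AJ by (simp add: lorentz_gram_def)
  then have "(norm (space_part (A $ None)))\<^sup>2 < (time_part (A $ None))\<^sup>2"
    by (simp add: lorentz_inner_def dot_square_norm power2_eq_square)
  moreover have "time_part (A $ None) > 0" using A(2) by (simp add: time_part_def)
  ultimately show ?thesis by (simp add: power2_less_imp_less)
qed

lemma time_part_mult: "time_part (A *v w) = (A $ None) \<bullet> w"
  by (simp add: time_part_def matrix_vector_mult_def inner_vec_def)

lemma SO_plus_future: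
  assumes A: "A \<in> SO_plus" and w: "norm (space_part w) \<le> time_part w" "time_part w > 0"
  shows "time_part (A *v w) > 0"
proof -
  let ?r = "A $ None"
  have "\<bar>space_part ?r \<bullet> space_part w\<bar> \<le> norm (space_part ?r) * norm (space_part w)"
    by (rule Cauchy_Schwarz_ineq2)
  also have "\<dots> \<le> norm (space_part ?r) * time_part w"
    using w by (intro mult_left_mono) auto
  also have "\<dots> < time_part ?r * time_part w"
    using SO_plus_row[OF A] w(2) by simp
  finally show ?thesis by (simp add: time_part_mult inner_space_time)
qed

lemma SO_plus_matrix_inv:
  assumes "A \<in> SO_plus"
  shows "matrix_inv A ** A = mat 1" "A ** matrix_inv A = mat 1"
proof -
  have "(lorentz_gram ** (transpose A ** lorentz_gram)) ** A = mat 1"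
    using assms by (simp add: SO_plus_def lorentz_gram_square flip: matrix_mul_assoc)
  then have "\<exists>A'. A ** A' = mat 1 \<and> A' ** A = mat 1"
    by (meson matrix_left_right_inverse)
  then have "A ** matrix_inv A = mat 1 \<and> matrix_inv A ** A = mat 1"
    unfolding matrix_inv_def by (rule someI_ex)
  then show "matrix_inv A ** A = mat 1" "A ** matrix_inv A = mat 1" by auto
qed

text \<open>
  The ray of \<open>x\<close> is normalised by time coordinate 1; \<open>A\<close> multiplies the normalised vector by
  this number. It is the reciprocal of the conformal factor of \<open>A\<close> at \<open>x\<close>.
\<close>

definition ray_scale :: "real ^ (('n::finite) option) ^ 'n option \<Rightarrow> real ^ 'n \<Rightarrow> real" where
  "ray_scale A x = time_part (A *v minkowski x 1)"

context
  fixes A :: "real ^ (('n::finite) option) ^ 'n option"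
  assumes A: "A \<in> SO_plus"
begin

lemma ray_scale_pos: "norm x = 1 \<Longrightarrow> ray_scale A x > 0"
  unfolding ray_scale_def by (rule SO_plus_future[OF A]) auto

lemma ray_image:
  assumes "norm x = 1"
  shows "A *v minkowski x 1 = ray_scale A x *\<^sub>R minkowski (sphere_act A x) 1"
  using ray_scale_pos[OF assms]
  by (intro minkowski_eqI) (simp_all add: sphere_act_def ray_scale_def Let_def)

lemma sphere_act_lorentz:
  assumes "norm x = 1" "norm y = 1"
  shows "ray_scale A x * ray_scale A y * (1 - sphere_act A x \<bullet> sphere_act A y) = 1 - x \<bullet> y"
proof -
  have "lorentz_inner (A *v minkowski x 1) (A *v minkowski y 1) = x \<bullet> y - 1"
    by (subst SO_plus_isometry[OF A]) (simp add: lorentz_inner_def)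
  then show ?thesis
    unfolding ray_image[OF assms(1)] ray_image[OF assms(2)]
    by (simp add: lorentz_inner_def algebra_simps)
qed

lemma norm_sphere_act:
  assumes "norm x = 1"
  shows "norm (sphere_act A x) = 1"
  using sphere_act_lorentz[OF assms assms] ray_scale_pos[OF assms] assms by (simp add: norm_eq_1)

text \<open>
  Since \<open>|x - y|\<^sup>2 = -2 \<langle>(x,1),(y,1)\<rangle>\<close> for the Lorentz product, which
  \<open>A\<close> preserves, the chordal distance is scaled by the geometric mean of the conformal factors, exactly and
  not only infinitesimally.
\<close>

lemma sphere_act_dist:
  assumes "norm x = 1" "norm y = 1"
  shows "(dist (sphere_act A x) (sphere_act A y))\<^sup>2 = (dist x y)\<^sup>2 / (ray_scale A x * ray_scale A y)"
proof -
  have d: "(dist u v)\<^sup>2 = 2 * (1 - u \<bullet> v)" if "norm u = 1" "norm v = 1" for u v :: "real ^ 'n"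
    using that by (simp add: dist_norm power2_norm_eq_inner inner_diff_left inner_diff_right norm_eq_1 inner_commute)
  show ?thesis
    using sphere_act_lorentz[OF assms] ray_scale_pos[OF assms(1)] ray_scale_pos[OF assms(2)]
    by (simp add: d assms norm_sphere_act field_simps)
qed

lemma sphere_act_mult:
  assumes "norm x = 1"
  shows "sphere_act (B ** A) x = sphere_act B (sphere_act A x)"
    and "ray_scale (B ** A) x = ray_scale B (sphere_act A x) * ray_scale A x"
proof -
  have "(B ** A) *v minkowski x 1 = ray_scale A x *\<^sub>R (B *v minkowski (sphere_act A x) 1)"
    by (simp add: ray_image[OF assms] matrix_vector_mult_scaleR flip: matrix_vector_mul_assoc)
  then show "ray_scale (B ** A) x = ray_scale B (sphere_act A x) * ray_scale A x"
    and "sphere_act (B ** A) x = sphere_act B (sphere_act A x)"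
    using ray_scale_pos[OF assms] by (simp_all add: ray_scale_def sphere_act_def Let_def)
qed

text \<open>
  The map is the quotient of two affine functions, \<open>S\<close> by \<open>\<tau>\<close>. For tangent vectors the
  inner products of the derivatives follow from three instances of the invariance of the Lorentz product.
\<close>

lemma sphere_act_derivative:
  assumes x: "norm x = 1"
  shows "\<exists>D. (sphere_act A has_derivative D) (at x) \<and>
    (\<forall>v w. v \<bullet> x = 0 \<longrightarrow> w \<bullet> x = 0 \<longrightarrow> D v \<bullet> D w = (v \<bullet> w) / (ray_scale A x)\<^sup>2)"
proof -
  define \<sigma> where "\<sigma> = (\<lambda>h. space_part (A *v minkowski h 0))"
  define \<theta> where "\<theta> = (\<lambda>h. time_part (A *v minkowski h 0))"
  define S where "S = (\<lambda>y. space_part (A *v minkowski y 1))"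
  let ?\<tau> = "ray_scale A"
  have lin_m: "linear (\<lambda>h::real^'n. A *v minkowski h 0)"
  proof -
    have "linear (\<lambda>h::real^'n. minkowski h 0)"
      by (rule linearI; rule minkowski_eqI) simp_all
    from linear_compose[OF this matrix_vector_mul_linear[of A]] show ?thesis by (simp add: o_def)
  qed
  have lin: "linear \<sigma>" "linear \<theta>"
    unfolding \<sigma>_def \<theta>_def
    using linear_compose[OF lin_m space_part_linear] linear_compose[OF lin_m time_part_linear]
    by (simp_all add: o_def)
  have split: "A *v minkowski y 1 = A *v minkowski y 0 + A *v minkowski 0 1" for y
  proof -
    have "minkowski y 1 = minkowski y 0 + minkowski 0 (1::real)"
      by (rule minkowski_eqI) simp_all
    then show ?thesis by (simp add: matrix_vector_right_distrib)
  qed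
  have S: "S y = \<sigma> y + space_part (A *v minkowski 0 1)" for y
    unfolding S_def \<sigma>_def split[of y] by simp
  have \<tau>: "?\<tau> y = \<theta> y + time_part (A *v minkowski 0 1)" for y
    unfolding ray_scale_def \<theta>_def split[of y] by simp
  have dS: "(S has_derivative \<sigma>) (at x)"
    unfolding S[abs_def] by (rule has_derivative_add_const linear_imp_has_derivative lin)+
  have d\<tau>: "(?\<tau> has_derivative \<theta>) (at x)"
    unfolding \<tau>[abs_def] by (rule has_derivative_add_const linear_imp_has_derivative lin)+
  have pos: "?\<tau> x > 0" by (rule ray_scale_pos[OF x])
  define D where "D = (\<lambda>h. inverse (?\<tau> x) *\<^sub>R \<sigma> h - (\<theta> h / (?\<tau> x)\<^sup>2) *\<^sub>R S x)"
  have "((\<lambda>y. inverse (?\<tau> y) *\<^sub>R S y) has_derivative D) (at x)"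
  proof -
    have nz: "?\<tau> x \<noteq> 0" using pos by simp
    have "D = (\<lambda>h. inverse (?\<tau> x) *\<^sub>R \<sigma> h + - (inverse (?\<tau> x) * \<theta> h * inverse (?\<tau> x)) *\<^sub>R S x)"
      by (simp add: D_def fun_eq_iff power2_eq_square divide_inverse mult_ac)
    then show ?thesis
      using has_derivative_scaleR[OF Deriv.has_derivative_inverse[OF nz d\<tau>] dS] by simp
  qed
  moreover have "(\<lambda>y. inverse (?\<tau> y) *\<^sub>R S y) = sphere_act A"
    by (simp add: fun_eq_iff sphere_act_def Let_def ray_scale_def S_def divide_inverse)
  ultimately have der: "(sphere_act A has_derivative D) (at x)" by simp
  have "D v \<bullet> D w = (v \<bullet> w) / (?\<tau> x)\<^sup>2" if v: "v \<bullet> x = 0" and w: "w \<bullet> x = 0" for v w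
  proof -
    have vw: "\<sigma> v \<bullet> \<sigma> w = v \<bullet> w + \<theta> v * \<theta> w"
      using SO_plus_isometry[OF A, of "minkowski v 0" "minkowski w 0"]
      by (simp add: lorentz_inner_def \<sigma>_def \<theta>_def)
    have tangent: "\<sigma> u \<bullet> S x = \<theta> u * ?\<tau> x" if "u \<bullet> x = 0" for u
      using SO_plus_isometry[OF A, of "minkowski u 0" "minkowski x 1"] that
      by (simp add: lorentz_inner_def \<sigma>_def \<theta>_def S_def ray_scale_def)
    have SS: "S x \<bullet> S x = ?\<tau> x * ?\<tau> x"
      using SO_plus_isometry[OF A, of "minkowski x 1" "minkowski x 1"] x
      by (simp add: lorentz_inner_def S_def ray_scale_def norm_eq_1)
    have "D v \<bullet> D w = inverse (?\<tau> x) * inverse (?\<tau> x) * (\<sigma> v \<bullet> \<sigma> w)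
        - inverse (?\<tau> x) * (\<theta> w / (?\<tau> x)\<^sup>2) * (\<sigma> v \<bullet> S x)
        - inverse (?\<tau> x) * (\<theta> v / (?\<tau> x)\<^sup>2) * (\<sigma> w \<bullet> S x)
        + (\<theta> v / (?\<tau> x)\<^sup>2) * (\<theta> w / (?\<tau> x)\<^sup>2) * (S x \<bullet> S x)"
      unfolding D_def by (simp add: inner_diff_left inner_diff_right inner_commute[of "S x" "\<sigma> w"] algebra_simps)
    also have "\<dots> = (v \<bullet> w) / (?\<tau> x)\<^sup>2"
      unfolding vw tangent[OF v] tangent[OF w] SS using pos by (simp add: field_simps power2_eq_square)
    finally show ?thesis .
  qed
  with der show ?thesis by (intro exI[of _ D] conjI allI impI)
qed

end

text \<open>
  A derivative within the sphere is determined on tangent vectors: compose with the great circle through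
  \<open>x\<close> in the direction \<open>v\<close>.
\<close>

lemma has_derivative_within_sphere_tangent:
  fixes f :: "'a::real_inner \<Rightarrow> 'b::real_normed_vector"
  assumes x: "norm x = 1" and v: "v \<bullet> x = 0" "norm v = 1"
    and D: "(f has_derivative D) (at x within sphere 0 1)"
    and D': "(f has_derivative D') (at x within sphere 0 1)"
  shows "D v = D' v"
proof -
  define c where "c = (\<lambda>s. cos s *\<^sub>R x + sin s *\<^sub>R v)"
  have "norm (c s) = 1" for s
  proof -
    have "c s \<bullet> c s = (cos s)\<^sup>2 + (sin s)\<^sup>2"
      using x v by (simp add: c_def inner_add_left inner_add_right norm_eq_1 inner_commute[of x v] power2_eq_square)
    then show ?thesis by (simp add: norm_eq_1)
  qed
  then have sub: "c ` UNIV \<subseteq> sphere 0 1" by auto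
  have c0: "c 0 = x" by (simp add: c_def)
  have c: "(c has_derivative (\<lambda>h. h *\<^sub>R v)) (at 0)"
    unfolding c_def by (auto intro!: derivative_eq_intros)
  have "((\<lambda>s. f (c s)) has_derivative (\<lambda>h. E (h *\<^sub>R v))) (at 0)"
    if "(f has_derivative E) (at x within sphere 0 1)" for E
    by (rule has_derivative_in_compose[OF c]) (use has_derivative_subset[OF that sub] c0 in simp)
  then have "(\<lambda>h. D (h *\<^sub>R v)) = (\<lambda>h. D' (h *\<^sub>R v))"
    using has_derivative_unique D D' by blast
  from fun_cong[OF this, of 1] show ?thesis by simp
qed

text \<open>
  The assumption on the dimension provides a nonzero tangent vector. Without one every positive number would be a
  conformal factor.
\<close>

lemma conformal_factor_sphere_act:
  fixes A :: "real ^ (('n::finite) option) ^ 'n option"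
  assumes A: "A \<in> SO_plus" and x: "norm x = 1" and n: "CARD('n) \<ge> 2"
  shows "conformal_factor (sphere_act A) x = 1 / ray_scale A x"
proof -
  let ?P = "\<lambda>c. c > 0 \<and> (\<exists>D. (sphere_act A has_derivative D) (at x within sphere 0 1) \<and>
        (\<forall>v w. v \<bullet> x = 0 \<longrightarrow> w \<bullet> x = 0 \<longrightarrow> (D v /\<^sub>R c) \<bullet> (D w /\<^sub>R c) = v \<bullet> w))"
  obtain D where D: "(sphere_act A has_derivative D) (at x)"
    and Di: "\<And>v w. v \<bullet> x = 0 \<Longrightarrow> w \<bullet> x = 0 \<Longrightarrow> D v \<bullet> D w = (v \<bullet> w) / (ray_scale A x)\<^sup>2"
    using sphere_act_derivative[OF A x] by blast
  have D': "(sphere_act A has_derivative D) (at x within sphere 0 1)"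
    using D by (rule has_derivative_at_withinI)
  have pos: "ray_scale A x > 0" by (rule ray_scale_pos[OF A x])
  obtain v0 :: "real ^ 'n" where v0: "v0 \<noteq> 0" "orthogonal x v0"
    by (rule orthogonal_to_vector_exists[of x]) (use n in auto)
  define v where "v = v0 /\<^sub>R norm v0"
  have v: "v \<bullet> x = 0" "norm v = 1"
    using v0 by (auto simp: v_def orthogonal_def inner_commute)
  then have vv: "v \<bullet> v = 1" by (simp add: dot_square_norm)
  have "?P (1 / ray_scale A x)"
  proof (intro conjI exI[of _ D] allI impI)
    fix v w :: "real ^ 'n" assume "v \<bullet> x = 0" "w \<bullet> x = 0"
    then show "(D v /\<^sub>R (1 / ray_scale A x)) \<bullet> (D w /\<^sub>R (1 / ray_scale A x)) = v \<bullet> w"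
      using pos by (simp add: Di power2_eq_square)
  qed (use pos D' in auto)
  moreover have "c = 1 / ray_scale A x" if Pc: "?P c" for c
  proof -
    obtain E where E: "(sphere_act A has_derivative E) (at x within sphere 0 1)"
      "\<And>v w. v \<bullet> x = 0 \<Longrightarrow> w \<bullet> x = 0 \<Longrightarrow> (E v /\<^sub>R c) \<bullet> (E w /\<^sub>R c) = v \<bullet> w" and c: "c > 0"
      using Pc by blast
    have "E v = D v" by (rule has_derivative_within_sphere_tangent[OF x v E(1) D'])
    then have "(D v \<bullet> D v) / c\<^sup>2 = 1"
      using E(2)[OF v(1) v(1)] vv by (simp add: divide_inverse power2_eq_square mult_ac)
    then have "c\<^sup>2 = (1 / ray_scale A x)\<^sup>2"
      using c pos Di[OF v(1) v(1)] vv by (simp add: power_divide field_simps)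
    then show ?thesis using c pos by (simp add: power2_eq_iff_nonneg)
  qed
  ultimately show ?thesis unfolding conformal_factor_def by (rule the_equality)
qed

section \<open>The action on the closed ball\<close>

text \<open>
  The vector \<open>ball_to_hyperboloid x\<close> multiplied by \<open>1 - |x|\<^sup>2\<close>. In contrast to the point
  of the hyperboloid it has a limit at the boundary, namely twice the light ray \<open>(x,1)\<close>.
\<close>

definition closed_ball_lift :: "real ^ 'n \<Rightarrow> real ^ ('n::finite) option" where
  "closed_ball_lift x = minkowski (2 *\<^sub>R x) (1 + (norm x)\<^sup>2)"

text \<open>
  The common continuous extension of \<open>ball_act A\<close> and \<open>sphere_act A\<close> to the closed ball,
  obtained by multiplying numerator and denominator of \<open>ball_act A\<close> by \<open>1 - |x|\<^sup>2\<close>.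
\<close>

definition closed_ball_act :: "real ^ (('n::finite) option) ^ 'n option \<Rightarrow> real ^ 'n \<Rightarrow> real ^ 'n" where
  "closed_ball_act A x =
     (1 / ((1 - (norm x)\<^sup>2) + time_part (A *v closed_ball_lift x))) *\<^sub>R space_part (A *v closed_ball_lift x)"

text \<open>
  The ratio of \<open>exp (- \<rho>(0, Ax))\<close> to \<open>exp (- \<rho>(0, x))\<close>, written such that it makes
  sense on the closed ball. On the sphere it is the conformal factor of \<open>A\<close>.
\<close>

definition dilation :: "real ^ (('n::finite) option) ^ 'n option \<Rightarrow> real ^ 'n \<Rightarrow> real" where
  "dilation A x = 2 * (1 + norm x)\<^sup>2 /
     (((1 - (norm x)\<^sup>2) + time_part (A *v closed_ball_lift x)) * (1 + norm (closed_ball_act A x))\<^sup>2)"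

lemma one_minus_norm_pos: "norm x < 1 \<Longrightarrow> 1 - (norm x)\<^sup>2 > 0"
  by (simp add: abs_square_less_1)

lemma closed_ball_lift_ball:
  assumes "norm x < 1"
  shows "closed_ball_lift x = (1 - (norm x)\<^sup>2) *\<^sub>R ball_to_hyperboloid x"
proof -
  have "(1 - (norm x)\<^sup>2) * (c / (1 - (norm x)\<^sup>2)) = c" for c
    using one_minus_norm_pos[OF assms] by simp
  then show ?thesis
    unfolding closed_ball_lift_def ball_to_hyperboloid_def
    by (intro minkowski_eqI)
       (simp_all only: space_part_simps time_part_simps space_part_minkowski time_part_minkowski scaleR_scaleR)
qed

lemma closed_ball_lift_sphere: "norm x = 1 \<Longrightarrow> closed_ball_lift x = 2 *\<^sub>R minkowski x 1"
  by (rule minkowski_eqI) (auto simp: closed_ball_lift_def)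



lemma one_minus_norm_nonneg: "norm x \<le> 1 \<Longrightarrow> 1 - (norm x)\<^sup>2 \<ge> 0"
  by (simp add: abs_square_le_1)

lemma ball_to_hyperboloid_lorentz:
  assumes "norm x < 1"
  shows "lorentz_inner (ball_to_hyperboloid x) (ball_to_hyperboloid x) = -1"
    and "norm (space_part (ball_to_hyperboloid x)) \<le> time_part (ball_to_hyperboloid x)"
    and "time_part (ball_to_hyperboloid x) > 0"
proof -
  let ?c = "1 - (norm x)\<^sup>2"
  have c: "?c > 0" using assms by (rule one_minus_norm_pos)
  have "lorentz_inner (ball_to_hyperboloid x) (ball_to_hyperboloid x) =
      (4 * (norm x)\<^sup>2 - (1 + (norm x)\<^sup>2)\<^sup>2) / ?c\<^sup>2"
    by (simp add: lorentz_inner_def ball_to_hyperboloid_def dot_square_norm power2_eq_square diff_divide_distrib)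
  also have "4 * (norm x)\<^sup>2 - (1 + (norm x)\<^sup>2)\<^sup>2 = - ?c\<^sup>2"
    by (simp add: power2_eq_square algebra_simps)
  finally show "lorentz_inner (ball_to_hyperboloid x) (ball_to_hyperboloid x) = -1" using c by simp
  have "2 * norm x \<le> 1 + (norm x)\<^sup>2" using sum_squares_bound[of 1 "norm x"] by simp
  then show "norm (space_part (ball_to_hyperboloid x)) \<le> time_part (ball_to_hyperboloid x)"
    using c by (simp add: ball_to_hyperboloid_def divide_right_mono)
  have "1 + (norm x)\<^sup>2 > 0" by (simp add: add_pos_nonneg)
  then show "time_part (ball_to_hyperboloid x) > 0"
    using c by (simp add: ball_to_hyperboloid_def)
qed

lemma hyperboloid_to_ball_inverse:
  assumes w: "lorentz_inner w w = -1" "time_part w > 0"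
  shows "ball_to_hyperboloid (hyperboloid_to_ball w) = w"
    and "norm (hyperboloid_to_ball w) < 1"
proof -
  let ?T = "time_part w" and ?p = "hyperboloid_to_ball w"
  have S: "(norm (space_part w))\<^sup>2 = ?T\<^sup>2 - 1"
    using w(1) by (simp add: lorentz_inner_def dot_square_norm power2_eq_square)
  have "(norm ?p)\<^sup>2 = (norm (space_part w))\<^sup>2 / (1 + ?T)\<^sup>2"
    using w(2) by (simp add: hyperboloid_to_ball_def power_divide)
  also have "\<dots> = ((?T - 1) * (?T + 1)) / ((1 + ?T) * (1 + ?T))"
    unfolding S by (simp add: power2_eq_square algebra_simps)
  also have "\<dots> = (?T - 1) / (1 + ?T)" using w(2) by (simp add: add.commute)
  finally have p: "(norm ?p)\<^sup>2 = (?T - 1) / (1 + ?T)" .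
  have 1: "1 - (norm ?p)\<^sup>2 = 2 / (1 + ?T)" unfolding p using w(2) by (simp add: field_simps)
  have 2: "1 + (norm ?p)\<^sup>2 = 2 * ?T / (1 + ?T)" unfolding p using w(2) by (simp add: field_simps)
  have "0 < 2 / (1 + ?T)" using w(2) by simp
  then have "(norm ?p)\<^sup>2 < 1" unfolding 1[symmetric] by simp
  then show "norm ?p < 1" by (simp add: abs_square_less_1)
  show "ball_to_hyperboloid ?p = w"
    using w(2) unfolding ball_to_hyperboloid_def 1 2
    by (intro minkowski_eqI) (simp_all add: hyperboloid_to_ball_def)
qed

context
  fixes A :: "real ^ (('n::finite) option) ^ 'n option"
  assumes A: "A \<in> SO_plus"
begin

lemma hyperboloid_image:
  assumes "norm x < 1"
  shows "lorentz_inner (A *v ball_to_hyperboloid x) (A *v ball_to_hyperboloid x) = -1"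
    and "time_part (A *v ball_to_hyperboloid x) > 0"
proof -
  note L = ball_to_hyperboloid_lorentz[OF assms]
  show "lorentz_inner (A *v ball_to_hyperboloid x) (A *v ball_to_hyperboloid x) = -1"
    by (subst SO_plus_isometry[OF A]) (rule L(1))
  show "time_part (A *v ball_to_hyperboloid x) > 0" by (rule SO_plus_future[OF A L(2,3)])
qed

lemma norm_ball_act: "norm x < 1 \<Longrightarrow> norm (ball_act A x) < 1"
  unfolding ball_act_def by (intro hyperboloid_to_ball_inverse hyperboloid_image)

lemma ball_to_hyperboloid_ball_act:
  "norm x < 1 \<Longrightarrow> ball_to_hyperboloid (ball_act A x) = A *v ball_to_hyperboloid x"
  unfolding ball_act_def by (intro hyperboloid_to_ball_inverse hyperboloid_image)

lemma ball_act_mult: "norm x < 1 \<Longrightarrow> ball_act (B ** A) x = ball_act B (ball_act A x)"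
  unfolding ball_act_def[of B] ball_to_hyperboloid_ball_act
  by (simp add: ball_act_def matrix_vector_mul_assoc)

lemma closed_ball_time_pos:
  shows "time_part (A *v closed_ball_lift x) > 0"
proof (rule SO_plus_future[OF A])
  have "2 * norm x \<le> 1 + (norm x)\<^sup>2" using sum_squares_bound[of 1 "norm x"] by simp
  then show "norm (space_part (closed_ball_lift x)) \<le> time_part (closed_ball_lift x)"
    by (simp add: closed_ball_lift_def)
  show "time_part (closed_ball_lift x) > 0"
    by (simp add: closed_ball_lift_def add_pos_nonneg)
qed

lemma closed_ball_denominator_pos:
  "norm x \<le> 1 \<Longrightarrow> (1 - (norm x)\<^sup>2) + time_part (A *v closed_ball_lift x) > 0"
  by (intro add_nonneg_pos one_minus_norm_nonneg closed_ball_time_pos)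

lemma closed_ball_act_ball:
  assumes "norm x < 1"
  shows "closed_ball_act A x = ball_act A x"
proof -
  define c where "c = 1 - (norm x)\<^sup>2"
  have c: "c > 0" using one_minus_norm_pos[OF assms] by (simp add: c_def)
  let ?w = "A *v ball_to_hyperboloid x"
  have "A *v closed_ball_lift x = c *\<^sub>R ?w"
    by (simp add: closed_ball_lift_ball[OF assms] c_def matrix_vector_mult_scaleR)
  then have "closed_ball_act A x = (c / (c + c * time_part ?w)) *\<^sub>R space_part ?w"
    unfolding closed_ball_act_def c_def[symmetric] by simp
  also have "c / (c + c * time_part ?w) = 1 / (1 + time_part ?w)"
    using c by (simp add: distrib_left[symmetric, of c 1, simplified])
  finally show ?thesis by (simp add: ball_act_def hyperboloid_to_ball_def)
qed

lemma closed_ball_act_sphere: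
  assumes "norm x = 1"
  shows "closed_ball_act A x = sphere_act A x"
  by (simp add: closed_ball_act_def sphere_act_def Let_def closed_ball_lift_sphere[OF assms]
      matrix_vector_mult_scaleR assms)

text \<open>
  The Lorentz square of the lift of \<open>x\<close> is \<open>- (1 - |x|\<^sup>2)\<^sup>2\<close>. It is preserved by
  \<open>A\<close>, and the quotient defining the image has a norm that depends only on this square and on the time
  coordinate.
\<close>

lemma one_minus_norm_closed_ball_act:
  assumes "norm x \<le> 1"
  shows "1 - (norm (closed_ball_act A x))\<^sup>2 =
    2 * (1 - (norm x)\<^sup>2) / ((1 - (norm x)\<^sup>2) + time_part (A *v closed_ball_lift x))"
proof -
  define c where "c = 1 - (norm x)\<^sup>2"
  let ?w = "A *v closed_ball_lift x"
  let ?T = "time_part ?w"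
  have pos: "c + ?T > 0" using closed_ball_denominator_pos[OF assms] by (simp add: c_def)
  have "lorentz_inner ?w ?w = 4 * (norm x)\<^sup>2 - (1 + (norm x)\<^sup>2)\<^sup>2"
    by (subst SO_plus_isometry[OF A])
       (simp add: lorentz_inner_def closed_ball_lift_def dot_square_norm power2_eq_square)
  also have "\<dots> = - c\<^sup>2" by (simp add: c_def power2_eq_square algebra_simps)
  finally have S: "(norm (space_part ?w))\<^sup>2 = ?T\<^sup>2 - c\<^sup>2"
    by (simp add: lorentz_inner_def dot_square_norm power2_eq_square)
  have "(norm (closed_ball_act A x))\<^sup>2 = (?T\<^sup>2 - c\<^sup>2) / (c + ?T)\<^sup>2"
    unfolding closed_ball_act_def c_def[symmetric] using pos by (simp add: power_divide S)
  also have "\<dots> = ((?T - c) * (c + ?T)) / ((c + ?T) * (c + ?T))"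
    by (simp add: power2_eq_square algebra_simps)
  also have "\<dots> = (?T - c) / (c + ?T)" using pos by simp
  finally show ?thesis unfolding c_def[symmetric] using pos by (simp add: field_simps)
qed

lemma closed_ball_act_cball: "closed_ball_act A ` cball 0 1 \<subseteq> cball 0 1"
proof (rule image_subsetI)
  fix x :: "real ^ 'n" assume "x \<in> cball 0 1"
  then have x: "norm x \<le> 1" by simp
  have "1 - (norm (closed_ball_act A x))\<^sup>2 \<ge> 0"
    unfolding one_minus_norm_closed_ball_act[OF x]
    using closed_ball_denominator_pos[OF x] one_minus_norm_nonneg[OF x]
    by (intro divide_nonneg_pos) auto
  then show "closed_ball_act A x \<in> cball 0 1" by (simp add: abs_square_le_1)
qed

lemma closed_ball_act_continuous: "continuous_on (cball 0 1) (closed_ball_act A)"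
  and dilation_continuous: "continuous_on (cball 0 1) (dilation A)"
  and dilation_pos: "norm x \<le> 1 \<Longrightarrow> dilation A x > 0"
proof -
  have clift: "continuous_on X (closed_ball_lift :: real^'n \<Rightarrow> _)" for X
    unfolding closed_ball_lift_def[abs_def] minkowski_def
  proof (rule continuous_on_vec_lambda)
    fix i :: "'n option"
    show "continuous_on X (\<lambda>x::real^'n. case i of None \<Rightarrow> 1 + (norm x)\<^sup>2 | Some k \<Rightarrow> (2 *\<^sub>R x) $ k)"
      by (cases i) (auto intro!: continuous_intros)
  qed
  have cA: "continuous_on X (\<lambda>x. A *v closed_ball_lift x)" for X
    by (rule continuous_on_compose2[OF _ clift subset_UNIV])
       (simp add: matrix_vector_mult_linear_continuous_on)
  have cs: "continuous_on X (\<lambda>x. space_part (A *v closed_ball_lift x))"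
       and ct: "continuous_on X (\<lambda>x. time_part (A *v closed_ball_lift x))" for X
  proof -
    have "continuous_on UNIV (space_part :: real ^ 'n option \<Rightarrow> _)"
         "continuous_on UNIV (time_part :: real ^ 'n option \<Rightarrow> _)"
      using space_part_linear time_part_linear
      by (auto intro!: linear_continuous_on simp: linear_conv_bounded_linear)
    then show "continuous_on X (\<lambda>x. space_part (A *v closed_ball_lift x))"
              "continuous_on X (\<lambda>x. time_part (A *v closed_ball_lift x))"
      using continuous_on_compose2[OF _ cA subset_UNIV] by blast+
  qed
  have nz: "(1 - (norm x)\<^sup>2) + time_part (A *v closed_ball_lift x) \<noteq> 0" if "x \<in> cball 0 1" for x
    using closed_ball_denominator_pos[of x] that by simp
  show c1: "continuous_on (cball 0 1) (closed_ball_act A)"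
    unfolding closed_ball_act_def[abs_def]
    by (intro continuous_on_scaleR continuous_on_divide continuous_intros cs ct) (use nz in auto)
  have p: "1 + norm (closed_ball_act A x) > 0" for x by (simp add: add_pos_nonneg)
  show "continuous_on (cball 0 1) (dilation A)"
    unfolding dilation_def[abs_def]
    by (intro continuous_on_divide continuous_intros c1 cs ct) (use nz p in \<open>auto simp: less_imp_neq[THEN not_sym]\<close>)
  show "dilation A x > 0" if "norm x \<le> 1"
    unfolding dilation_def using closed_ball_denominator_pos[OF that] p[of x]
    by (intro divide_pos_pos mult_pos_pos zero_less_power) (auto simp: add_pos_nonneg)
qed

lemma dilation_ball:
  assumes x: "norm x < 1"
  shows "exp (- hyperbolic_dist 0 (ball_act A x)) = dilation A x * exp (- hyperbolic_dist 0 x)"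
proof -
  define c where "c = 1 - (norm x)\<^sup>2"
  let ?T = "time_part (A *v closed_ball_lift x)" and ?y = "ball_act A x"
  have c: "c > 0" using one_minus_norm_pos[OF x] by (simp add: c_def)
  have T: "c + ?T > 0" using closed_ball_denominator_pos[of x] x by (simp add: c_def)
  have k: "(1 - norm z) / (1 + norm z) = (1 - (norm z)\<^sup>2) / (1 + norm z)\<^sup>2" for z :: "real ^ 'n"
  proof -
    have "1 + norm z > 0" by (simp add: add_pos_nonneg)
    then have "(1 - norm z) / (1 + norm z) = ((1 - norm z) * (1 + norm z)) / ((1 + norm z) * (1 + norm z))"
      by simp
    then show ?thesis by (simp add: power2_eq_square algebra_simps)
  qed
  have nx: "1 + norm x > 0" by (simp add: add_pos_nonneg)
  have "exp (- hyperbolic_dist 0 ?y) = (2 * c / (c + ?T)) / (1 + norm ?y)\<^sup>2"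
    using one_minus_norm_closed_ball_act[of x] x
    by (simp add: exp_hyperbolic_dist_0[OF norm_ball_act[OF x]] k closed_ball_act_ball[OF x] c_def)
  also have "\<dots> = dilation A x * (c / (1 + norm x)\<^sup>2)"
    unfolding dilation_def closed_ball_act_ball[OF x] c_def[symmetric] using nx T by simp
  also have "c / (1 + norm x)\<^sup>2 = exp (- hyperbolic_dist 0 x)"
    by (simp add: exp_hyperbolic_dist_0[OF x] k c_def)
  finally show ?thesis .
qed

lemma dilation_sphere:
  assumes x: "norm x = 1"
  shows "dilation A x = 1 / ray_scale A x"
  using norm_sphere_act[OF A x]
  by (simp add: dilation_def closed_ball_act_sphere[OF x] closed_ball_lift_sphere[OF x]
      matrix_vector_mult_scaleR x ray_scale_def)

lemma sphere_act_continuous: "continuous_on (sphere 0 1) (sphere_act A)"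
proof -
  have "continuous_on (sphere 0 1) (closed_ball_act A)"
    by (rule continuous_on_subset[OF closed_ball_act_continuous]) auto
  then show ?thesis
    by (rule continuous_on_eq) (simp add: closed_ball_act_sphere)
qed

lemma ball_act_continuous: "continuous_on (ball 0 1) (ball_act A)"
proof -
  have "continuous_on (ball 0 1) (closed_ball_act A)"
    by (rule continuous_on_subset[OF closed_ball_act_continuous]) auto
  then show ?thesis
    by (rule continuous_on_eq) (simp add: closed_ball_act_ball)
qed

end

section \<open>Measures determined by Lipschitz functions\<close>

text \<open>
  Indicators of closed sets are decreasing limits of the Lipschitz functions \<open>max 0 (1 - n infdist x C)\<close>,
  and closed sets form an intersection stable generator of the Borel sets.
\<close>

lemma finite_borel_measure_eqI_lipschitz:
  fixes M N :: "'a::metric_space measure"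
  assumes "finite_measure M" "finite_measure N"
    and M: "sets M = sets borel" and N: "sets N = sets borel"
    and eq: "\<And>\<phi>. \<lbrakk>\<exists>L. L-lipschitz_on UNIV \<phi>; \<And>x. 0 \<le> \<phi> x; \<And>x. \<phi> x \<le> 1\<rbrakk>
               \<Longrightarrow> (\<integral>x. \<phi> x \<partial>M) = (\<integral>x. (\<phi> x :: real) \<partial>N)"
  shows "M = N"
proof -
  interpret M: finite_measure M by fact
  interpret N: finite_measure N by fact
  have *: "measure M C = measure N C" if C: "closed C" for C
  proof (cases "C = {}")
    case False
    \<comment> \<open>Lipschitz functions decreasing to the indicator of \<open>C\<close>; infdist is constantly 0 for the empty set, which is therefore a separate case.\<close>
    define \<phi> where "\<phi> = (\<lambda>n x. max 0 (1 - real n * infdist x C))"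
    have lip: "(real n)-lipschitz_on UNIV (\<phi> n)" for n
    proof (rule lipschitz_onI)
      fix x y
      have "\<bar>infdist x C - infdist y C\<bar> \<le> dist x y"
        by (metis abs_le_iff dist_commute infdist_triangle_abs minus_diff_eq)
      then have "real n * \<bar>infdist x C - infdist y C\<bar> \<le> real n * dist x y"
        by (simp add: mult_left_mono)
      moreover have "dist (\<phi> n x) (\<phi> n y) \<le> \<bar>real n * infdist x C - real n * infdist y C\<bar>"
        by (auto simp: \<phi>_def dist_real_def)
      moreover have "\<bar>real n * infdist x C - real n * infdist y C\<bar> = real n * \<bar>infdist x C - infdist y C\<bar>"
        by (simp add: abs_mult flip: right_diff_distrib)
      ultimately show "dist (\<phi> n x) (\<phi> n y) \<le> real n * dist x y" by linarith
    qed simp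
    have rng: "0 \<le> \<phi> n x" "\<phi> n x \<le> 1" for n x
      by (auto simp: \<phi>_def infdist_nonneg)
    have lim: "(\<lambda>n. \<phi> n x) \<longlonglongrightarrow> indicator C x" for x
    proof (cases "x \<in> C")
      case True
      then show ?thesis by (simp add: \<phi>_def)
    next
      case False
      then have pos: "infdist x C > 0"
        using C \<open>C \<noteq> {}\<close> by (metis in_closed_iff_infdist_zero infdist_nonneg order_le_less)
      obtain k :: nat where k: "1 / infdist x C < real k" using reals_Archimedean2 by blast
      have "\<phi> n x = 0" if "n \<ge> k" for n
      proof -
        have "1 \<le> real k * infdist x C" using k pos by (simp add: field_simps)
        also have "\<dots> \<le> real n * infdist x C" using that pos by simp
        finally show ?thesis by (simp add: \<phi>_def)
      qed
      then have "eventually (\<lambda>n. \<phi> n x = 0) sequentially"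
        by (auto simp: eventually_sequentially)
      then show ?thesis using False by (simp add: tendsto_eventually)
    qed
    have conv: "(\<lambda>n. \<integral>x. \<phi> n x \<partial>K) \<longlonglongrightarrow> measure K C"
      if K: "finite_measure K" "sets K = sets borel" for K :: "'a measure"
    proof -
      interpret K: finite_measure K by fact
      have [measurable]: "C \<in> sets K" using C K by auto
      have sp: "space K = UNIV" using K(2) by (metis sets_eq_imp_space_eq space_borel)
      have [measurable]: "\<phi> n \<in> borel_measurable K" for n
      proof -
        have "\<phi> n \<in> borel_measurable borel"
          using lip[of n] by (intro borel_measurable_continuous_onI lipschitz_on_continuous_on)
        then show ?thesis using K(2) measurable_cong_sets by blast
      qed
      have "(\<lambda>n. \<integral>x. \<phi> n x \<partial>K) \<longlonglongrightarrow> (\<integral>x. indicator C x \<partial>K)"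
        by (rule integral_dominated_convergence[where w="\<lambda>_. 1"])
           (auto simp: lim rng)
      then show ?thesis by (simp add: sp)
    qed
    have "(\<integral>x. \<phi> n x \<partial>M) = (\<integral>x. \<phi> n x \<partial>N)" for n
      using eq[of "\<phi> n"] lip rng by blast
    then show ?thesis
      using conv[OF \<open>finite_measure M\<close> M] conv[OF \<open>finite_measure N\<close> N]
      by (simp add: LIMSEQ_unique)
  qed simp
  have sg: "sets borel = sigma_sets (UNIV::'a set) (Collect closed)"
    by (simp add: borel_eq_closed)
  show ?thesis
  proof (rule measure_eqI_generator_eq[where E="Collect closed" and \<Omega>=UNIV and A="\<lambda>_. UNIV"])
    show "Int_stable (Collect (closed :: 'a set \<Rightarrow> bool))"
      by (auto simp: Int_stable_def)
    show "emeasure M X = emeasure N X" if "X \<in> Collect closed" for X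
      using *[of X] that by (simp add: M.emeasure_eq_measure N.emeasure_eq_measure)
  qed (auto simp: M N sg)
qed

lemma id_measurable_restrict_borel:
  assumes "sets K = sets (restrict_space borel S)"
  shows "(\<lambda>x. x) \<in> measurable K (borel :: 'a::topological_space measure)"
proof -
  have "(\<lambda>x. x) \<in> measurable (restrict_space borel S) (borel :: 'a measure)"
    by (rule measurable_restrict_space1) simp
  then show ?thesis using assms measurable_cong_sets by blast
qed

lemma finite_measure_eqI_lipschitz:
  fixes M N :: "'a::metric_space measure"
  assumes fin: "finite_measure M" "finite_measure N"
    and M: "sets M = sets (restrict_space borel S)" and N: "sets N = sets (restrict_space borel S)"
    and eq: "\<And>\<phi>. \<lbrakk>\<exists>L. L-lipschitz_on UNIV \<phi>; \<And>x. 0 \<le> \<phi> x; \<And>x. \<phi> x \<le> 1\<rbrakk>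
               \<Longrightarrow> (\<integral>x. \<phi> x \<partial>M) = (\<integral>x. (\<phi> x :: real) \<partial>N)"
  shows "M = N"
proof -
  have sp: "space M = S" "space N = S"
    using sets_eq_imp_space_eq[OF M] sets_eq_imp_space_eq[OF N] by (auto simp: space_restrict_space)
  have D: "distr M borel (\<lambda>x. x) = distr N borel (\<lambda>x. x)"
  proof (rule finite_borel_measure_eqI_lipschitz)
    fix \<phi> :: "'a \<Rightarrow> real"
    assume L: "\<exists>L. L-lipschitz_on UNIV \<phi>" and b: "\<And>x. 0 \<le> \<phi> x" "\<And>x. \<phi> x \<le> 1"
    have "\<phi> \<in> borel_measurable borel"
      using L by (meson borel_measurable_continuous_onI lipschitz_on_continuous_on)
    then show "integral\<^sup>L (distr M borel (\<lambda>x. x)) \<phi> = integral\<^sup>L (distr N borel (\<lambda>x. x)) \<phi>"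
      using eq[OF L b] id_measurable_restrict_borel[OF M] id_measurable_restrict_borel[OF N] by (simp add: integral_distr)
  qed (auto intro!: finite_measure.finite_measure_distr fin id_measurable_restrict_borel[OF M] id_measurable_restrict_borel[OF N] simp: M N)
  show ?thesis
  proof (rule measure_eqI)
    show "sets M = sets N" using M N by simp
    fix A assume "A \<in> sets M"
    then obtain B where B: "B \<in> sets borel" "A = B \<inter> S"
      using M by (auto simp: sets_restrict_space)
    have "emeasure M A = emeasure (distr M borel (\<lambda>x. x)) B"
      using B id_measurable_restrict_borel[OF M] by (simp add: emeasure_distr sp)
    also have "\<dots> = emeasure N A"
      unfolding D using B id_measurable_restrict_borel[OF N] by (simp add: emeasure_distr sp)
    finally show "emeasure M A = emeasure N A" .
  qed
qed

section \<open>Conformal transformation of the Patterson--Sullivan measure\<close>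

text \<open>
  The integrand and the measure both vary with \<open>s\<close> when \<open>s\<close> tends to \<open>\<delta>\<close>;
  uniform convergence of the integrand separates the two limits.
\<close>

lemma compact_powr_tendsto_uniformly:
  fixes q \<phi> :: "'a::metric_space \<Rightarrow> real"
  assumes K: "compact K" and q: "continuous_on K q" and pos: "\<And>x. x \<in> K \<Longrightarrow> q x > 0"
    and \<phi>: "continuous_on K \<phi>" and e: "e > 0"
  shows "\<forall>\<^sub>F s in at_right \<delta>. \<forall>x\<in>K. \<bar>q x powr s * \<phi> x - q x powr \<delta> * \<phi> x\<bar> < e"
proof -
  let ?F = "\<lambda>p. q (snd p) powr fst p * \<phi> (snd p)"
  let ?D = "{\<delta>..\<delta> + 1} \<times> K"
  have "continuous_on ?D ?F"
  proof (intro continuous_on_mult continuous_on_powr continuous_intros)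
    show "continuous_on ?D (\<lambda>p. q (snd p))"
      by (rule continuous_on_compose2[OF q continuous_on_snd[OF continuous_on_id]]) auto
    show "continuous_on ?D (\<lambda>p. \<phi> (snd p))"
      by (rule continuous_on_compose2[OF \<phi> continuous_on_snd[OF continuous_on_id]]) auto
    show "\<forall>p\<in>?D. q (snd p) \<noteq> 0" using pos by fastforce
  qed
  moreover have "compact ?D" using K by (intro compact_Times) auto
  ultimately have "uniformly_continuous_on ?D ?F" by (intro compact_uniformly_continuous)
  then obtain d where d: "d > 0"
      "\<And>p p'. p \<in> ?D \<Longrightarrow> p' \<in> ?D \<Longrightarrow> dist p' p < d \<Longrightarrow> dist (?F p') (?F p) < e"
    unfolding uniformly_continuous_on_def using e by metis
  have "\<forall>\<^sub>F s in at_right \<delta>. s \<in> {\<delta><..<\<delta> + min d 1}"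
    by (rule eventually_at_right_real) (use d in simp)
  then show ?thesis
  proof (rule eventually_mono, intro ballI)
    fix s x assume s: "s \<in> {\<delta><..<\<delta> + min d 1}" and x: "x \<in> K"
    have "dist (s, x) (\<delta>, x) < d"
      using s by (auto simp: dist_Pair_Pair dist_real_def min_def split: if_splits)
    then show "\<bar>q x powr s * \<phi> x - q x powr \<delta> * \<phi> x\<bar> < e"
      using d(2)[of "(\<delta>, x)" "(s, x)"] s x
      by (auto simp: dist_real_def min_def split: if_splits)
  qed
qed

locale kleinian =
  fixes \<Gamma> :: "(real ^ (('n::finite) option) ^ 'n option) set"
  assumes kleinian_group: "kleinian_group \<Gamma>"
begin

lemma in_SO_plus: "A \<in> \<Gamma> \<Longrightarrow> A \<in> SO_plus"
  using kleinian_group by (auto simp: kleinian_group_def)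

lemma mult_closed: "A \<in> \<Gamma> \<Longrightarrow> B \<in> \<Gamma> \<Longrightarrow> A ** B \<in> \<Gamma>"
  using kleinian_group by (auto simp: kleinian_group_def)

lemma inverse_closed: "A \<in> \<Gamma> \<Longrightarrow> matrix_inv A \<in> \<Gamma>"
  using kleinian_group by (auto simp: kleinian_group_def)

lemma closed_limit_set: "closed (limit_set \<Gamma>)"
  by (auto simp: limit_set_def)

lemma limit_set_norm: "x \<in> limit_set \<Gamma> \<Longrightarrow> norm x = 1"
  by (simp add: limit_set_def)

lemma orbit_in_ball: "A \<in> \<Gamma> \<Longrightarrow> norm (ball_act A 0) < 1"
  by (rule norm_ball_act[OF in_SO_plus]) auto

text \<open>
  The extension to the closed ball maps the orbit of the centre to itself, hence also its closure.
\<close>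

lemma sphere_act_limit_set:
  assumes A: "A \<in> \<Gamma>" and x: "x \<in> limit_set \<Gamma>"
  shows "sphere_act A x \<in> limit_set \<Gamma>"
proof -
  let ?O = "(\<lambda>B. ball_act B 0) ` \<Gamma>"
  have sub: "closure ?O \<subseteq> cball 0 1"
    by (rule closure_minimal) (use orbit_in_ball in fastforce)+
  have "closed_ball_act A ` closure ?O \<subseteq> closure ?O"
  proof (rule image_closure_subset)
    show "continuous_on (closure ?O) (closed_ball_act A)"
      by (rule continuous_on_subset[OF closed_ball_act_continuous[OF in_SO_plus[OF A]] sub])
    have "closed_ball_act A (ball_act B 0) = ball_act (A ** B) 0" if "B \<in> \<Gamma>" for B
      using closed_ball_act_ball[OF in_SO_plus[OF A] orbit_in_ball[OF that]]
        ball_act_mult[OF in_SO_plus[OF that], of 0 A] by simp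
    then show "closed_ball_act A ` ?O \<subseteq> closure ?O"
      using mult_closed[OF A] closure_subset by fastforce
  qed simp
  moreover have "x \<in> closure ?O" using x by (simp add: limit_set_def)
  ultimately have "closed_ball_act A x \<in> closure ?O" by blast
  then show ?thesis
    using closed_ball_act_sphere[OF in_SO_plus[OF A] limit_set_norm[OF x]]
      norm_sphere_act[OF in_SO_plus[OF A] limit_set_norm[OF x]]
    by (simp add: limit_set_def)
qed

lemma matrix_inv_sphere_act:
  assumes A: "A \<in> \<Gamma>" and x: "norm x = 1"
  shows "sphere_act A (sphere_act (matrix_inv A) x) = x"
    and "ray_scale A (sphere_act (matrix_inv A) x) * ray_scale (matrix_inv A) x = 1"
proof -
  have "sphere_act (mat 1) x = x" "ray_scale (mat 1) x = 1"
    by (simp_all add: sphere_act_def ray_scale_def)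
  then show "sphere_act A (sphere_act (matrix_inv A) x) = x"
    and "ray_scale A (sphere_act (matrix_inv A) x) * ray_scale (matrix_inv A) x = 1"
    using sphere_act_mult[OF in_SO_plus[OF inverse_closed[OF A]] x, of A]
    by (simp_all add: SO_plus_matrix_inv[OF in_SO_plus[OF A]])
qed

lemma orbit_measure_sets: "sets (orbit_measure \<Gamma> s) = sets (restrict_space borel (cball 0 1))"
  by (simp add: orbit_measure_def)

lemma nn_integral_orbit_measure:
  assumes "f \<in> borel_measurable (restrict_space borel (cball 0 1))"
  shows "(\<integral>\<^sup>+x. f x \<partial>orbit_measure \<Gamma> s) =
    (\<integral>\<^sup>+A. ennreal (exp (- s * hyperbolic_dist 0 (ball_act A 0))) / poincare_series \<Gamma> s * f (ball_act A 0)
       \<partial>count_space \<Gamma>)"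
proof -
  let ?M = "density (count_space \<Gamma>)
          (\<lambda>A. ennreal (exp (- s * hyperbolic_dist 0 (ball_act A 0))) / poincare_series \<Gamma> s)"
  have m: "(\<lambda>A. ball_act A 0) \<in> measurable ?M (restrict_space borel (cball 0 1))"
    using orbit_in_ball by (auto simp: space_restrict_space less_imp_le)
  have "(\<integral>\<^sup>+x. f x \<partial>orbit_measure \<Gamma> s) = (\<integral>\<^sup>+A. f (ball_act A 0) \<partial>?M)"
    unfolding orbit_measure_def using assms by (intro nn_integral_distr[OF m]) simp
  also have "\<dots> = (\<integral>\<^sup>+A. ennreal (exp (- s * hyperbolic_dist 0 (ball_act A 0))) / poincare_series \<Gamma> s * f (ball_act A 0)
       \<partial>count_space \<Gamma>)"
    by (rule nn_integral_density) auto
  finally show ?thesis .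
qed

text \<open>
  Replace the summation index \<open>C\<close> by \<open>AC\<close>. The point masses are then moved by
  \<open>A\<close>, and the weight of \<open>AC\<close> is that of \<open>C\<close> times \<open>dilation A (C0) powr
  s\<close>.
\<close>

lemma orbit_measure_scaling:
  fixes \<phi> :: "real ^ 'n \<Rightarrow> real"
  assumes A: "A \<in> \<Gamma>" and \<phi>: "continuous_on (cball 0 1) \<phi>" "\<And>x. \<phi> x \<ge> 0"
  shows "(\<integral>x. \<phi> (closed_ball_act (matrix_inv A) x) \<partial>orbit_measure \<Gamma> s) =
         (\<integral>x. dilation A x powr s * \<phi> x \<partial>orbit_measure \<Gamma> s)"
proof -
  let ?B = "matrix_inv A" and ?R = "restrict_space borel (cball (0 :: real ^ 'n) 1)"
  let ?w = "\<lambda>A. exp (- s * hyperbolic_dist 0 (ball_act A 0))"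
  let ?W = "\<lambda>A. ennreal (?w A) / poincare_series \<Gamma> s"
  have B: "?B \<in> \<Gamma>" by (rule inverse_closed[OF A])
  have m1: "(\<lambda>x. \<phi> (closed_ball_act ?B x)) \<in> borel_measurable ?R"
  proof (intro borel_measurable_continuous_on_restrict continuous_on_compose2[OF \<phi>(1)])
    show "continuous_on (cball 0 1) (closed_ball_act ?B)"
      by (rule closed_ball_act_continuous[OF in_SO_plus[OF B]])
    show "closed_ball_act ?B ` cball 0 1 \<subseteq> cball 0 1"
      by (rule closed_ball_act_cball[OF in_SO_plus[OF B]])
  qed
  have dpos: "x \<in> cball 0 1 \<Longrightarrow> dilation A x \<noteq> 0" for x
    using dilation_pos[OF in_SO_plus[OF A], of x] by auto
  have m2: "(\<lambda>x. dilation A x powr s * \<phi> x) \<in> borel_measurable ?R"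
    by (intro borel_measurable_continuous_on_restrict continuous_on_mult \<phi>(1) continuous_on_powr
        dilation_continuous[OF in_SO_plus[OF A]] continuous_on_const) (use dpos in blast)
  have w: "ennreal (dilation A (ball_act C 0) powr s) * ?W C = ?W (A ** C)" if C: "C \<in> \<Gamma>" for C
  proof -
    have e: "?w C = exp (- hyperbolic_dist 0 (ball_act C 0)) powr s" for C
      by (simp add: powr_def mult.commute)
    have AC: "ball_act (A ** C) 0 = ball_act A (ball_act C 0)"
      by (rule ball_act_mult[OF in_SO_plus[OF C]]) simp
    have "?w (A ** C) = (dilation A (ball_act C 0) * exp (- hyperbolic_dist 0 (ball_act C 0))) powr s"
      using e[of "A ** C"] unfolding AC dilation_ball[OF in_SO_plus[OF A] orbit_in_ball[OF C]] .
    also have "\<dots> = dilation A (ball_act C 0) powr s * ?w C"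
      unfolding e[of C] by (rule powr_mult)
    finally have "?w (A ** C) = dilation A (ball_act C 0) powr s * ?w C" .
    then show ?thesis by (simp add: ennreal_times_divide ennreal_mult)
  qed
  have bij: "bij_betw (\<lambda>C. A ** C) \<Gamma> \<Gamma>"
    by (rule bij_betwI[where g="\<lambda>C. ?B ** C"])
       (use A B mult_closed SO_plus_matrix_inv[OF in_SO_plus[OF A]] in \<open>auto simp: matrix_mul_assoc\<close>)
  have "(\<integral>\<^sup>+x. ennreal (\<phi> (closed_ball_act ?B x)) \<partial>orbit_measure \<Gamma> s) =
        (\<integral>\<^sup>+C. ?W C * ennreal (\<phi> (closed_ball_act ?B (ball_act C 0))) \<partial>count_space \<Gamma>)"
    using m1 by (intro nn_integral_orbit_measure) auto
  also have "\<dots> = (\<integral>\<^sup>+C. ?W (A ** C) * ennreal (\<phi> (closed_ball_act ?B (ball_act (A ** C) 0))) \<partial>count_space \<Gamma>)"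
    by (rule nn_integral_bij_count_space[OF bij, symmetric])
  also have "\<dots> = (\<integral>\<^sup>+C. ?W C * ennreal (dilation A (ball_act C 0) powr s * \<phi> (ball_act C 0)) \<partial>count_space \<Gamma>)"
  proof (rule nn_integral_cong)
    fix C assume "C \<in> space (count_space \<Gamma>)"
    then have C: "C \<in> \<Gamma>" by simp
    have "closed_ball_act ?B (ball_act (A ** C) 0) = ball_act (?B ** (A ** C)) 0"
      using closed_ball_act_ball[OF in_SO_plus[OF B] orbit_in_ball[OF mult_closed[OF A C]]]
        ball_act_mult[OF in_SO_plus[OF mult_closed[OF A C]], of 0 ?B] by simp
    also have "\<dots> = ball_act C 0"
      by (simp add: matrix_mul_assoc SO_plus_matrix_inv[OF in_SO_plus[OF A]])
    finally show "?W (A ** C) * ennreal (\<phi> (closed_ball_act ?B (ball_act (A ** C) 0))) =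
        ?W C * ennreal (dilation A (ball_act C 0) powr s * \<phi> (ball_act C 0))"
      unfolding w[OF C, symmetric] using \<phi>(2) by (simp add: ennreal_mult mult_ac)
  qed
  also have "\<dots> = (\<integral>\<^sup>+x. ennreal (dilation A x powr s * \<phi> x) \<partial>orbit_measure \<Gamma> s)"
    using m2 by (intro nn_integral_orbit_measure[symmetric]) auto
  finally have eq: "(\<integral>\<^sup>+x. ennreal (\<phi> (closed_ball_act ?B x)) \<partial>orbit_measure \<Gamma> s) =
      (\<integral>\<^sup>+x. ennreal (dilation A x powr s * \<phi> x) \<partial>orbit_measure \<Gamma> s)" .
  show ?thesis
    using m1 m2 \<phi>(2) eq
    by (subst (1 2) integral_eq_nn_integral)
       (auto simp: measurable_cong_sets[OF orbit_measure_sets refl])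
qed

end

locale patterson_sullivan = kleinian \<Gamma> for \<Gamma> :: "(real ^ (('n::finite) option) ^ 'n option) set" +
  fixes \<delta> :: real and \<mu> :: "(real ^ 'n) measure"
  assumes patterson_sullivan: "patterson_sullivan_measure \<Gamma> \<delta> \<mu>"
begin

lemma mu_sets: "sets \<mu> = sets (restrict_space borel (limit_set \<Gamma>))"
  using patterson_sullivan by (simp add: patterson_sullivan_measure_def)

lemma mu_finite: "finite_measure \<mu>"
  using patterson_sullivan by (simp add: patterson_sullivan_measure_def)

lemma mu_space: "space \<mu> = limit_set \<Gamma>"
  using sets_eq_imp_space_eq[OF mu_sets] by (simp add: space_restrict_space)

lemma mu_measurable:
  fixes f :: "real ^ 'n \<Rightarrow> 'b::topological_space"
  assumes "continuous_on (limit_set \<Gamma>) f"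
  shows "f \<in> borel_measurable \<mu>"
  using borel_measurable_continuous_on_restrict[OF assms] measurable_cong_sets[OF mu_sets refl] by blast

lemma limit_set_sub_sphere: "limit_set \<Gamma> \<subseteq> sphere 0 1"
  by (auto simp: limit_set_def)

lemma sphere_act_measurable:
  assumes "A \<in> \<Gamma>"
  shows "sphere_act A \<in> measurable \<mu> \<mu>"
proof -
  have "sphere_act A \<in> borel_measurable \<mu>"
    by (intro mu_measurable continuous_on_subset[OF sphere_act_continuous limit_set_sub_sphere]
        in_SO_plus assms)
  then have "sphere_act A \<in> measurable \<mu> (restrict_space borel (limit_set \<Gamma>))"
    using sphere_act_limit_set[OF assms] by (intro measurable_restrict_space2) (auto simp: mu_space)
  then show ?thesis using measurable_cong_sets[OF refl mu_sets] by blast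
qed

lemma orbit_integral_tendsto:
  fixes \<phi> :: "real ^ 'n \<Rightarrow> real"
  assumes "continuous_on (cball 0 1) \<phi>"
  shows "((\<lambda>s. \<integral>x. \<phi> x \<partial>orbit_measure \<Gamma> s) \<longlongrightarrow> (\<integral>x. \<phi> x \<partial>\<mu>)) (at_right \<delta>)"
  using patterson_sullivan assms by (simp add: patterson_sullivan_measure_def)

lemma orbit_integrable:
  fixes \<phi> :: "real ^ 'n \<Rightarrow> real"
  assumes s: "s > \<delta>" and \<phi>: "continuous_on (cball 0 1) \<phi>"
  shows "integrable (orbit_measure \<Gamma> s) \<phi>"
proof -
  interpret prob_space "orbit_measure \<Gamma> s"
    using patterson_sullivan s by (simp add: patterson_sullivan_measure_def)
  have "bounded (\<phi> ` cball 0 1)"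
    by (intro compact_imp_bounded compact_continuous_image \<phi> compact_cball)
  then obtain B where "\<And>x. x \<in> cball 0 1 \<Longrightarrow> norm (\<phi> x) \<le> B"
    unfolding bounded_iff by blast
  moreover have "space (orbit_measure \<Gamma> s) = cball 0 1"
    using sets_eq_imp_space_eq[OF orbit_measure_sets] by (simp add: space_restrict_space)
  moreover have "\<phi> \<in> borel_measurable (orbit_measure \<Gamma> s)"
    using borel_measurable_continuous_on_restrict[OF \<phi>] measurable_cong_sets[OF orbit_measure_sets refl] by blast
  ultimately show ?thesis
    by (intro integrable_const_bound[where B=B]) (auto intro!: AE_I2)
qed

text \<open>
  The limit \<open>s \<longlongrightarrow> \<delta>\<close> of \<open>orbit_measure_scaling\<close>. The left side of
  that identity is the integral of a fixed continuous function, and on the right side \<open>dilation A powr s\<close>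
  is first replaced by \<open>dilation A powr \<delta>\<close>.
\<close>

lemma mu_integral_scaling:
  fixes \<phi> :: "real ^ 'n \<Rightarrow> real"
  assumes A: "A \<in> \<Gamma>" and \<phi>: "continuous_on (cball 0 1) \<phi>" "\<And>x. \<phi> x \<ge> 0"
  shows "(\<integral>x. \<phi> (sphere_act (matrix_inv A) x) \<partial>\<mu>) = (\<integral>x. (1 / ray_scale A x) powr \<delta> * \<phi> x \<partial>\<mu>)"
proof -
  let ?B = "matrix_inv A"
  note AS = in_SO_plus[OF A]
  have BS: "?B \<in> SO_plus" by (intro in_SO_plus inverse_closed A)
  let ?q = "dilation A"
  have qpos: "\<And>x. x \<in> cball 0 1 \<Longrightarrow> ?q x > 0" using dilation_pos[OF AS] by simp
  have cq: "continuous_on (cball 0 1) (\<lambda>x. ?q x powr s * \<phi> x)" for s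
    by (intro continuous_on_mult \<phi>(1) continuous_on_powr dilation_continuous[OF AS] continuous_on_const)
       (use qpos in fastforce)
  have cB: "continuous_on (cball 0 1) (\<lambda>x. \<phi> (closed_ball_act ?B x))"
    by (rule continuous_on_compose2[OF \<phi>(1) closed_ball_act_continuous[OF BS] closed_ball_act_cball[OF BS]])
  let ?M = "orbit_measure \<Gamma>"
  have 1: "((\<lambda>s. \<integral>x. ?q x powr s * \<phi> x \<partial>?M s) \<longlongrightarrow> (\<integral>x. \<phi> (closed_ball_act ?B x) \<partial>\<mu>)) (at_right \<delta>)"
    using orbit_integral_tendsto[OF cB] by (simp add: orbit_measure_scaling[OF A \<phi>])
  have 2: "((\<lambda>s. (\<integral>x. ?q x powr s * \<phi> x \<partial>?M s) - (\<integral>x. ?q x powr \<delta> * \<phi> x \<partial>?M s)) \<longlongrightarrow> 0) (at_right \<delta>)"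
  proof (rule tendstoI)
    fix e :: real assume e: "e > 0"
    have "\<forall>\<^sub>F s in at_right \<delta>. s > \<delta>" by (simp add: eventually_at_right_less)
    with compact_powr_tendsto_uniformly[OF compact_cball dilation_continuous[OF AS] qpos \<phi>(1), of "e/2" \<delta>]
    have "\<forall>\<^sub>F s in at_right \<delta>. s > \<delta> \<and> (\<forall>x\<in>cball 0 1. \<bar>?q x powr s * \<phi> x - ?q x powr \<delta> * \<phi> x\<bar> < e/2)"
      using e by (simp add: eventually_conj)
    then show "\<forall>\<^sub>F s in at_right \<delta>. dist ((\<integral>x. ?q x powr s * \<phi> x \<partial>?M s) - (\<integral>x. ?q x powr \<delta> * \<phi> x \<partial>?M s)) 0 < e"
    proof (rule eventually_mono)
      fix s assume s: "s > \<delta> \<and> (\<forall>x\<in>cball 0 1. \<bar>?q x powr s * \<phi> x - ?q x powr \<delta> * \<phi> x\<bar> < e/2)"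
      interpret prob_space "?M s"
        using patterson_sullivan s by (simp add: patterson_sullivan_measure_def)
      have sp: "space (?M s) = cball 0 1"
        using sets_eq_imp_space_eq[OF orbit_measure_sets] by (simp add: space_restrict_space)
      have i: "integrable (?M s) (\<lambda>x. ?q x powr s * \<phi> x)" "integrable (?M s) (\<lambda>x. ?q x powr \<delta> * \<phi> x)"
        using s by (auto intro!: orbit_integrable cq)
      have "\<bar>\<integral>x. ?q x powr s * \<phi> x - ?q x powr \<delta> * \<phi> x \<partial>?M s\<bar> \<le>
            (\<integral>x. \<bar>?q x powr s * \<phi> x - ?q x powr \<delta> * \<phi> x\<bar> \<partial>?M s)"
        by (rule integral_abs_bound)
      also have "\<dots> \<le> (\<integral>x. e/2 \<partial>?M s)"
      proof (rule integral_mono)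
        show "integrable (?M s) (\<lambda>x. \<bar>?q x powr s * \<phi> x - ?q x powr \<delta> * \<phi> x\<bar>)"
          by (intro integrable_abs Bochner_Integration.integrable_diff i)
        show "\<bar>?q x powr s * \<phi> x - ?q x powr \<delta> * \<phi> x\<bar> \<le> e/2" if "x \<in> space (?M s)" for x
          using s that sp by (simp add: less_imp_le)
      qed simp
      also have "\<dots> < e" using e by (simp add: prob_space)
      finally show "dist ((\<integral>x. ?q x powr s * \<phi> x \<partial>?M s) - (\<integral>x. ?q x powr \<delta> * \<phi> x \<partial>?M s)) 0 < e"
        using i by (simp add: dist_real_def)
    qed
  qed
  have 3: "((\<lambda>s. \<integral>x. ?q x powr \<delta> * \<phi> x \<partial>?M s) \<longlongrightarrow> (\<integral>x. ?q x powr \<delta> * \<phi> x \<partial>\<mu>)) (at_right \<delta>)"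
    by (rule orbit_integral_tendsto[OF cq])
  have "((\<lambda>s. \<integral>x. ?q x powr s * \<phi> x \<partial>?M s) \<longlongrightarrow> (\<integral>x. ?q x powr \<delta> * \<phi> x \<partial>\<mu>)) (at_right \<delta>)"
    using tendsto_add[OF 2 3] by simp
  then have "(\<integral>x. \<phi> (closed_ball_act ?B x) \<partial>\<mu>) = (\<integral>x. ?q x powr \<delta> * \<phi> x \<partial>\<mu>)"
    using 1 by (intro tendsto_unique[OF trivial_limit_at_right_real])
  moreover have "(\<integral>x. \<phi> (closed_ball_act ?B x) \<partial>\<mu>) = (\<integral>x. \<phi> (sphere_act ?B x) \<partial>\<mu>)"
    by (rule Bochner_Integration.integral_cong)
       (simp_all add: mu_space limit_set_norm closed_ball_act_sphere[OF BS])
  moreover have "(\<integral>x. ?q x powr \<delta> * \<phi> x \<partial>\<mu>) = (\<integral>x. (1 / ray_scale A x) powr \<delta> * \<phi> x \<partial>\<mu>)"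
    by (rule Bochner_Integration.integral_cong)
       (simp_all add: mu_space limit_set_norm dilation_sphere[OF AS])
  ultimately show ?thesis by simp
qed

end

section \<open>The logarithmic Dirichlet form\<close>

text \<open>
  The estimates of this part hold for every finite measure on a bounded set whose potential with exponent \<open>1 -
  \<delta>\<close> is bounded. The form itself has exponent \<open>-\<delta>\<close>; the missing power of the distance
  is supplied by a Lipschitz factor.
\<close>

locale log_dirichlet_space = finite_measure \<mu>
  for \<mu> :: "'a::{metric_space, second_countable_topology} measure" +
  fixes S :: "'a set" and \<delta> :: real
  assumes sets_eq: "sets \<mu> = sets (restrict_space borel S)"
    and bounded_S: "bounded S"
    and potential_bound: "\<exists>C. \<forall>x\<in>S. (\<integral>\<^sup>+y. ennreal (dist x y powr (1 - \<delta>)) \<partial>\<mu>) \<le> ennreal C"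
begin

lemma space_eq: "space \<mu> = S"
  using sets_eq_imp_space_eq[OF sets_eq] by (simp add: space_restrict_space)

lemma id_measurable: "(\<lambda>x. x) \<in> measurable \<mu> borel"
  by (rule id_measurable_restrict_borel[OF sets_eq])

lemma potential_measurable: "(\<lambda>y. ennreal (dist x y powr s)) \<in> borel_measurable \<mu>"
proof -
  have "(\<lambda>y. dist x y) \<in> borel_measurable \<mu>"
    using id_measurable by measurable
  then show ?thesis by measurable
qed

sublocale P: pair_sigma_finite \<mu> \<mu> ..

lemma dist_measurable [measurable]: "(\<lambda>p. dist (fst p) (snd p)) \<in> borel_measurable (\<mu> \<Otimes>\<^sub>M \<mu>)"
proof -
  have "fst \<in> measurable (\<mu> \<Otimes>\<^sub>M \<mu>) borel" "snd \<in> measurable (\<mu> \<Otimes>\<^sub>M \<mu>) borel"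
    using measurable_compose[OF measurable_fst id_measurable]
      measurable_compose[OF measurable_snd id_measurable] by auto
  then show ?thesis by measurable
qed

definition difference_kernel :: "('a \<Rightarrow> real) \<Rightarrow> ('a \<Rightarrow> real) \<Rightarrow> 'a \<times> 'a \<Rightarrow> real" where
  "difference_kernel f h p =
     (f (fst p) - f (snd p)) * (h (fst p) - h (snd p)) / dist (fst p) (snd p) powr \<delta>"

lemma difference_kernel_measurable [measurable]:
  assumes [measurable]: "f \<in> borel_measurable \<mu>" "h \<in> borel_measurable \<mu>"
  shows "difference_kernel f h \<in> borel_measurable (\<mu> \<Otimes>\<^sub>M \<mu>)"
  unfolding difference_kernel_def by measurable

lemma form_dom_iff:
  "f \<in> form_dom \<delta> \<mu> \<longleftrightarrow> f \<in> L2 \<mu> \<and> integrable (\<mu> \<Otimes>\<^sub>M \<mu>) (difference_kernel f f)"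
proof (cases "f \<in> L2 \<mu>")
  case True
  then have [measurable]: "f \<in> borel_measurable \<mu>" by (simp add: L2_def)
  have "(\<integral>\<^sup>+x. \<integral>\<^sup>+y. ennreal (\<bar>f x - f y\<bar>\<^sup>2 / dist x y powr \<delta>) \<partial>\<mu> \<partial>\<mu>) =
        (\<integral>\<^sup>+x. \<integral>\<^sup>+y. ennreal (norm (difference_kernel f f (x, y))) \<partial>\<mu> \<partial>\<mu>)"
    by (simp add: difference_kernel_def power2_eq_square abs_mult)
  also have "\<dots> = (\<integral>\<^sup>+p. ennreal (norm (difference_kernel f f p)) \<partial>(\<mu> \<Otimes>\<^sub>M \<mu>))"
    by (rule nn_integral_fst) measurable
  finally show ?thesis using True by (simp add: form_dom_def integrable_iff_bounded)
qed (simp add: form_dom_def)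

lemma difference_kernel_integrable:
  assumes "f \<in> form_dom \<delta> \<mu>" "h \<in> form_dom \<delta> \<mu>"
  shows "integrable (\<mu> \<Otimes>\<^sub>M \<mu>) (difference_kernel f h)"
proof (rule Bochner_Integration.integrable_bound)
  show "integrable (\<mu> \<Otimes>\<^sub>M \<mu>) (\<lambda>p. difference_kernel f f p + difference_kernel h h p)"
    using assms by (simp add: form_dom_iff)
  show "difference_kernel f h \<in> borel_measurable (\<mu> \<Otimes>\<^sub>M \<mu>)"
    using assms by (intro difference_kernel_measurable) (auto simp: form_dom_def L2_def)
  show "AE p in \<mu> \<Otimes>\<^sub>M \<mu>. norm (difference_kernel f h p) \<le>
          norm (difference_kernel f f p + difference_kernel h h p)"
  proof (rule AE_I2)
    fix p
    have *: "\<bar>u * v\<bar> \<le> \<bar>u * u + v * v\<bar>" for u v :: real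
    proof -
      have "2 * \<bar>u * v\<bar> \<le> u * u + v * v"
        using sum_squares_bound[of "\<bar>u\<bar>" "\<bar>v\<bar>"] by (simp add: power2_eq_square abs_mult)
      then show ?thesis by linarith
    qed
    show "norm (difference_kernel f h p) \<le> norm (difference_kernel f f p + difference_kernel h h p)"
      unfolding difference_kernel_def real_norm_def abs_divide add_divide_distrib[symmetric]
      by (rule divide_right_mono[OF *]) simp
  qed
qed

lemma form_eq:
  assumes "f \<in> form_dom \<delta> \<mu>" "h \<in> form_dom \<delta> \<mu>"
  shows "form \<delta> \<mu> f h = 1/2 * integral\<^sup>L (\<mu> \<Otimes>\<^sub>M \<mu>) (difference_kernel f h)"
  using P.integral_fst'[OF difference_kernel_integrable[OF assms]]
  by (simp add: form_def difference_kernel_def)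

lemma L2_mult_integrable:
  assumes "f \<in> L2 \<mu>" "h \<in> L2 \<mu>"
  shows "integrable \<mu> (\<lambda>x. f x * h x)"
proof (rule Bochner_Integration.integrable_bound)
  show "integrable \<mu> (\<lambda>x. (f x)\<^sup>2 + (h x)\<^sup>2)" using assms by (simp add: L2_def)
  have [measurable]: "f \<in> borel_measurable \<mu>" "h \<in> borel_measurable \<mu>"
    using assms by (auto simp: L2_def)
  show "(\<lambda>x. f x * h x) \<in> borel_measurable \<mu>"
    by measurable
  show "AE x in \<mu>. norm (f x * h x) \<le> norm ((f x)\<^sup>2 + (h x)\<^sup>2)"
  proof (rule AE_I2)
    fix x
    have "2 * \<bar>f x * h x\<bar> \<le> (f x)\<^sup>2 + (h x)\<^sup>2"
      using sum_squares_bound[of "\<bar>f x\<bar>" "\<bar>h x\<bar>"] by (simp add: abs_mult)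
    then show "norm (f x * h x) \<le> norm ((f x)\<^sup>2 + (h x)\<^sup>2)" by simp
  qed
qed

lemma L2_add:
  assumes "f \<in> L2 \<mu>" "h \<in> L2 \<mu>"
  shows "(\<lambda>x. f x + h x) \<in> L2 \<mu>"
proof -
  have "(\<lambda>x. (f x + h x)\<^sup>2) = (\<lambda>x. (f x)\<^sup>2 + (h x)\<^sup>2 + 2 * (f x * h x))"
    by (simp add: power2_sum mult.assoc)
  then show ?thesis using assms L2_mult_integrable[OF assms] by (auto simp: L2_def)
qed

lemma L2_cmult: "f \<in> L2 \<mu> \<Longrightarrow> (\<lambda>x. c * f x) \<in> L2 \<mu>"
  by (auto simp: L2_def power_mult_distrib)

lemma L2_diff:
  assumes "f \<in> L2 \<mu>" "h \<in> L2 \<mu>"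
  shows "(\<lambda>x. f x - h x) \<in> L2 \<mu>"
  using L2_add[OF assms(1) L2_cmult[OF assms(2), of "-1"]] by simp

lemma L2_bounded_mult:
  assumes b[measurable]: "b \<in> borel_measurable \<mu>" and B: "\<And>x. x \<in> S \<Longrightarrow> \<bar>b x\<bar> \<le> B" and f: "f \<in> L2 \<mu>"
  shows "(\<lambda>x. b x * f x) \<in> L2 \<mu>" and "L2_norm \<mu> (\<lambda>x. b x * f x) \<le> \<bar>B\<bar> * L2_norm \<mu> f"
proof -
  have [measurable]: "f \<in> borel_measurable \<mu>" and i: "integrable \<mu> (\<lambda>x. (f x)\<^sup>2)"
    using f by (auto simp: L2_def)
  have le: "(b x * f x)\<^sup>2 \<le> B\<^sup>2 * (f x)\<^sup>2" if "x \<in> S" for x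
  proof -
    have "(b x)\<^sup>2 \<le> B\<^sup>2" using B[OF that] by (simp add: abs_le_square_iff[symmetric])
    then show ?thesis by (simp add: power_mult_distrib mult_right_mono)
  qed
  have i2: "integrable \<mu> (\<lambda>x. (b x * f x)\<^sup>2)"
    by (rule Bochner_Integration.integrable_bound[OF integrable_mult_right[OF i, of "B\<^sup>2"]])
       (use le in \<open>auto intro!: AE_I2 simp: space_eq\<close>)
  then show "(\<lambda>x. b x * f x) \<in> L2 \<mu>" by (simp add: L2_def)
  have "(\<integral>x. (b x * f x)\<^sup>2 \<partial>\<mu>) \<le> (\<integral>x. B\<^sup>2 * (f x)\<^sup>2 \<partial>\<mu>)"
    by (rule integral_mono[OF i2]) (use i le in \<open>auto simp: space_eq\<close>)
  then have "sqrt (\<integral>x. (b x * f x)\<^sup>2 \<partial>\<mu>) \<le> sqrt (B\<^sup>2 * (\<integral>x. (f x)\<^sup>2 \<partial>\<mu>))" by simp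
  then show "L2_norm \<mu> (\<lambda>x. b x * f x) \<le> \<bar>B\<bar> * L2_norm \<mu> f"
    by (simp add: L2_norm_def L2_inner_def real_sqrt_mult power2_eq_square)
qed

lemma bounded_L2:
  assumes [measurable]: "\<phi> \<in> borel_measurable \<mu>" and B: "\<And>x. \<bar>\<phi> x\<bar> \<le> 1"
  shows "\<phi> \<in> L2 \<mu>"
proof -
  have "(\<lambda>_. 1) \<in> L2 \<mu>" by (simp add: L2_def)
  from L2_bounded_mult(1)[OF assms(1) B this] show ?thesis by simp
qed

lemma diameter_bound: obtains D where "D \<ge> 0" "\<And>x y. x \<in> S \<Longrightarrow> y \<in> S \<Longrightarrow> dist x y \<le> D"
  using diameter_ge_0[OF bounded_S] diameter_bounded_bound[OF bounded_S] by blast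

lemma potential: obtains C where "C \<ge> 0"
    "\<And>x. x \<in> S \<Longrightarrow> (\<integral>\<^sup>+y. ennreal (dist x y powr (1 - \<delta>)) \<partial>\<mu>) \<le> ennreal C"
proof -
  obtain C where C: "\<And>x. x \<in> S \<Longrightarrow> (\<integral>\<^sup>+y. ennreal (dist x y powr (1 - \<delta>)) \<partial>\<mu>) \<le> ennreal C"
    using potential_bound by auto
  have "(\<integral>\<^sup>+y. ennreal (dist x y powr (1 - \<delta>)) \<partial>\<mu>) \<le> ennreal (max 0 C)" if "x \<in> S" for x
    using order_trans[OF C[OF that] ennreal_leI[of C "max 0 C"]] by simp
  then show ?thesis using that[of "max 0 C"] by simp
qed

lemma dist_powr_eq: "dist x y / dist x y powr \<delta> = dist x y powr (1 - \<delta>)"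
  by (cases "dist x y = 0") (simp_all add: powr_diff)

text \<open>
  This is how the bound on the potential enters: a kernel of order \<open>d(x,y) powr (1 - \<delta>)\<close> may be
  multiplied by an integrable function of one variable.
\<close>

lemma dominated_pair_integrable:
  assumes [measurable]: "k \<in> borel_measurable (\<mu> \<Otimes>\<^sub>M \<mu>)" "m \<in> borel_measurable \<mu>"
    and k: "\<And>x y. x \<in> S \<Longrightarrow> y \<in> S \<Longrightarrow> \<bar>k (x, y)\<bar> \<le> L * dist x y powr (1 - \<delta>)"
    and L: "L \<ge> 0" and m: "integrable \<mu> m"
  shows "integrable (\<mu> \<Otimes>\<^sub>M \<mu>) (\<lambda>p. m (fst p) * k p)"
proof -
  obtain C where C: "C \<ge> 0"
      "\<And>x. x \<in> S \<Longrightarrow> (\<integral>\<^sup>+y. ennreal (dist x y powr (1 - \<delta>)) \<partial>\<mu>) \<le> ennreal C"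
    by (rule potential) blast
  have "(\<integral>\<^sup>+p. ennreal (norm (m (fst p) * k p)) \<partial>(\<mu> \<Otimes>\<^sub>M \<mu>)) =
        (\<integral>\<^sup>+x. \<integral>\<^sup>+y. ennreal (norm (m x * k (x, y))) \<partial>\<mu> \<partial>\<mu>)"
    by (subst nn_integral_fst[symmetric]) auto
  also have "\<dots> \<le> (\<integral>\<^sup>+x. ennreal (norm (m x)) * ennreal (L * C) \<partial>\<mu>)"
  proof (rule nn_integral_mono)
    fix x assume x: "x \<in> space \<mu>"
    have "(\<integral>\<^sup>+y. ennreal (norm (m x * k (x, y))) \<partial>\<mu>) \<le>
          (\<integral>\<^sup>+y. ennreal (\<bar>m x\<bar> * L) * ennreal (dist x y powr (1 - \<delta>)) \<partial>\<mu>)"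
      using k x L by (intro nn_integral_mono)
         (auto simp: space_eq abs_mult ennreal_mult'[symmetric] mult.assoc intro!: ennreal_leI mult_left_mono)
    also have "\<dots> = ennreal (\<bar>m x\<bar> * L) * (\<integral>\<^sup>+y. ennreal (dist x y powr (1 - \<delta>)) \<partial>\<mu>)"
      by (rule nn_integral_cmult[OF potential_measurable])
    also have "\<dots> \<le> ennreal (\<bar>m x\<bar> * L) * ennreal C"
      using C(2) x by (intro mult_left_mono) (auto simp: space_eq)
    also have "\<dots> = ennreal (norm (m x)) * ennreal (L * C)"
      using L C(1) by (simp add: ennreal_mult'[symmetric] mult.assoc)
    finally show "(\<integral>\<^sup>+y. ennreal (norm (m x * k (x, y))) \<partial>\<mu>) \<le> ennreal (norm (m x)) * ennreal (L * C)" .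
  qed
  also have "\<dots> = (\<integral>\<^sup>+x. ennreal (norm (m x)) \<partial>\<mu>) * ennreal (L * C)"
    by (rule nn_integral_multc) measurable
  also have "\<dots> < \<infinity>"
    using m by (auto simp: integrable_iff_bounded ennreal_mult_less_top)
  finally show ?thesis by (intro integrableI_bounded) auto
qed

lemma lipschitz_in_form_dom:
  assumes "L-lipschitz_on UNIV \<phi>" and b: "\<And>x. \<bar>\<phi> x\<bar> \<le> 1"
  shows "\<phi> \<in> form_dom \<delta> \<mu>"
proof -
  have "\<phi> \<in> borel_measurable borel"
    using assms(1) by (intro borel_measurable_continuous_onI lipschitz_on_continuous_on)
  then have [measurable]: "\<phi> \<in> borel_measurable \<mu>"
    using measurable_compose[OF id_measurable] by auto
  obtain D where D: "D \<ge> 0" "\<And>x y. x \<in> S \<Longrightarrow> y \<in> S \<Longrightarrow> dist x y \<le> D"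
    by (rule diameter_bound) blast
  have L: "L \<ge> 0" "\<And>x y. \<bar>\<phi> x - \<phi> y\<bar> \<le> L * dist x y"
    using lipschitz_on_nonneg[OF assms(1)] lipschitz_onD[OF assms(1)] by (auto simp: dist_real_def)
  have "integrable (\<mu> \<Otimes>\<^sub>M \<mu>) (\<lambda>p. 1 * difference_kernel \<phi> \<phi> p)"
  proof (rule dominated_pair_integrable[where m="\<lambda>_. 1" and L="L * D * L"])
    fix x y assume S: "x \<in> S" "y \<in> S"
    have "\<bar>\<phi> x - \<phi> y\<bar> * \<bar>\<phi> x - \<phi> y\<bar> \<le> (L * D) * (L * dist x y)"
      using L D(1) S by (intro mult_mono)
        (auto intro: order_trans[OF L(2)] mult_left_mono[OF D(2)])
    then have "\<bar>difference_kernel \<phi> \<phi> (x, y)\<bar> \<le> (L * D) * (L * dist x y) / dist x y powr \<delta>"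
      unfolding difference_kernel_def by (auto simp: abs_mult intro: divide_right_mono)
    then show "\<bar>difference_kernel \<phi> \<phi> (x, y)\<bar> \<le> L * D * L * dist x y powr (1 - \<delta>)"
      by (simp add: dist_powr_eq[symmetric] mult.assoc)
  qed (use L D in auto)
  then show ?thesis
    using bounded_L2[OF _ b] by (auto simp: form_dom_iff)
qed

text \<open>
  The form is densely defined. If \<open>v\<close> is orthogonal to all Lipschitz functions, the measures with densities
  the positive and the negative part of \<open>v\<close> have the same integrals of these functions, hence they
  coincide.
\<close>

lemma L2_eqI_form_dom:
  assumes w: "w \<in> L2 \<mu>" and w': "w' \<in> L2 \<mu>"
    and eq: "\<And>h. h \<in> form_dom \<delta> \<mu> \<Longrightarrow> L2_inner \<mu> w h = L2_inner \<mu> w' h"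
  shows "AE x in \<mu>. w x = w' x"
proof -
  have [measurable]: "w \<in> borel_measurable \<mu>" "w' \<in> borel_measurable \<mu>"
    using w w' by (auto simp: L2_def)
  define v where "v = (\<lambda>x. w x - w' x)"
  have [measurable]: "v \<in> borel_measurable \<mu>" unfolding v_def by measurable
  have v: "v \<in> L2 \<mu>" unfolding v_def using w w' by (rule L2_diff)
  have iv: "integrable \<mu> v"
    using L2_mult_integrable[OF v, of "\<lambda>_. 1"] bounded_L2[of "\<lambda>_. 1"] by simp
  define p where "p = (\<lambda>x. max 0 (v x))"
  define n where "n = (\<lambda>x. max 0 (- v x))"
  have [measurable]: "p \<in> borel_measurable \<mu>" "n \<in> borel_measurable \<mu>"
    unfolding p_def n_def by measurable
  have ip: "integrable \<mu> p" and "in": "integrable \<mu> n"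
    unfolding p_def n_def using iv by auto
  have fin: "finite_measure (density \<mu> (\<lambda>x. ennreal (u x)))" if "integrable \<mu> u" "\<And>x. u x \<ge> 0" for u
  proof (rule finite_measureI)
    have m: "u \<in> borel_measurable \<mu>" using that by auto
    have "(\<integral>\<^sup>+x. ennreal (u x) \<partial>\<mu>) < \<infinity>"
      using that by (simp add: integrable_iff_bounded)
    moreover have "emeasure (density \<mu> (\<lambda>x. ennreal (u x))) (space \<mu>) = (\<integral>\<^sup>+x. ennreal (u x) \<partial>\<mu>)"
      using m by (subst emeasure_density) (auto intro!: nn_integral_cong)
    ultimately show "emeasure (density \<mu> (\<lambda>x. ennreal (u x))) (space (density \<mu> (\<lambda>x. ennreal (u x)))) \<noteq> \<infinity>"
      by simp
  qed
  have "density \<mu> (\<lambda>x. ennreal (p x)) = density \<mu> (\<lambda>x. ennreal (n x))"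
  proof (rule finite_measure_eqI_lipschitz[where S=S])
    fix \<phi> :: "'a \<Rightarrow> real" assume L: "\<exists>L. L-lipschitz_on UNIV \<phi>" and b: "\<And>x. 0 \<le> \<phi> x" "\<And>x. \<phi> x \<le> 1"
    then have f: "\<phi> \<in> form_dom \<delta> \<mu>" using lipschitz_in_form_dom by auto
    then have \<phi>: "\<phi> \<in> L2 \<mu>" by (simp add: form_dom_def)
    then have [measurable]: "\<phi> \<in> borel_measurable \<mu>" by (simp add: L2_def)
    have bi: "integrable \<mu> (\<lambda>x. u x * \<phi> x)" if "integrable \<mu> u" for u
      using that b
      by (intro Bochner_Integration.integrable_bound[OF that]) (auto simp: abs_mult mult_left_le)
    have "(\<integral>x. v x * \<phi> x \<partial>\<mu>) = 0"
      using eq[OF f] L2_mult_integrable[OF w \<phi>] L2_mult_integrable[OF w' \<phi>]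
      by (simp add: v_def L2_inner_def left_diff_distrib)
    moreover have "(\<integral>x. v x * \<phi> x \<partial>\<mu>) = (\<integral>x. p x * \<phi> x \<partial>\<mu>) - (\<integral>x. n x * \<phi> x \<partial>\<mu>)"
      using bi[OF ip] bi[OF "in"]
    proof -
      have "v x * \<phi> x = p x * \<phi> x - n x * \<phi> x" for x
        by (simp add: p_def n_def max_def)
      then show ?thesis
        using bi[OF ip] bi[OF "in"] by (simp add: Bochner_Integration.integral_diff)
    qed
    ultimately show "integral\<^sup>L (density \<mu> (\<lambda>x. ennreal (p x))) \<phi> =
                     integral\<^sup>L (density \<mu> (\<lambda>x. ennreal (n x))) \<phi>"
      by (subst (1 2) integral_density) (auto simp: p_def n_def)
  qed (use fin[OF ip] fin[OF "in"] in \<open>auto simp: p_def n_def sets_eq\<close>)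
  then have "AE x in \<mu>. ennreal (p x) = ennreal (n x)"
    using ip "in" by (subst (asm) density_unique_iff) auto
  then show ?thesis
  proof (rule AE_mp, intro AE_I2 impI)
    fix x assume "ennreal (p x) = ennreal (n x)"
    moreover have "p x \<ge> 0" "n x \<ge> 0" by (simp_all add: p_def n_def)
    ultimately have "p x = n x" by simp
    then show "w x = w' x" by (simp add: p_def n_def v_def max_def split: if_splits)
  qed
qed

lemma laplacian_resolvent:
  assumes "u \<in> laplacian_dom \<delta> \<mu>"
  obtains f where "is_resolvent \<delta> \<mu> f u" "laplacian \<delta> \<mu> u = (\<lambda>x. f x - u x)"
proof -
  let ?P = "\<lambda>w. \<exists>f. is_resolvent \<delta> \<mu> f u \<and> w = (\<lambda>x. f x - u x)"
  obtain f where "is_resolvent \<delta> \<mu> f u" using assms by (auto simp: laplacian_dom_def)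
  then have "?P (\<lambda>x. f x - u x)" by (intro exI[of _ f] conjI refl)
  then have "?P (SOME w. ?P w)" by (rule someI[of ?P])
  then have "?P (laplacian \<delta> \<mu> u)" unfolding laplacian_def .
  then show thesis using that by blast
qed

lemma laplacian_unique:
  assumes "is_resolvent \<delta> \<mu> f u"
  shows "AE x in \<mu>. laplacian \<delta> \<mu> u x = f x - u x"
proof -
  obtain f' where f': "is_resolvent \<delta> \<mu> f' u" "laplacian \<delta> \<mu> u = (\<lambda>x. f' x - u x)"
    by (rule laplacian_resolvent[of u]) (use assms in \<open>auto simp: laplacian_dom_def\<close>)
  have "AE x in \<mu>. f' x = f x"
    by (rule L2_eqI_form_dom) (use assms f'(1) in \<open>auto simp: is_resolvent_def\<close>)
  then show ?thesis unfolding f'(2) by (rule AE_mp) simp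
qed

end

section \<open>Weighted composition by a conformal map\<close>

text \<open>
  The two scaling laws of a conformal map \<open>g\<close>, where \<open>a\<close> is the power
  \<open>\<delta>/2\<close> of its conformal factor: the kernel \<open>d(x,y) powr (-\<delta>)\<close> and the measure
  are scaled such that \<open>d(x,y) powr (-\<delta>) a(x) a(y) d\<mu>(x) d\<mu>(y)\<close> is the pullback of
  \<open>d(x,y) powr (-\<delta>) d\<mu>(x) d\<mu>(y)\<close>.
\<close>

locale conformal_transformation = log_dirichlet_space \<mu> S \<delta>
  for \<mu> :: "'a::{metric_space, second_countable_topology} measure" and S \<delta> +
  fixes g :: "'a \<Rightarrow> 'a" and a :: "'a \<Rightarrow> real" and L lo :: real
  assumes g_measurable [measurable]: "g \<in> measurable \<mu> \<mu>"
    and a_measurable [measurable]: "a \<in> borel_measurable \<mu>"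
    and a_lipschitz: "\<And>x y. x \<in> S \<Longrightarrow> y \<in> S \<Longrightarrow> \<bar>a x - a y\<bar> \<le> L * dist x y"
    and L_nonneg: "L \<ge> 0"
    and lo_pos: "lo > 0" and a_lower: "\<And>x. x \<in> S \<Longrightarrow> lo \<le> a x"
    and dist_scaling: "\<And>x y. x \<in> S \<Longrightarrow> y \<in> S \<Longrightarrow>
          dist (g x) (g y) powr \<delta> = a x * a y * dist x y powr \<delta>"
    and measure_scaling: "distr (density \<mu> (\<lambda>x. ennreal ((a x)\<^sup>2))) \<mu> g = \<mu>"
begin

definition weighted_composition :: "('a \<Rightarrow> real) \<Rightarrow> 'a \<Rightarrow> real" where
  "weighted_composition f = (\<lambda>x. a x * f (g x))"

definition weight_kernel :: "'a \<times> 'a \<Rightarrow> real" where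
  "weight_kernel p = (a (fst p) - a (snd p)) / dist (fst p) (snd p) powr \<delta>"

definition commutator_potential :: "'a \<Rightarrow> real" where
  "commutator_potential x = (\<integral>y. weight_kernel (x, y) \<partial>\<mu>) / a x"

lemma a_pos: "x \<in> S \<Longrightarrow> a x > 0"
  using lo_pos a_lower by fastforce

lemma weight_kernel_measurable [measurable]: "weight_kernel \<in> borel_measurable (\<mu> \<Otimes>\<^sub>M \<mu>)"
  unfolding weight_kernel_def by measurable

lemma weight_kernel_bound:
  assumes "x \<in> S" "y \<in> S"
  shows "\<bar>weight_kernel (x, y)\<bar> \<le> L * dist x y powr (1 - \<delta>)"
proof -
  have "\<bar>weight_kernel (x, y)\<bar> \<le> (L * dist x y) / dist x y powr \<delta>"
    unfolding weight_kernel_def using a_lipschitz[OF assms] by (auto intro: divide_right_mono)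
  then show ?thesis by (simp flip: dist_powr_eq)
qed

lemma weight_kernel_swap: "weight_kernel (y, x) = - weight_kernel (x, y)"
proof -
  have "a y - a x = - (a x - a y)" by simp
  then show ?thesis
    unfolding weight_kernel_def fst_conv snd_conv dist_commute[of y x] minus_divide_left by simp
qed

lemma commutator_potential_measurable [measurable]: "commutator_potential \<in> borel_measurable \<mu>"
proof -
  have "(\<lambda>x. \<integral>y. weight_kernel (x, y) \<partial>\<mu>) \<in> borel_measurable \<mu>"
    by (rule borel_measurable_lebesgue_integral) simp
  then show ?thesis unfolding commutator_potential_def by measurable
qed

lemma commutator_potential_bounded: obtains B where "\<And>x. x \<in> S \<Longrightarrow> \<bar>commutator_potential x\<bar> \<le> B"
proof -
  obtain C where C: "C \<ge> 0"
      "\<And>x. x \<in> S \<Longrightarrow> (\<integral>\<^sup>+y. ennreal (dist x y powr (1 - \<delta>)) \<partial>\<mu>) \<le> ennreal C"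
    by (rule potential) blast
  show thesis
  proof (rule that)
    fix x assume x: "x \<in> S"
    have "ennreal \<bar>\<integral>y. weight_kernel (x, y) \<partial>\<mu>\<bar> \<le> (\<integral>\<^sup>+y. ennreal \<bar>weight_kernel (x, y)\<bar> \<partial>\<mu>)"
      using x by (cases "integrable \<mu> (\<lambda>y. weight_kernel (x, y))")
        (use integral_norm_bound_ennreal[of \<mu> "\<lambda>y. weight_kernel (x, y)"] in
          \<open>auto simp: not_integrable_integral_eq\<close>)
    also have "\<dots> \<le> (\<integral>\<^sup>+y. ennreal L * ennreal (dist x y powr (1 - \<delta>)) \<partial>\<mu>)"
      using weight_kernel_bound[OF x] L_nonneg
      by (intro nn_integral_mono) (auto simp: space_eq ennreal_mult'[symmetric] intro!: ennreal_leI)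
    also have "\<dots> = ennreal L * (\<integral>\<^sup>+y. ennreal (dist x y powr (1 - \<delta>)) \<partial>\<mu>)"
      by (rule nn_integral_cmult[OF potential_measurable])
    also have "\<dots> \<le> ennreal L * ennreal C"
      using C(2)[OF x] by (rule mult_left_mono) simp
    also have "\<dots> = ennreal (L * C)"
      using L_nonneg C(1) by (simp add: ennreal_mult)
    finally have "\<bar>\<integral>y. weight_kernel (x, y) \<partial>\<mu>\<bar> \<le> L * C"
      using L_nonneg C(1) by (simp add: ennreal_le_iff)
    then show "\<bar>commutator_potential x\<bar> \<le> L * C / lo"
      unfolding commutator_potential_def using a_lower[OF x] a_pos[OF x] lo_pos L_nonneg C(1)
      by (auto simp: abs_divide intro!: frac_le)
  qed
qed

lemma sigma_finite_density: "sigma_finite_measure (density \<mu> (\<lambda>x. ennreal ((a x)\<^sup>2)))"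
  by (rule sigma_finite_measure_distr[where N=\<mu> and f=g])
     (use sigma_finite_measure_axioms in \<open>auto simp: measure_scaling\<close>)

lemma pair_measure_scaling:
  "distr (density (\<mu> \<Otimes>\<^sub>M \<mu>) (\<lambda>(x, y). ennreal ((a x)\<^sup>2) * ennreal ((a y)\<^sup>2))) (\<mu> \<Otimes>\<^sub>M \<mu>)
     (\<lambda>(x, y). (g x, g y)) = \<mu> \<Otimes>\<^sub>M \<mu>"
proof -
  let ?D = "density \<mu> (\<lambda>x. ennreal ((a x)\<^sup>2))"
  have "?D \<Otimes>\<^sub>M ?D = density (\<mu> \<Otimes>\<^sub>M \<mu>) (\<lambda>(x, y). ennreal ((a x)\<^sup>2) * ennreal ((a y)\<^sup>2))"
    by (rule pair_measure_density) (use sigma_finite_measure_axioms sigma_finite_density in auto)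
  moreover have "distr ?D \<mu> g \<Otimes>\<^sub>M distr ?D \<mu> g = distr (?D \<Otimes>\<^sub>M ?D) (\<mu> \<Otimes>\<^sub>M \<mu>) (\<lambda>(x, y). (g x, g y))"
    by (rule pair_measure_distr) (use sigma_finite_measure_axioms in \<open>auto simp: measure_scaling\<close>)
  ultimately show ?thesis by (simp add: measure_scaling)
qed

lemma integral_scaling:
  fixes f :: "'a \<Rightarrow> real"
  assumes [measurable]: "f \<in> borel_measurable \<mu>"
  shows "integrable \<mu> (\<lambda>x. (a x)\<^sup>2 * f (g x)) \<longleftrightarrow> integrable \<mu> f"
    and "(\<integral>x. (a x)\<^sup>2 * f (g x) \<partial>\<mu>) = integral\<^sup>L \<mu> f"
proof -
  let ?D = "density \<mu> (\<lambda>x. ennreal ((a x)\<^sup>2))"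
  have "integrable \<mu> f \<longleftrightarrow> integrable (distr ?D \<mu> g) f" by (simp add: measure_scaling)
  also have "\<dots> \<longleftrightarrow> integrable ?D (\<lambda>x. f (g x))"
    by (rule integrable_distr_eq) auto
  also have "\<dots> \<longleftrightarrow> integrable \<mu> (\<lambda>x. (a x)\<^sup>2 * f (g x))"
    by (rule integrable_real_density) auto
  finally show "integrable \<mu> (\<lambda>x. (a x)\<^sup>2 * f (g x)) \<longleftrightarrow> integrable \<mu> f" by simp
  have "integral\<^sup>L \<mu> f = integral\<^sup>L (distr ?D \<mu> g) f" by (simp add: measure_scaling)
  also have "\<dots> = integral\<^sup>L ?D (\<lambda>x. f (g x))"
    by (rule integral_distr) auto
  also have "\<dots> = (\<integral>x. (a x)\<^sup>2 * f (g x) \<partial>\<mu>)"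
    by (rule integral_real_density) auto
  finally show "(\<integral>x. (a x)\<^sup>2 * f (g x) \<partial>\<mu>) = integral\<^sup>L \<mu> f" by simp
qed

lemma pair_integral_scaling:
  fixes F :: "'a \<times> 'a \<Rightarrow> real"
  assumes [measurable]: "F \<in> borel_measurable (\<mu> \<Otimes>\<^sub>M \<mu>)"
  defines "G \<equiv> \<lambda>p. (a (fst p))\<^sup>2 * (a (snd p))\<^sup>2 * F (g (fst p), g (snd p))"
  shows "integrable (\<mu> \<Otimes>\<^sub>M \<mu>) G \<longleftrightarrow> integrable (\<mu> \<Otimes>\<^sub>M \<mu>) F"
    and "integral\<^sup>L (\<mu> \<Otimes>\<^sub>M \<mu>) G = integral\<^sup>L (\<mu> \<Otimes>\<^sub>M \<mu>) F"
proof -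
  let ?D = "density (\<mu> \<Otimes>\<^sub>M \<mu>) (\<lambda>p. ennreal ((a (fst p))\<^sup>2 * (a (snd p))\<^sup>2))"
  have D: "distr ?D (\<mu> \<Otimes>\<^sub>M \<mu>) (\<lambda>p. (g (fst p), g (snd p))) = \<mu> \<Otimes>\<^sub>M \<mu>"
    using pair_measure_scaling by (simp add: case_prod_unfold ennreal_mult)
  have "integrable (\<mu> \<Otimes>\<^sub>M \<mu>) F \<longleftrightarrow> integrable (distr ?D (\<mu> \<Otimes>\<^sub>M \<mu>) (\<lambda>p. (g (fst p), g (snd p)))) F"
    by (simp add: D)
  also have "\<dots> \<longleftrightarrow> integrable ?D (\<lambda>p. F (g (fst p), g (snd p)))"
    by (rule integrable_distr_eq) auto
  also have "\<dots> \<longleftrightarrow> integrable (\<mu> \<Otimes>\<^sub>M \<mu>) G"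
    unfolding G_def by (rule integrable_real_density) auto
  finally show "integrable (\<mu> \<Otimes>\<^sub>M \<mu>) G \<longleftrightarrow> integrable (\<mu> \<Otimes>\<^sub>M \<mu>) F" by simp
  have "integral\<^sup>L (\<mu> \<Otimes>\<^sub>M \<mu>) F = integral\<^sup>L (distr ?D (\<mu> \<Otimes>\<^sub>M \<mu>) (\<lambda>p. (g (fst p), g (snd p)))) F"
    by (simp add: D)
  also have "\<dots> = integral\<^sup>L ?D (\<lambda>p. F (g (fst p), g (snd p)))"
    by (rule integral_distr) auto
  also have "\<dots> = integral\<^sup>L (\<mu> \<Otimes>\<^sub>M \<mu>) G"
    unfolding G_def by (rule integral_real_density) auto
  finally show "integral\<^sup>L (\<mu> \<Otimes>\<^sub>M \<mu>) G = integral\<^sup>L (\<mu> \<Otimes>\<^sub>M \<mu>) F" by simp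
qed

lemma weighted_composition_measurable [measurable]:
  assumes [measurable]: "f \<in> borel_measurable \<mu>"
  shows "weighted_composition f \<in> borel_measurable \<mu>"
  unfolding weighted_composition_def by measurable

lemma weighted_composition_L2:
  assumes "f \<in> L2 \<mu>"
  shows "weighted_composition f \<in> L2 \<mu>"
proof -
  have [measurable]: "f \<in> borel_measurable \<mu>" and "integrable \<mu> (\<lambda>x. (f x)\<^sup>2)"
    using assms by (auto simp: L2_def)
  then have "integrable \<mu> (\<lambda>x. (a x)\<^sup>2 * (f (g x))\<^sup>2)"
    by (subst integral_scaling(1)[of "\<lambda>x. (f x)\<^sup>2"]) auto
  then show ?thesis
    by (auto simp: L2_def) (simp add: weighted_composition_def power_mult_distrib)
qed

lemma weighted_composition_inner:
  assumes [measurable]: "f \<in> borel_measurable \<mu>" "h \<in> borel_measurable \<mu>"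
  shows "L2_inner \<mu> (weighted_composition f) (weighted_composition h) = L2_inner \<mu> f h"
  using integral_scaling(2)[of "\<lambda>x. f x * h x"]
  by (simp add: L2_inner_def weighted_composition_def power2_eq_square mult_ac)

text \<open>
  The algebraic core: after the kernel is rewritten by \<open>dist_scaling\<close>, the part that does not come from the
  form at the image points contains the difference of the weights as a factor, so it is less singular on the diagonal.
\<close>

lemma difference_kernel_weighted_composition:
  fixes f h :: "'a \<Rightarrow> real"
  assumes S: "x \<in> S" "y \<in> S"
  defines "m \<equiv> \<lambda>x. a x * f (g x) * h (g x)"
  shows "difference_kernel (weighted_composition f) (weighted_composition h) (x, y) =
           (a x)\<^sup>2 * (a y)\<^sup>2 * difference_kernel f h (g x, g y) + (m x - m y) * weight_kernel (x, y)"
proof -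
  have *: "(A * F - B * F') * (A * H - B * H') / q =
             A\<^sup>2 * B\<^sup>2 * ((F - F') * (H - H') / (A * B * q)) + (A * F * H - B * F' * H') * ((A - B) / q)"
    if "A > 0" "B > 0" for A B F F' H H' q :: real
    \<comment> \<open>On the diagonal \<open>q = 0\<close>, and both sides vanish because division by zero gives zero.\<close>
    using that by (cases "q = 0") (simp_all add: field_simps power2_eq_square)
  show ?thesis
    unfolding difference_kernel_def weighted_composition_def weight_kernel_def m_def fst_conv snd_conv
      dist_scaling[OF S]
    by (rule *) (use a_pos S in auto)
qed

text \<open>
  In the integral of \<open>(m(x) - m(y)) k(x,y)\<close> with \<open>k\<close> antisymmetric, the exchange of
  \<open>x\<close> and \<open>y\<close> identifies the two parts. Each one is integrable by itself since
  \<open>k\<close> is of order \<open>d(x,y) powr (1 - \<delta>)\<close>, and integration over \<open>y\<close> first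
  yields the potential.
\<close>

lemma weighted_composition_form:
  assumes f: "f \<in> form_dom \<delta> \<mu>" and h: "h \<in> form_dom \<delta> \<mu>"
  defines "K \<equiv> difference_kernel (weighted_composition f) (weighted_composition h)"
  shows "integrable (\<mu> \<Otimes>\<^sub>M \<mu>) K"
    and "integral\<^sup>L (\<mu> \<Otimes>\<^sub>M \<mu>) K = integral\<^sup>L (\<mu> \<Otimes>\<^sub>M \<mu>) (difference_kernel f h) +
      2 * L2_inner \<mu> (\<lambda>x. commutator_potential x * weighted_composition f x) (weighted_composition h)"
proof -
  have fL: "f \<in> L2 \<mu>" "h \<in> L2 \<mu>" using f h by (auto simp: form_dom_def)
  then have [measurable]: "f \<in> borel_measurable \<mu>" "h \<in> borel_measurable \<mu>" by (auto simp: L2_def)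
  define m where "m = (\<lambda>x. a x * f (g x) * h (g x))"
  have [measurable]: "m \<in> borel_measurable \<mu>" unfolding m_def by measurable
  have im: "integrable \<mu> m"
  proof (rule Bochner_Integration.integrable_bound)
    show "integrable \<mu> (\<lambda>x. 1 / lo * (weighted_composition f x * weighted_composition h x))"
      by (intro integrable_mult_right L2_mult_integrable weighted_composition_L2 fL)
    show "AE x in \<mu>. norm (m x) \<le> norm (1 / lo * (weighted_composition f x * weighted_composition h x))"
    proof (rule AE_I2)
      fix x assume "x \<in> space \<mu>"
      then have x: "x \<in> S" by (simp add: space_eq)
      have "lo * \<bar>m x\<bar> \<le> a x * \<bar>m x\<bar>" using a_lower[OF x] by (rule mult_right_mono) simp
      also have "\<dots> = \<bar>weighted_composition f x * weighted_composition h x\<bar>"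
        using a_pos[OF x] by (simp add: m_def weighted_composition_def abs_mult mult_ac)
      finally show "norm (m x) \<le> norm (1 / lo * (weighted_composition f x * weighted_composition h x))"
        using lo_pos by (simp add: abs_mult field_simps)
    qed
  qed simp
  have k1: "integrable (\<mu> \<Otimes>\<^sub>M \<mu>) (\<lambda>p. m (fst p) * weight_kernel p)"
    by (rule dominated_pair_integrable[where L=L]) (use weight_kernel_bound L_nonneg im in auto)
  have swap: "(\<lambda>(x, y). m (fst (y, x)) * weight_kernel (y, x)) = (\<lambda>p. - (m (snd p) * weight_kernel p))"
  proof
    fix p
    show "(case p of (x, y) \<Rightarrow> m (fst (y, x)) * weight_kernel (y, x)) = - (m (snd p) * weight_kernel p)"
      using weight_kernel_swap[of "snd p" "fst p"] by (simp add: case_prod_unfold)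
  qed
  have k2: "integrable (\<mu> \<Otimes>\<^sub>M \<mu>) (\<lambda>p. - (m (snd p) * weight_kernel p))"
    using P.integrable_product_swap[OF k1] unfolding swap .
  have k2': "integral\<^sup>L (\<mu> \<Otimes>\<^sub>M \<mu>) (\<lambda>p. - (m (snd p) * weight_kernel p)) =
             integral\<^sup>L (\<mu> \<Otimes>\<^sub>M \<mu>) (\<lambda>p. m (fst p) * weight_kernel p)"
    using P.integral_product_swap[of "\<lambda>p. m (fst p) * weight_kernel p"] unfolding swap by simp
  define G where "G = (\<lambda>p. (a (fst p))\<^sup>2 * (a (snd p))\<^sup>2 * difference_kernel f h (g (fst p), g (snd p)))"
  have dkm: "difference_kernel f h \<in> borel_measurable (\<mu> \<Otimes>\<^sub>M \<mu>)" by measurable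
  have G: "integrable (\<mu> \<Otimes>\<^sub>M \<mu>) G"
          "integral\<^sup>L (\<mu> \<Otimes>\<^sub>M \<mu>) G = integral\<^sup>L (\<mu> \<Otimes>\<^sub>M \<mu>) (difference_kernel f h)"
    unfolding G_def using pair_integral_scaling[OF dkm] difference_kernel_integrable[OF f h] by auto
  define N where "N = (\<lambda>p. G p + (m (fst p) * weight_kernel p + - (m (snd p) * weight_kernel p)))"
  have KN: "K p = N p" if p_in: "p \<in> space (\<mu> \<Otimes>\<^sub>M \<mu>)" for p
  proof -
    obtain x y where p: "p = (x, y)" "x \<in> S" "y \<in> S"
      using p_in by (auto simp: space_pair_measure space_eq)
    show ?thesis
      unfolding K_def N_def G_def p(1) difference_kernel_weighted_composition[OF p(2,3), of f h]
      by (simp add: m_def algebra_simps)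
  qed
  have iN: "integrable (\<mu> \<Otimes>\<^sub>M \<mu>) N"
    unfolding N_def by (intro Bochner_Integration.integrable_add G k1 k2)
  then show "integrable (\<mu> \<Otimes>\<^sub>M \<mu>) K"
    using KN by (simp cong: Bochner_Integration.integrable_cong)
  have "integral\<^sup>L (\<mu> \<Otimes>\<^sub>M \<mu>) K = integral\<^sup>L (\<mu> \<Otimes>\<^sub>M \<mu>) N"
    using KN by (rule Bochner_Integration.integral_cong[OF refl])
  also have "\<dots> = integral\<^sup>L (\<mu> \<Otimes>\<^sub>M \<mu>) (difference_kernel f h) +
                2 * integral\<^sup>L (\<mu> \<Otimes>\<^sub>M \<mu>) (\<lambda>p. m (fst p) * weight_kernel p)"
    unfolding N_def
    by (subst Bochner_Integration.integral_add[OF G(1) Bochner_Integration.integrable_add[OF k1 k2]],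
        subst Bochner_Integration.integral_add[OF k1 k2], unfold k2' G(2)) simp
  also have "integral\<^sup>L (\<mu> \<Otimes>\<^sub>M \<mu>) (\<lambda>p. m (fst p) * weight_kernel p) =
             (\<integral>x. \<integral>y. m x * weight_kernel (x, y) \<partial>\<mu> \<partial>\<mu>)"
    using P.integral_fst'[OF k1] by simp
  also have "\<dots> = L2_inner \<mu> (\<lambda>x. commutator_potential x * weighted_composition f x)
                   (weighted_composition h)"
    unfolding L2_inner_def
  proof (rule Bochner_Integration.integral_cong[OF refl])
    fix x assume "x \<in> space \<mu>"
    then show "(\<integral>y. m x * weight_kernel (x, y) \<partial>\<mu>) =
        commutator_potential x * weighted_composition f x * weighted_composition h x"
      using a_pos[of x]
      by (simp add: space_eq commutator_potential_def m_def weighted_composition_def)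
  qed
  finally show "integral\<^sup>L (\<mu> \<Otimes>\<^sub>M \<mu>) K = integral\<^sup>L (\<mu> \<Otimes>\<^sub>M \<mu>) (difference_kernel f h) +
      2 * L2_inner \<mu> (\<lambda>x. commutator_potential x * weighted_composition f x) (weighted_composition h)" .
qed

lemma weighted_composition_form_dom:
  "f \<in> form_dom \<delta> \<mu> \<Longrightarrow> weighted_composition f \<in> form_dom \<delta> \<mu>"
  using weighted_composition_form(1)[of f f] weighted_composition_L2 form_dom_iff by blast

lemma form_weighted_composition:
  assumes f: "f \<in> form_dom \<delta> \<mu>" and h: "h \<in> form_dom \<delta> \<mu>"
  shows "form \<delta> \<mu> (weighted_composition f) (weighted_composition h) = form \<delta> \<mu> f h +
      L2_inner \<mu> (\<lambda>x. commutator_potential x * weighted_composition f x) (weighted_composition h)"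
  unfolding form_eq[OF f h] form_eq[OF weighted_composition_form_dom[OF f] weighted_composition_form_dom[OF h]]
    weighted_composition_form(2)[OF f h] by simp

lemma bounded_commutator_potential_composition:
  "bounded_operator_L2 \<mu> (\<lambda>f x. commutator_potential x * weighted_composition f x)"
proof -
  obtain B where B: "\<And>x. x \<in> S \<Longrightarrow> \<bar>commutator_potential x\<bar> \<le> B"
    by (rule commutator_potential_bounded) blast
  note * = L2_bounded_mult[OF commutator_potential_measurable B weighted_composition_L2]
  have "L2_norm \<mu> (weighted_composition f) = L2_norm \<mu> f" if "f \<in> L2 \<mu>" for f
    using that by (simp add: L2_norm_def L2_def weighted_composition_inner)
  then have "\<forall>f\<in>L2 \<mu>. L2_norm \<mu> (\<lambda>x. commutator_potential x * weighted_composition f x) \<le> \<bar>B\<bar> * L2_norm \<mu> f"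
    using *(2) by auto
  then show ?thesis
    unfolding bounded_operator_L2_def using *(1)
    by (auto simp: weighted_composition_def algebra_simps)
qed

end

lemma (in log_dirichlet_space) form_cong:
  assumes "\<And>x. x \<in> S \<Longrightarrow> h x = h' x"
  shows "form \<delta> \<mu> f h = form \<delta> \<mu> f h'"
proof -
  have "(\<integral>x. \<integral>y. (f x - f y) * (h x - h y) / dist x y powr \<delta> \<partial>\<mu> \<partial>\<mu>) =
        (\<integral>x. \<integral>y. (f x - f y) * (h' x - h' y) / dist x y powr \<delta> \<partial>\<mu> \<partial>\<mu>)"
    by (intro Bochner_Integration.integral_cong refl) (simp add: space_eq assms)
  then show ?thesis by (simp add: form_def)
qed

lemma (in log_dirichlet_space) L2_inner_cong:
  assumes "\<And>x. x \<in> S \<Longrightarrow> h x = h' x"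
  shows "L2_inner \<mu> f h = L2_inner \<mu> f h'"
  unfolding L2_inner_def
  by (intro Bochner_Integration.integral_cong refl) (simp add: space_eq assms)

locale invertible_conformal_transformation =
  conformal_transformation \<mu> S \<delta> g a L lo + inverse: conformal_transformation \<mu> S \<delta> g' a' L' lo'
  for \<mu> :: "'a::{metric_space, second_countable_topology} measure" and S \<delta> g a L lo g' a' L' lo' +
  assumes inverse_map: "\<And>x. x \<in> S \<Longrightarrow> g' (g x) = x"
    and inverse_weight: "\<And>x. x \<in> S \<Longrightarrow> a x * a' (g x) = 1"
begin

text \<open>
  Test functions \<open>h\<close> are written as \<open>U h'\<close> with \<open>h' = U\<^sup>-\<^sup>1 h\<close> in the
  form domain. The extra term of \<open>form_weighted_composition\<close> is an inner product with a square integrable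
  function, so it can be moved to the right side of the resolvent equation.
\<close>

lemma is_resolvent_weighted_composition:
  assumes r: "is_resolvent \<delta> \<mu> f u"
  shows "is_resolvent \<delta> \<mu>
    (\<lambda>x. weighted_composition f x + commutator_potential x * weighted_composition u x)
    (weighted_composition u)"
proof -
  let ?U = weighted_composition
  let ?b = "\<lambda>x. commutator_potential x * ?U u x"
  have f: "f \<in> L2 \<mu>" and u: "u \<in> form_dom \<delta> \<mu>"
    and eq: "\<And>h. h \<in> form_dom \<delta> \<mu> \<Longrightarrow> L2_inner \<mu> u h + form \<delta> \<mu> u h = L2_inner \<mu> f h"
    using r by (auto simp: is_resolvent_def)
  have uL: "u \<in> L2 \<mu>" using u by (simp add: form_dom_def)
  have bL: "?b \<in> L2 \<mu>"
    using bounded_commutator_potential_composition uL by (auto simp: bounded_operator_L2_def)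
  have UfL: "?U f \<in> L2 \<mu>" using f by (rule weighted_composition_L2)
  have "L2_inner \<mu> (?U u) h + form \<delta> \<mu> (?U u) h = L2_inner \<mu> (\<lambda>x. ?U f x + ?b x) h"
    if h: "h \<in> form_dom \<delta> \<mu>" for h
  proof -
    define h' where "h' = inverse.weighted_composition h"
    have h': "h' \<in> form_dom \<delta> \<mu>"
      unfolding h'_def using h by (rule inverse.weighted_composition_form_dom)
    have meas: "u \<in> borel_measurable \<mu>" "f \<in> borel_measurable \<mu>" "h' \<in> borel_measurable \<mu>"
      using u h' f by (auto simp: form_dom_def L2_def)
    have hh: "h x = ?U h' x" if "x \<in> S" for x
      using inverse_map[OF that] inverse_weight[OF that]
      by (simp add: h'_def weighted_composition_def inverse.weighted_composition_def mult.assoc[symmetric])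
    have UhL: "?U h' \<in> L2 \<mu>" using h' by (intro weighted_composition_L2) (simp add: form_dom_def)
    have "L2_inner \<mu> (?U u) h + form \<delta> \<mu> (?U u) h =
          L2_inner \<mu> (?U u) (?U h') + form \<delta> \<mu> (?U u) (?U h')"
      using form_cong[of h "?U h'"] L2_inner_cong[of h "?U h'"] hh by simp
    also have "\<dots> = L2_inner \<mu> u h' + form \<delta> \<mu> u h' + L2_inner \<mu> ?b (?U h')"
      using meas by (simp add: weighted_composition_inner form_weighted_composition[OF u h'])
    also have "\<dots> = L2_inner \<mu> (?U f) (?U h') + L2_inner \<mu> ?b (?U h')"
      using meas by (simp add: eq[OF h'] weighted_composition_inner)
    also have "\<dots> = L2_inner \<mu> (\<lambda>x. ?U f x + ?b x) (?U h')"
      using L2_mult_integrable[OF UfL UhL] L2_mult_integrable[OF bL UhL]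
      by (simp add: L2_inner_def distrib_right)
    also have "\<dots> = L2_inner \<mu> (\<lambda>x. ?U f x + ?b x) h"
      using L2_inner_cong[of h "?U h'"] hh by simp
    finally show ?thesis .
  qed
  then show ?thesis
    using L2_add[OF UfL bL] weighted_composition_form_dom[OF u] by (simp add: is_resolvent_def)
qed

theorem commutator_bounded:
  "(\<forall>u\<in>laplacian_dom \<delta> \<mu>. weighted_composition u \<in> laplacian_dom \<delta> \<mu>) \<and>
   (\<exists>T. bounded_operator_L2 \<mu> T \<and>
      (\<forall>u\<in>laplacian_dom \<delta> \<mu>. AE x in \<mu>.
         T u x = laplacian \<delta> \<mu> (weighted_composition u) x - weighted_composition (laplacian \<delta> \<mu> u) x))"
proof (intro conjI exI ballI)
  fix u assume u: "u \<in> laplacian_dom \<delta> \<mu>"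
  then obtain f where f: "is_resolvent \<delta> \<mu> f u" "laplacian \<delta> \<mu> u = (\<lambda>x. f x - u x)"
    by (rule laplacian_resolvent)
  note r = is_resolvent_weighted_composition[OF f(1)]
  then show "weighted_composition u \<in> laplacian_dom \<delta> \<mu>" by (auto simp: laplacian_dom_def)
  from laplacian_unique[OF r]
  show "AE x in \<mu>. commutator_potential x * weighted_composition u x =
      laplacian \<delta> \<mu> (weighted_composition u) x - weighted_composition (laplacian \<delta> \<mu> u) x"
    by (rule AE_mp) (simp add: f(2) weighted_composition_def algebra_simps)
qed (rule bounded_commutator_potential_composition)

end

section \<open>Orbits near boundary points of a convex cocompact group\<close>

text \<open>
  The images of the open sets of points with an orbit point of norm below \<open>1 - 1/(n+1)\<close> form an increasing
  open cover of the quotient, so one of them is everything.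
\<close>

lemma (in kleinian) cocompact_returns:
  assumes "convex_cocompact \<Gamma>"
  obtains R where "R < 1" "\<And>p. p \<in> convex_core \<Gamma> \<Longrightarrow> \<exists>A\<in>\<Gamma>. norm (ball_act A p) \<le> R"
proof -
  let ?C = "convex_core \<Gamma>"
  let ?Q = "quotient_topology (top_of_set ?C) (orbit \<Gamma>)"
  have top: "topspace ?Q = orbit \<Gamma> ` ?C"
    using quotient_map_quotient_topology[of "top_of_set ?C" "orbit \<Gamma>"]
    by (simp add: quotient_map_def)
  have C: "?C \<subseteq> ball 0 1" by (auto simp: convex_core_def hyperbolic_geodesic_def)
  define V where "V n = {p \<in> ?C. \<exists>A\<in>\<Gamma>. norm (ball_act A p) < 1 - 1 / (real n + 1)}" for n
  define U where "U n = orbit \<Gamma> ` V n" for n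
  have preimage: "{p \<in> ?C. orbit \<Gamma> p \<in> U n} = V n" for n
  proof (intro equalityI subsetI)
    fix p assume "p \<in> {p \<in> ?C. orbit \<Gamma> p \<in> U n}"
    then obtain q A where p: "p \<in> ?C" and q: "orbit \<Gamma> p = orbit \<Gamma> q" "A \<in> \<Gamma>"
        "norm (ball_act A q) < 1 - 1 / (real n + 1)"
      by (auto simp: U_def V_def)
    have "ball_act A q \<in> orbit \<Gamma> p" using q by (auto simp: orbit_def)
    then obtain B where "B \<in> \<Gamma>" "ball_act A q = ball_act B p" by (auto simp: orbit_def)
    then show "p \<in> V n" using p q(3) by (auto simp: V_def)
  qed (auto simp: U_def V_def)
  have open_V: "openin (top_of_set ?C) (V n)" for n
  proof -
    have eq: "V n = (\<Union>A\<in>\<Gamma>. ?C \<inter> (\<lambda>p. norm (ball_act A p)) -` {..<1 - 1 / (real n + 1)})"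
      by (auto simp: V_def)
    have "openin (top_of_set ?C) (?C \<inter> (\<lambda>p. norm (ball_act A p)) -` {..<1 - 1 / (real n + 1)})"
      if "A \<in> \<Gamma>" for A
      by (intro continuous_openin_preimage_gen continuous_on_norm
            continuous_on_subset[OF ball_act_continuous[OF in_SO_plus[OF that]] C]) auto
    then show ?thesis unfolding eq by (intro openin_Union) auto
  qed
  have "openin ?Q (U n)" for n
    unfolding openin_quotient_topology using open_V[of n] preimage[of n] by (auto simp: U_def V_def)
  moreover have "topspace ?Q \<subseteq> \<Union>(range U)"
  proof
    fix c assume "c \<in> topspace ?Q"
    then obtain p where p: "p \<in> ?C" "c = orbit \<Gamma> p" using top by auto
    have id: "mat 1 \<in> \<Gamma>" using kleinian_group by (simp add: kleinian_group_def)
    have "norm (ball_act (mat 1) p) < 1"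
      using p(1) C by (intro norm_ball_act[OF in_SO_plus[OF id]]) auto
    then obtain n where "inverse (real (Suc n)) < 1 - norm (ball_act (mat 1) p)"
      using reals_Archimedean[of "1 - norm (ball_act (mat 1) p)"] by auto
    then have "norm (ball_act (mat 1) p) < 1 - 1 / (real n + 1)"
      by (simp add: inverse_eq_divide add.commute)
    then show "c \<in> \<Union>(range U)" using p id by (auto simp: U_def V_def)
  qed
  ultimately obtain F where F: "finite F" "F \<subseteq> range U" "topspace ?Q \<subseteq> \<Union>F"
    using assms unfolding convex_cocompact_def compact_space_alt
    by (metis (no_types, lifting) rangeE)
  then obtain I where I: "finite I" "F = U ` I" by (metis finite_subset_image)
  define N where "N = Max (insert 0 I)"
  show thesis
  proof (rule that)
    show "1 - 1 / (real N + 1) < 1" by simp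
    fix p assume p: "p \<in> ?C"
    then obtain n where n: "n \<in> I" "orbit \<Gamma> p \<in> U n"
      using F(3) I(2) top by blast
    then have "p \<in> V n" using p preimage by blast
    then obtain A where A: "A \<in> \<Gamma>" "norm (ball_act A p) < 1 - 1 / (real n + 1)" by (auto simp: V_def)
    have "n \<le> N" unfolding N_def using n(1) I(1) by (intro Max_ge) auto
    then have "1 / (real N + 1) \<le> 1 / (real n + 1)" by (simp add: field_simps)
    then show "\<exists>A\<in>\<Gamma>. norm (ball_act A p) \<le> 1 - 1 / (real N + 1)" using A by (intro bexI[of _ A]) auto
  qed
qed

lemma lorentz_inner_ray_ball:
  assumes "norm z = 1" "norm p < 1"
  shows "lorentz_inner (minkowski z 1) (ball_to_hyperboloid p) = - ((norm (z - p))\<^sup>2 / (1 - (norm p)\<^sup>2))"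
proof -
  have "(norm (z - p))\<^sup>2 = 1 + (norm p)\<^sup>2 - 2 * (z \<bullet> p)"
    using assms(1) by (simp add: power2_norm_eq_inner inner_diff_left inner_diff_right norm_eq_1 inner_commute)
  then show ?thesis
    by (simp add: lorentz_inner_def ball_to_hyperboloid_def diff_divide_distrib add_divide_distrib)
qed

text \<open>
  The ratio \<open>|z - p|\<^sup>2 / (1 - |p|\<^sup>2)\<close> is, up to the sign, the Lorentz product of the ray of
  \<open>z\<close> with the hyperboloid point of \<open>p\<close>. Applying \<open>A\<close> turns it into
  \<open>ray_scale A z\<close> times the same ratio for \<open>A z\<close> and \<open>A p\<close>, and the latter is
  bounded below when \<open>A p\<close> stays away from the sphere.
\<close>

lemma ray_scale_le:
  assumes A: "A \<in> SO_plus" and z: "norm z = 1" and p: "norm p < 1"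
    and R: "norm (ball_act A p) \<le> R" "R < 1"
  shows "ray_scale A z \<le> 2 / (1 - R) * ((norm (z - p))\<^sup>2 / (1 - (norm p)\<^sup>2))"
proof -
  let ?q = "ball_act A p" and ?z' = "sphere_act A z" and ?\<tau> = "ray_scale A z"
  have q: "norm ?q < 1" by (rule norm_ball_act[OF A p])
  have z': "norm ?z' = 1" by (rule norm_sphere_act[OF A z])
  have \<tau>: "?\<tau> > 0" by (rule ray_scale_pos[OF A z])
  have "lorentz_inner (A *v minkowski z 1) (A *v ball_to_hyperboloid p) =
        lorentz_inner (minkowski z 1) (ball_to_hyperboloid p)"
    by (rule SO_plus_isometry[OF A])
  moreover have "lorentz_inner (A *v minkowski z 1) (A *v ball_to_hyperboloid p) =
      ?\<tau> * lorentz_inner (minkowski ?z' 1) (ball_to_hyperboloid ?q)"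
    unfolding ray_image[OF A z] ball_to_hyperboloid_ball_act[OF A p] 
    by (simp add: lorentz_inner_def right_diff_distrib)
  ultimately have eq: "?\<tau> * ((norm (?z' - ?q))\<^sup>2 / (1 - (norm ?q)\<^sup>2)) = (norm (z - p))\<^sup>2 / (1 - (norm p)\<^sup>2)"
    unfolding lorentz_inner_ray_ball[OF z p] lorentz_inner_ray_ball[OF z' q] by simp
  have "(1 - R) / 2 \<le> (norm (?z' - ?q))\<^sup>2 / (1 - (norm ?q)\<^sup>2)"
  proof -
    have c: "1 - (norm ?q)\<^sup>2 > 0" by (rule one_minus_norm_pos[OF q])
    have "1 - norm ?q \<le> norm (?z' - ?q)" using norm_triangle_ineq2[of ?z' ?q] z' by simp
    then have "(1 - norm ?q)\<^sup>2 \<le> (norm (?z' - ?q))\<^sup>2" using q by (intro power_mono) auto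
    moreover have "(1 - R) / 2 * (1 - (norm ?q)\<^sup>2) \<le> (1 - norm ?q)\<^sup>2"
    proof -
      have "(1 - R) / 2 * (1 - (norm ?q)\<^sup>2) = ((1 - R) * (1 - norm ?q)) * ((1 + norm ?q) / 2)"
      proof -
        have "1 - (norm ?q)\<^sup>2 = (1 - norm ?q) * (1 + norm ?q)"
          by (simp add: power2_eq_square algebra_simps)
        then show ?thesis by (simp only: times_divide_eq_left times_divide_eq_right mult.assoc)
      qed
      also have "\<dots> \<le> ((1 - norm ?q) * (1 - norm ?q)) * 1"
        using R q by (intro mult_mono) auto
      finally show ?thesis by (simp add: power2_eq_square)
    qed
    ultimately have "(1 - R) / 2 * (1 - (norm ?q)\<^sup>2) \<le> (norm (?z' - ?q))\<^sup>2" by linarith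
    then show ?thesis using c by (simp add: pos_le_divide_eq)
  qed
  then have "?\<tau> * ((1 - R) / 2) \<le> (norm (z - p))\<^sup>2 / (1 - (norm p)\<^sup>2)"
    unfolding eq[symmetric] using \<tau> by (intro mult_left_mono) auto
  moreover have "t \<le> 2 / (1 - R) * X" if "t * ((1 - R) / 2) \<le> X" for t X
    using R(2) that by (simp add: field_simps)
  ultimately show ?thesis by blast
qed

text \<open>
  Take the geodesic from a limit point \<open>\<eta>\<close> to \<open>x\<close> and on it the point \<open>p\<close> at
  Euclidean distance about \<open>r\<close> from \<open>x\<close>. For \<open>z\<close> in the ball of radius
  \<open>r\<close> around \<open>x\<close> the ratio \<open>|z - p|\<^sup>2 / (1 - |p|\<^sup>2)\<close> is then of order
  \<open>r\<close>, and a group element that brings \<open>p\<close> back to a fixed ball expands near \<open>x\<close>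
  by a factor of order \<open>1/r\<close>. The constant is uniform because \<open>\<eta>\<close> can be chosen among two
  fixed limit points such that it is not close to \<open>x\<close>.
\<close>

lemma (in kleinian) uniformly_conical:
  assumes "convex_cocompact \<Gamma>" "non_elementary \<Gamma>"
  obtains K where "K > 0"
    "\<And>x r. x \<in> limit_set \<Gamma> \<Longrightarrow> 0 < r \<Longrightarrow> r \<le> 1 \<Longrightarrow>
       \<exists>A\<in>\<Gamma>. \<forall>z\<in>limit_set \<Gamma>. dist z x \<le> r \<longrightarrow> ray_scale A z \<le> K * r"
proof -
  obtain R where R: "R < 1" "\<And>p. p \<in> convex_core \<Gamma> \<Longrightarrow> \<exists>A\<in>\<Gamma>. norm (ball_act A p) \<le> R"
    by (rule cocompact_returns[OF assms(1)]) blast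
  obtain \<eta>1 \<eta>2 where \<eta>: "\<eta>1 \<in> limit_set \<Gamma>" "\<eta>2 \<in> limit_set \<Gamma>" "\<eta>1 \<noteq> \<eta>2"
  proof -
    have inf: "infinite (limit_set \<Gamma>)" using assms(2) by (simp add: non_elementary_def)
    then obtain a where a: "a \<in> limit_set \<Gamma>" by (metis finite.emptyI ex_in_conv)
    have "infinite (limit_set \<Gamma> - {a})" using inf by simp
    then obtain b where "b \<in> limit_set \<Gamma> - {a}" by (metis finite.emptyI ex_in_conv)
    then show thesis using that a by auto
  qed
  define \<epsilon> where "\<epsilon> = dist \<eta>1 \<eta>2 / 2"
  have \<epsilon>: "\<epsilon> > 0" using \<eta> by (simp add: \<epsilon>_def)
  show thesis
  proof (rule that[of "25 / ((1 - R) * \<epsilon>)"])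
    show "25 / ((1 - R) * \<epsilon>) > 0" using R(1) \<epsilon> by simp
    fix x r assume x: "x \<in> limit_set \<Gamma>" and r: "0 < r" "r \<le> (1::real)"
    obtain \<eta> where e: "\<eta> \<in> limit_set \<Gamma>" "\<epsilon> \<le> norm (x - \<eta>)"
    proof -
      have "dist \<eta>1 \<eta>2 \<le> dist x \<eta>1 + dist x \<eta>2" by (rule dist_triangle3)
      then have "\<epsilon> \<le> dist x \<eta>1 \<or> \<epsilon> \<le> dist x \<eta>2" by (auto simp: \<epsilon>_def)
      then show thesis using that \<eta> by (auto simp: dist_norm)
    qed
    define m where "m = norm (x - \<eta>)"
    have m: "m > 0" "\<epsilon> \<le> m" "x \<noteq> \<eta>" using e \<epsilon> by (auto simp: m_def)
    note nx = limit_set_norm[OF x] and ne = limit_set_norm[OF e(1)]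
    have m2: "m \<le> 2" unfolding m_def using norm_triangle_ineq4[of x \<eta>] nx ne by simp
    \<comment> \<open>This parameter makes \<open>exp (- t)\<close> equal to the radius.\<close>
    define t where "t = - ln r"
    have et: "exp t = 1 / r" "exp (- t) = r" using r by (simp_all add: t_def exp_minus inverse_eq_divide)
    define p where "p = geodesic_between x \<eta> t"
    define W where "W = m + 1 / r + r"
    have W: "W > 0" "1 / r \<le> W" using m r by (auto simp: W_def intro!: add_pos_pos)
    have p1: "norm p < 1" unfolding p_def by (rule geodesic_between_in_ball[OF nx ne m(3)])
    have pn: "1 - (norm p)\<^sup>2 = 2 * m / W"
      unfolding p_def geodesic_between_norm[OF nx ne m(3)] by (simp add: et m_def W_def)
    have "p \<in> convex_core \<Gamma>"
      unfolding convex_core_def p_def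
      using hyperbolic_geodesic_between[OF nx ne m(3)] x e(1) by blast
    then obtain A where A: "A \<in> \<Gamma>" "norm (ball_act A p) \<le> R" using R(2) by blast
    have "ray_scale A z \<le> 25 / ((1 - R) * \<epsilon>) * r" if z: "z \<in> limit_set \<Gamma>" "dist z x \<le> r" for z
    proof -
      note nz = limit_set_norm[OF z(1)]
      \<comment> \<open>Each of the three summands of \<open>W (z - p)\<close> below is bounded, so \<open>|z - p|\<close> is of order \<open>1 / W\<close>, hence of order \<open>r\<close>.\<close>
      have "W *\<^sub>R p = (1 / r) *\<^sub>R x + r *\<^sub>R \<eta>"
        using W(1) unfolding p_def geodesic_between_def et m_def[symmetric] W_def[symmetric] by simp
      then have "W *\<^sub>R (z - p) = m *\<^sub>R z + (1 / r) *\<^sub>R (z - x) + r *\<^sub>R (z - \<eta>)"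
        unfolding scaleR_diff_right by (simp add: W_def scaleR_add_left)
      then have "norm (W *\<^sub>R (z - p)) \<le> norm (m *\<^sub>R z) + norm ((1 / r) *\<^sub>R (z - x)) + norm (r *\<^sub>R (z - \<eta>))"
        by (simp only: norm_triangle_mono norm_triangle_ineq order_refl)
      also have "\<dots> \<le> 2 + 1 + 2"
      proof (intro add_mono)
        show "norm (m *\<^sub>R z) \<le> 2" using m m2 nz by simp
        show "norm ((1 / r) *\<^sub>R (z - x)) \<le> 1" using z(2) r by (simp add: dist_norm)
        have "r * norm (z - \<eta>) \<le> 1 * 2"
          using r norm_triangle_ineq4[of z \<eta>] nz ne by (intro mult_mono) auto
        then show "norm (r *\<^sub>R (z - \<eta>)) \<le> 2" using r by simp
      qed
      finally have "W * norm (z - p) \<le> 5" using W by (simp only: norm_scaleR)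
      then have "norm (z - p) \<le> 5 / W" using W by (simp add: pos_le_divide_eq mult.commute)
      then have "(norm (z - p))\<^sup>2 \<le> (5 / W)\<^sup>2" by (intro power_mono) auto
      then have "(norm (z - p))\<^sup>2 / (1 - (norm p)\<^sup>2) \<le> (5 / W)\<^sup>2 / (2 * m / W)"
        unfolding pn using m W by (intro divide_right_mono) auto
      also have "\<dots> = (25 / (2 * m)) * (1 / W)" using W m by (simp add: power2_eq_square)
      also have "\<dots> \<le> (25 / (2 * \<epsilon>)) * r"
      proof (rule mult_mono)
        show "25 / (2 * m) \<le> 25 / (2 * \<epsilon>)" using m \<epsilon> by (simp add: frac_le)
        show "1 / W \<le> r" using W r by (simp add: field_simps)
      qed (use W r \<epsilon> in auto)
      finally have *: "(norm (z - p))\<^sup>2 / (1 - (norm p)\<^sup>2) \<le> (25 / (2 * \<epsilon>)) * r" .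
      have "ray_scale A z \<le> 2 / (1 - R) * ((norm (z - p))\<^sup>2 / (1 - (norm p)\<^sup>2))"
        by (rule ray_scale_le[OF in_SO_plus[OF A(1)] nz p1 A(2) R(1)])
      also have "\<dots> \<le> 2 / (1 - R) * ((25 / (2 * \<epsilon>)) * r)"
        using * R(1) by (intro mult_left_mono) auto
      also have "\<dots> = 25 / ((1 - R) * \<epsilon>) * r" by simp
      finally show ?thesis .
    qed
    then show "\<exists>A\<in>\<Gamma>. \<forall>z\<in>limit_set \<Gamma>. dist z x \<le> r \<longrightarrow> ray_scale A z \<le> 25 / ((1 - R) * \<epsilon>) * r"
      using A(1) by blast
  qed
qed

section \<open>The limit set as a logarithmic Dirichlet space\<close>

lemma ray_scale_affine: "ray_scale A x = space_part (A $ None) \<bullet> x + time_part (A $ None)"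
  by (simp add: ray_scale_def time_part_mult inner_space_time)

lemma ray_scale_bounds:
  assumes A: "A \<in> SO_plus" and x: "norm x = 1"
  shows "time_part (A $ None) - norm (space_part (A $ None)) \<le> ray_scale A x"
    and "ray_scale A x \<le> time_part (A $ None) + norm (space_part (A $ None))"
  using Cauchy_Schwarz_ineq2[of "space_part (A $ None)" x] x
  by (auto simp: ray_scale_affine abs_le_iff)

lemma ray_scale_lipschitz:
  "\<bar>ray_scale A x - ray_scale A y\<bar> \<le> norm (space_part (A $ None)) * dist x y"
  using Cauchy_Schwarz_ineq2[of "space_part (A $ None)" "x - y"]
  by (simp add: ray_scale_affine inner_diff_right dist_norm)

lemma ray_scale_continuous: "continuous_on X (ray_scale A)"
  unfolding ray_scale_affine[abs_def] by (intro continuous_intros)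

context patterson_sullivan
begin

lemma weight_measurable: "(\<lambda>x. (1 / ray_scale A x) powr s) \<in> borel_measurable \<mu>"
proof -
  have [measurable]: "ray_scale A \<in> borel_measurable \<mu>"
    by (rule mu_measurable[OF ray_scale_continuous])
  show ?thesis by measurable
qed

lemma mu_measure_scaling:
  assumes A: "A \<in> \<Gamma>"
  shows "distr \<mu> \<mu> (sphere_act (matrix_inv A)) = density \<mu> (\<lambda>x. ennreal ((1 / ray_scale A x) powr \<delta>))"
proof (rule finite_measure_eqI_lipschitz[where S="limit_set \<Gamma>"])
  interpret finite_measure \<mu> by (rule mu_finite)
  note m = sphere_act_measurable[OF inverse_closed[OF A]]
  show "finite_measure (distr \<mu> \<mu> (sphere_act (matrix_inv A)))"
    by (rule finite_measure_distr[OF m])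
  have eq: "(\<integral>x. \<phi> x \<partial>distr \<mu> \<mu> (sphere_act (matrix_inv A))) =
        (\<integral>x. \<phi> x \<partial>density \<mu> (\<lambda>x. ennreal ((1 / ray_scale A x) powr \<delta>)))"
    if L: "\<exists>L. L-lipschitz_on UNIV \<phi>" and b: "\<And>x. 0 \<le> \<phi> x" for \<phi> :: "real ^ 'n \<Rightarrow> real"
  proof -
    have c: "continuous_on X \<phi>" for X
      using L lipschitz_on_continuous_on continuous_on_subset by blast
    have pm: "\<phi> \<in> borel_measurable \<mu>" by (rule mu_measurable[OF c])
    have "(\<integral>x. \<phi> x \<partial>distr \<mu> \<mu> (sphere_act (matrix_inv A))) = (\<integral>x. \<phi> (sphere_act (matrix_inv A) x) \<partial>\<mu>)"
      by (rule integral_distr[OF m pm])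
    also have "\<dots> = (\<integral>x. (1 / ray_scale A x) powr \<delta> * \<phi> x \<partial>\<mu>)"
      by (rule mu_integral_scaling[OF A c b])
    also have "\<dots> = (\<integral>x. \<phi> x \<partial>density \<mu> (\<lambda>x. ennreal ((1 / ray_scale A x) powr \<delta>)))"
      using pm weight_measurable by (intro integral_real_density[symmetric]) auto
    finally show ?thesis .
  qed
  show "(\<integral>x. \<phi> x \<partial>distr \<mu> \<mu> (sphere_act (matrix_inv A))) =
        (\<integral>x. \<phi> x \<partial>density \<mu> (\<lambda>x. ennreal ((1 / ray_scale A x) powr \<delta>)))"
    if "\<exists>L. L-lipschitz_on UNIV \<phi>" "\<And>x. 0 \<le> \<phi> x" "\<And>x. \<phi> x \<le> 1" for \<phi> :: "real ^ 'n \<Rightarrow> real"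
    using that(1,2) by (rule eq)
  show "finite_measure (density \<mu> (\<lambda>x. ennreal ((1 / ray_scale A x) powr \<delta>)))"
  proof (rule finite_measureI)
    obtain B where B: "\<And>x. x \<in> limit_set \<Gamma> \<Longrightarrow> (1 / ray_scale A x) powr \<delta> \<le> B"
    proof -
      have "continuous_on (limit_set \<Gamma>) (\<lambda>x. (1 / ray_scale A x) powr \<delta>)"
        using ray_scale_pos[OF in_SO_plus[OF A]] limit_set_norm
        by (intro continuous_on_powr continuous_on_divide continuous_on_const ray_scale_continuous) fastforce+
      moreover have "compact (limit_set \<Gamma>)"
        using closed_limit_set limit_set_sub_sphere by (metis compact_sphere closed_Int_compact inf.absorb1)
      ultimately have "bounded ((\<lambda>x. (1 / ray_scale A x) powr \<delta>) ` limit_set \<Gamma>)"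
        by (intro compact_imp_bounded compact_continuous_image)
      then obtain B where "\<forall>x\<in>limit_set \<Gamma>. norm ((1 / ray_scale A x) powr \<delta>) \<le> B"
        unfolding bounded_iff by blast
      then show thesis using that[of B] by force
    qed
    have "(\<integral>\<^sup>+x. ennreal ((1 / ray_scale A x) powr \<delta>) * indicator (space \<mu>) x \<partial>\<mu>) \<le> (\<integral>\<^sup>+x. ennreal B \<partial>\<mu>)"
      using B by (intro nn_integral_mono) (auto simp: mu_space intro!: ennreal_leI)
    also have "\<dots> < \<infinity>" by (simp add: emeasure_eq_measure ennreal_mult_less_top)
    finally show "emeasure (density \<mu> (\<lambda>x. ennreal ((1 / ray_scale A x) powr \<delta>)))
        (space (density \<mu> (\<lambda>x. ennreal ((1 / ray_scale A x) powr \<delta>)))) \<noteq> \<infinity>"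
      using weight_measurable by (simp add: emeasure_density)
  qed
qed (auto simp: mu_sets)

text \<open>
  The element \<open>A\<close> of \<open>uniformly_conical\<close> expands the ball around \<open>x\<close>, so by the
  scaling law its image has measure at least \<open>(1/(Kr)) powr \<delta>\<close> times that of the ball; it is at most
  the total mass.
\<close>

lemma upper_regular:
  assumes "convex_cocompact \<Gamma>" "non_elementary \<Gamma>" and \<delta>: "\<delta> \<ge> 0"
  obtains C where "C \<ge> 0" "\<And>x r. x \<in> limit_set \<Gamma> \<Longrightarrow> 0 < r \<Longrightarrow> r \<le> 1 \<Longrightarrow>
      emeasure \<mu> (limit_set \<Gamma> \<inter> cball x r) \<le> ennreal (C * r powr \<delta>)"
proof -
  interpret finite_measure \<mu> by (rule mu_finite)
  obtain K where K: "K > 0"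
    "\<And>x r. x \<in> limit_set \<Gamma> \<Longrightarrow> 0 < r \<Longrightarrow> r \<le> 1 \<Longrightarrow>
       \<exists>A\<in>\<Gamma>. \<forall>z\<in>limit_set \<Gamma>. dist z x \<le> r \<longrightarrow> ray_scale A z \<le> K * r"
    by (rule uniformly_conical[OF assms(1,2)]) blast
  let ?M = "measure \<mu> (space \<mu>)"
  show thesis
  proof (rule that[of "?M * K powr \<delta>"])
    show "?M * K powr \<delta> \<ge> 0" by simp
    fix x r assume x: "x \<in> limit_set \<Gamma>" and r: "0 < r" "r \<le> (1::real)"
    let ?S = "limit_set \<Gamma> \<inter> cball x r"
    obtain A where A: "A \<in> \<Gamma>" "\<And>z. z \<in> limit_set \<Gamma> \<Longrightarrow> dist z x \<le> r \<Longrightarrow> ray_scale A z \<le> K * r"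
      using K(2)[OF x r] by blast
    have S: "?S \<in> sets \<mu>" by (auto simp: mu_sets sets_restrict_space)
    have "ennreal ((1 / (K * r)) powr \<delta>) * emeasure \<mu> ?S =
          (\<integral>\<^sup>+z. ennreal ((1 / (K * r)) powr \<delta>) * indicator ?S z \<partial>\<mu>)"
      using S by (simp add: nn_integral_cmult_indicator)
    also have "\<dots> \<le> (\<integral>\<^sup>+z. ennreal ((1 / ray_scale A z) powr \<delta>) * indicator ?S z \<partial>\<mu>)"
    proof (rule nn_integral_mono)
      fix z
      have "(1 / (K * r)) powr \<delta> \<le> (1 / ray_scale A z) powr \<delta>" if "z \<in> ?S"
        using that A(2)[of z] ray_scale_pos[OF in_SO_plus[OF A(1)] limit_set_norm, of z] K(1) r \<delta>
        by (intro powr_mono2) (auto simp: dist_commute intro!: frac_le)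
      then show "ennreal ((1 / (K * r)) powr \<delta>) * indicator ?S z \<le>
          ennreal ((1 / ray_scale A z) powr \<delta>) * indicator ?S z"
        by (auto simp: indicator_def intro: ennreal_leI)
    qed
    also have "\<dots> = emeasure (distr \<mu> \<mu> (sphere_act (matrix_inv A))) ?S"
      unfolding mu_measure_scaling[OF A(1)] using S weight_measurable by (simp add: emeasure_density)
    also have "\<dots> \<le> emeasure \<mu> (space \<mu>)"
      using S sphere_act_measurable[OF inverse_closed[OF A(1)]]
      by (simp add: emeasure_distr emeasure_mono)
    finally have "(1 / (K * r)) powr \<delta> * measure \<mu> ?S \<le> ?M"
      by (simp add: emeasure_eq_measure ennreal_mult[symmetric])
    then have "measure \<mu> ?S \<le> ?M * K powr \<delta> * r powr \<delta>"
      using K(1) r by (simp add: powr_divide powr_mult field_simps)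
    then show "emeasure \<mu> ?S \<le> ennreal (?M * K powr \<delta> * r powr \<delta>)"
      unfolding emeasure_eq_measure by (rule ennreal_leI)
  qed
qed

text \<open>
  For \<open>\<delta> \<ge> 1\<close> the integral over the annulus \<open>r/2 < d(x,y) \<le> r\<close> is at most
  \<open>(r/2) powr (1 - \<delta>)\<close> times \<open>C r powr \<delta>\<close>, that is, a multiple of
  \<open>r\<close>, which is summable over \<open>r = 2\<^sup>-\<^sup>k\<close>.
\<close>

lemma log_dirichlet:
  assumes "convex_cocompact \<Gamma>" "non_elementary \<Gamma>"
  shows "log_dirichlet_space \<mu> (limit_set \<Gamma>) \<delta>"
proof -
  interpret finite_measure \<mu> by (rule mu_finite)
  have d2: "dist x y \<le> 2" if "x \<in> limit_set \<Gamma>" "y \<in> limit_set \<Gamma>" for x y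
    using norm_triangle_ineq4[of x y] limit_set_norm that by (simp add: dist_norm)
  have "\<exists>C. \<forall>x\<in>limit_set \<Gamma>. (\<integral>\<^sup>+y. ennreal (dist x y powr (1 - \<delta>)) \<partial>\<mu>) \<le> ennreal C"
  proof (cases "\<delta> < 1")
    case True
    have "(\<integral>\<^sup>+y. ennreal (dist x y powr (1 - \<delta>)) \<partial>\<mu>) \<le> ennreal (2 powr (1 - \<delta>) * measure \<mu> (space \<mu>))"
      if x: "x \<in> limit_set \<Gamma>" for x
    proof -
      have "(\<integral>\<^sup>+y. ennreal (dist x y powr (1 - \<delta>)) \<partial>\<mu>) \<le> (\<integral>\<^sup>+y. ennreal (2 powr (1 - \<delta>)) \<partial>\<mu>)"
        using d2[OF x] True by (intro nn_integral_mono ennreal_leI powr_mono2) (auto simp: mu_space)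
      then show ?thesis by (simp add: emeasure_eq_measure ennreal_mult)
    qed
    then show ?thesis by blast
  next
    case False
    then have \<delta>: "\<delta> \<ge> 1" by simp
    obtain C where C: "C \<ge> 0" "\<And>x r. x \<in> limit_set \<Gamma> \<Longrightarrow> 0 < r \<Longrightarrow> r \<le> 1 \<Longrightarrow>
        emeasure \<mu> (limit_set \<Gamma> \<inter> cball x r) \<le> ennreal (C * r powr \<delta>)"
      by (rule upper_regular[OF assms]) (use \<delta> in auto)
    let ?r = "\<lambda>k. (1/2::real) ^ k"
    let ?c = "C * 2 powr (\<delta> - 1)"
    have "(\<integral>\<^sup>+y. ennreal (dist x y powr (1 - \<delta>)) \<partial>\<mu>) \<le> ennreal (measure \<mu> (space \<mu>) + 2 * ?c)"
      if x: "x \<in> limit_set \<Gamma>" for x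
    proof -
      let ?B = "\<lambda>k. limit_set \<Gamma> \<inter> cball x (?r k)"
      let ?f = "\<lambda>k y. ennreal ((?r k / 2) powr (1 - \<delta>)) * indicator (?B k) y"
      have Bs: "?B k \<in> sets \<mu>" for k by (auto simp: mu_sets sets_restrict_space)
      have pw: "ennreal (dist x y powr (1 - \<delta>)) \<le> 1 + (\<Sum>k. ?f k y)" if y: "y \<in> limit_set \<Gamma>" for y
      proof (cases "dist x y = 0 \<or> dist x y \<ge> 1")
        case True
        then have "dist x y powr (1 - \<delta>) \<le> 1"
        proof
          assume "dist x y \<ge> 1"
          then have "dist x y powr (1 - \<delta>) \<le> dist x y powr 0" using \<delta> by (intro powr_mono) auto
          then show ?thesis using \<open>dist x y \<ge> 1\<close> by (simp split: if_splits)
        qed simp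
        then have "ennreal (dist x y powr (1 - \<delta>)) \<le> 1" by (simp add: ennreal_le_1)
        then show ?thesis by (rule order_trans) simp
      next
        case False
        then have d: "0 < dist x y" "dist x y < 1" by auto
        \<comment> \<open>The index of the dyadic annulus around \<open>x\<close> that contains \<open>y\<close>.\<close>
        define k where "k = (LEAST k. ?r k / 2 < dist x y)"
        obtain j where "?r j < 2 * dist x y"
          using real_arch_pow_inv[of "2 * dist x y" "1/2"] d by auto
        then have ex: "\<exists>k. ?r k / 2 < dist x y" by (intro exI[of _ j]) simp
        have k1: "?r k / 2 < dist x y" unfolding k_def using ex by (rule LeastI_ex)
        have k2: "dist x y \<le> ?r k"
        proof (cases k)
          case (Suc j)
          then have "j < (LEAST k. ?r k / 2 < dist x y)" unfolding k_def[symmetric] by simp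
          then have "\<not> ?r j / 2 < dist x y" by (rule not_less_Least)
          then show ?thesis using Suc by simp
        qed (use d in simp)
        have "dist x y powr (1 - \<delta>) \<le> (?r k / 2) powr (1 - \<delta>)"
          using k1 \<delta> by (intro powr_mono2') auto
        then have "ennreal (dist x y powr (1 - \<delta>)) \<le> ?f k y"
          using y k2 by (simp add: ennreal_leI)
        also have "\<dots> \<le> (\<Sum>k. ?f k y)"
        proof -
          have "F k \<le> suminf F" for F :: "nat \<Rightarrow> ennreal"
            using sum_le_suminf[of F "{k}"] by simp
          then show ?thesis .
        qed
        also have "\<dots> \<le> 1 + (\<Sum>k. ?f k y)" by simp
        finally show ?thesis .
      qed
      have "(\<integral>\<^sup>+y. ennreal (dist x y powr (1 - \<delta>)) \<partial>\<mu>) \<le> (\<integral>\<^sup>+y. 1 + (\<Sum>k. ?f k y) \<partial>\<mu>)"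
        using pw by (intro nn_integral_mono) (simp add: mu_space)
      also have "\<dots> = emeasure \<mu> (space \<mu>) + (\<Sum>k. \<integral>\<^sup>+y. ?f k y \<partial>\<mu>)"
        using Bs by (subst nn_integral_add) (auto simp: nn_integral_suminf)
      also have "(\<Sum>k. \<integral>\<^sup>+y. ?f k y \<partial>\<mu>) \<le> (\<Sum>k. ennreal (?c * ?r k))"
      proof (rule suminf_le)
        fix k
        have "(\<integral>\<^sup>+y. ?f k y \<partial>\<mu>) = ennreal ((?r k / 2) powr (1 - \<delta>)) * emeasure \<mu> (?B k)"
          using Bs by (rule nn_integral_cmult_indicator)
        also have "\<dots> \<le> ennreal ((?r k / 2) powr (1 - \<delta>)) * ennreal (C * ?r k powr \<delta>)"
          using C(2)[OF x, of "?r k"] by (intro mult_left_mono) (auto simp: power_le_one)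
        also have "\<dots> = ennreal (?c * ?r k)"
        proof -
          have rk: "?r k > 0" by simp
          have "(?r k / 2) powr (1 - \<delta>) * (C * ?r k powr \<delta>) =
                C * (2 powr (\<delta> - 1)) * (?r k powr (1 - \<delta>) * ?r k powr \<delta>)"
          proof -
            have "(\<rho> / 2) powr (1 - \<delta>) = 2 powr (\<delta> - 1) * \<rho> powr (1 - \<delta>)" if "\<rho> > 0" for \<rho> :: real
            proof -
              have "(\<rho> / 2) powr (1 - \<delta>) = \<rho> powr (1 - \<delta>) / 2 powr (1 - \<delta>)"
                by (rule powr_divide)
              also have "\<dots> = 2 powr (- (1 - \<delta>)) * \<rho> powr (1 - \<delta>)"
                unfolding powr_minus by (simp add: divide_inverse)
              finally show ?thesis by simp
            qed
            from this[OF rk] show ?thesis by simp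
          qed
          also have "?r k powr (1 - \<delta>) * ?r k powr \<delta> = ?r k"
            using rk by (simp add: powr_add[symmetric])
          finally show ?thesis using C(1) by (simp add: ennreal_mult[symmetric])
        qed
        finally show "(\<integral>\<^sup>+y. ?f k y \<partial>\<mu>) \<le> ennreal (?c * ?r k)" .
      qed auto
      also have "(\<Sum>k. ennreal (?c * ?r k)) = ennreal (2 * ?c)"
      proof -
        have s: "(\<lambda>k. ?c * ?r k) sums (?c * 2)"
          using sums_mult[OF geometric_sums[of "1/2::real"], of ?c] by simp
        show ?thesis
          using s C(1) by (subst suminf_ennreal2) (auto simp: sums_iff mult.commute)
      qed
      finally show ?thesis
        using C(1) by (simp add: emeasure_eq_measure add_left_mono flip: ennreal_plus)
    qed
    then show ?thesis by blast
  qed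
  moreover have "bounded (limit_set \<Gamma>)"
    using limit_set_sub_sphere bounded_sphere bounded_subset by blast
  ultimately show ?thesis
    by unfold_locales (auto simp: mu_sets)
qed

text \<open>
  The Lipschitz bound holds because \<open>ray_scale A\<close> is affine and takes values in a compact interval
  \<open>{lo..hi}\<close> of positive numbers, on which \<open>t powr (-\<delta>/2)\<close> has bounded derivative.
\<close>

lemma conformal_transformation_sphere_act:
  assumes "log_dirichlet_space \<mu> (limit_set \<Gamma>) \<delta>" and A: "A \<in> \<Gamma>" and n: "CARD('n) \<ge> 2"
  obtains L lo where "conformal_transformation \<mu> (limit_set \<Gamma>) \<delta> (sphere_act A)
    (\<lambda>x. conformal_factor (sphere_act A) x powr (\<delta> / 2)) L lo"
proof -
  interpret log_dirichlet_space \<mu> "limit_set \<Gamma>" \<delta> by fact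
  let ?a = "\<lambda>x. conformal_factor (sphere_act A) x powr (\<delta> / 2)"
  note AS = in_SO_plus[OF A]
  define lo where "lo = time_part (A $ None) - norm (space_part (A $ None))"
  define hi where "hi = time_part (A $ None) + norm (space_part (A $ None))"
  have lo: "lo > 0" using SO_plus_row[OF AS] by (simp add: lo_def)
  have tau: "ray_scale A x \<in> {lo..hi}" if "x \<in> limit_set \<Gamma>" for x
    using ray_scale_bounds[OF AS limit_set_norm[OF that]] by (simp add: lo_def hi_def)
  have tpos: "ray_scale A x > 0" if "x \<in> limit_set \<Gamma>" for x
    using tau[OF that] lo by auto
  have a: "?a x = ray_scale A x powr (- \<delta> / 2)" if "x \<in> limit_set \<Gamma>" for x
    using conformal_factor_sphere_act[OF AS limit_set_norm[OF that] n] tpos[OF that]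
    by (simp add: powr_divide powr_minus_divide)
  obtain B where B: "\<And>t. t \<in> {lo..hi} \<Longrightarrow> norm (- \<delta> / 2 * t powr (- \<delta> / 2 - 1)) \<le> B"
  proof -
    have "continuous_on {lo..hi} (\<lambda>t. - \<delta> / 2 * t powr (- \<delta> / 2 - 1))"
      using lo by (intro continuous_intros) auto
    then have "bounded ((\<lambda>t. - \<delta> / 2 * t powr (- \<delta> / 2 - 1)) ` {lo..hi})"
      by (intro compact_imp_bounded compact_continuous_image) auto
    then obtain B where "\<forall>t\<in>{lo..hi}. norm (- \<delta> / 2 * t powr (- \<delta> / 2 - 1)) \<le> B"
      unfolding bounded_iff by blast
    then show thesis using that[of B] by blast
  qed
  have lip: "\<bar>s powr (- \<delta> / 2) - t powr (- \<delta> / 2)\<bar> \<le> \<bar>B\<bar> * \<bar>s - t\<bar>"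
    if "s \<in> {lo..hi}" "t \<in> {lo..hi}" for s t
  proof -
    have "norm (s powr (- \<delta> / 2) - t powr (- \<delta> / 2)) \<le> \<bar>B\<bar> * norm (s - t)"
    proof (rule field_differentiable_bound[where S="{lo..hi}"])
      fix z assume z: "z \<in> {lo..hi}"
      then have "z > 0" using lo by auto
      then show "((\<lambda>t. t powr (- \<delta> / 2)) has_field_derivative - \<delta> / 2 * z powr (- \<delta> / 2 - 1)) (at z within {lo..hi})"
        by (intro has_real_derivative_powr[THEN DERIV_subset]) auto
      show "norm (- \<delta> / 2 * z powr (- \<delta> / 2 - 1)) \<le> \<bar>B\<bar>" using B[OF z] by linarith
    qed (use that in auto)
    then show ?thesis by simp
  qed
  show thesis
  proof (rule that[of "\<bar>B\<bar> * norm (space_part (A $ None))" "min (lo powr (- \<delta> / 2)) (hi powr (- \<delta> / 2))"], unfold_locales)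
    show "sphere_act A \<in> measurable \<mu> \<mu>" by (rule sphere_act_measurable[OF A])
    show am: "?a \<in> borel_measurable \<mu>"
    proof -
      have "(\<lambda>x. (1 / ray_scale A x) powr (\<delta> / 2)) \<in> borel_measurable \<mu>" by (rule weight_measurable)
      then show ?thesis
        by (rule measurable_cong[THEN iffD1, rotated])
           (simp add: mu_space conformal_factor_sphere_act[OF AS limit_set_norm n])
    qed
    show "\<bar>?a x - ?a y\<bar> \<le> \<bar>B\<bar> * norm (space_part (A $ None)) * dist x y"
      if x: "x \<in> limit_set \<Gamma>" and y: "y \<in> limit_set \<Gamma>" for x y
    proof -
      have "\<bar>?a x - ?a y\<bar> \<le> \<bar>B\<bar> * \<bar>ray_scale A x - ray_scale A y\<bar>"
        unfolding a[OF x] a[OF y] by (rule lip[OF tau[OF x] tau[OF y]])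
      also have "\<dots> \<le> \<bar>B\<bar> * (norm (space_part (A $ None)) * dist x y)"
        by (intro mult_left_mono ray_scale_lipschitz) auto
      finally show ?thesis by (simp add: mult.assoc)
    qed
    show "0 \<le> \<bar>B\<bar> * norm (space_part (A $ None))" by simp
    have "hi > 0" using lo norm_ge_zero[of "space_part (A $ None)"] unfolding lo_def hi_def by linarith
    then show "0 < min (lo powr (- \<delta> / 2)) (hi powr (- \<delta> / 2))" using lo by simp
    show "min (lo powr (- \<delta> / 2)) (hi powr (- \<delta> / 2)) \<le> ?a x" if x: "x \<in> limit_set \<Gamma>" for x
    proof (cases "\<delta> \<ge> 0")
      case True
      then have "hi powr (- \<delta> / 2) \<le> ray_scale A x powr (- \<delta> / 2)"
        using tau[OF x] tpos[OF x] by (intro powr_mono2') auto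
      then show ?thesis unfolding a[OF x] by (rule min.coboundedI2)
    next
      case False
      then have "lo powr (- \<delta> / 2) \<le> ray_scale A x powr (- \<delta> / 2)"
        using tau[OF x] lo by (intro powr_mono2) auto
      then show ?thesis unfolding a[OF x] by (rule min.coboundedI1)
    qed
    show "dist (sphere_act A x) (sphere_act A y) powr \<delta> = ?a x * ?a y * dist x y powr \<delta>"
      if x: "x \<in> limit_set \<Gamma>" and y: "y \<in> limit_set \<Gamma>" for x y
    proof -
      have sq: "u powr \<delta> = (u\<^sup>2) powr (\<delta> / 2)" if "u \<ge> 0" for u :: real
        using that by (cases "u = 0") (simp_all add: powr_powr flip: powr_numeral)
      have "(dist (sphere_act A x) (sphere_act A y)) powr \<delta> =
          ((dist x y)\<^sup>2 / (ray_scale A x * ray_scale A y)) powr (\<delta> / 2)"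
        by (simp add: sq sphere_act_dist[OF AS limit_set_norm[OF x] limit_set_norm[OF y]])
      also have "\<dots> = ?a x * ?a y * dist x y powr \<delta>"
        unfolding a[OF x] a[OF y] sq[OF zero_le_dist] using tpos[OF x] tpos[OF y]
        by (simp add: powr_divide powr_mult powr_minus_divide)
      finally show ?thesis .
    qed
    show "distr (density \<mu> (\<lambda>x. ennreal ((?a x)\<^sup>2))) \<mu> (sphere_act A) = \<mu>"
    proof -
      let ?i = "sphere_act (matrix_inv A)"
      have "density \<mu> (\<lambda>x. ennreal ((?a x)\<^sup>2)) = density \<mu> (\<lambda>x. ennreal ((1 / ray_scale A x) powr \<delta>))"
      proof (rule density_cong)
        show "AE x in \<mu>. ennreal ((?a x)\<^sup>2) = ennreal ((1 / ray_scale A x) powr \<delta>)"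
        proof (rule AE_I2)
          fix x assume "x \<in> space \<mu>"
          then have x: "norm x = 1" by (simp add: mu_space limit_set_norm)
          have "(?a x)\<^sup>2 = (1 / ray_scale A x) powr \<delta>"
            unfolding conformal_factor_sphere_act[OF AS x n]
            using ray_scale_pos[OF AS x] by (simp add: power2_eq_square powr_add[symmetric])
          then show "ennreal ((?a x)\<^sup>2) = ennreal ((1 / ray_scale A x) powr \<delta>)" by simp
        qed
      qed (use am weight_measurable in auto)
      also have "\<dots> = distr \<mu> \<mu> ?i" by (rule mu_measure_scaling[OF A, symmetric])
      finally have "distr (density \<mu> (\<lambda>x. ennreal ((?a x)\<^sup>2))) \<mu> (sphere_act A) =
          distr (distr \<mu> \<mu> ?i) \<mu> (sphere_act A)" by simp
      also have "\<dots> = distr \<mu> \<mu> (sphere_act A \<circ> ?i)"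
        by (rule distr_distr) (intro sphere_act_measurable A inverse_closed)+
      also have "\<dots> = distr \<mu> \<mu> (\<lambda>x. x)"
        by (rule distr_cong) (simp_all add: mu_space matrix_inv_sphere_act[OF A] limit_set_norm)
      also have "\<dots> = \<mu>" by (rule distr_id)
      finally show ?thesis .
    qed
  qed
qed

end


section \<open>The commutator\<close>

theorem proposition5p15:
  fixes n :: nat
    and \<Gamma> :: "(real ^ (('n::finite) option) ^ 'n option) set"
    and \<gamma> :: "real ^ 'n option ^ 'n option"
    and \<mu> :: "(real ^ 'n) measure"
    and \<delta> :: real
  assumes "n \<ge> 1" and "CARD('n) = n + 1"
    and "kleinian_group \<Gamma>" and "non_elementary \<Gamma>" and "convex_cocompact \<Gamma>" and "second_kind \<Gamma>"
    and "\<delta> = hausdorff_dim (limit_set \<Gamma>)"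
    and "patterson_sullivan_measure \<Gamma> \<delta> \<mu>"
    and "\<gamma> \<in> \<Gamma>"
  shows "(\<forall>f\<in>laplacian_dom \<delta> \<mu>. boundary_unitary \<delta> \<gamma> f \<in> laplacian_dom \<delta> \<mu>) \<and>
         (\<exists>T. bounded_operator_L2 \<mu> T \<and>
            (\<forall>f\<in>laplacian_dom \<delta> \<mu>. AE x in \<mu>.
               T f x = laplacian \<delta> \<mu> (boundary_unitary \<delta> \<gamma> f) x
                       - boundary_unitary \<delta> \<gamma> (laplacian \<delta> \<mu> f) x))"
proof -
  interpret patterson_sullivan \<Gamma> \<delta> \<mu>
    by unfold_locales (fact assms)+
  have n: "CARD('n) \<ge> 2" using assms(1,2) by simp
  have space: "log_dirichlet_space \<mu> (limit_set \<Gamma>) \<delta>"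
    using assms(4,5) by (intro log_dirichlet)
  let ?B = "matrix_inv \<gamma>"
  let ?a = "\<lambda>A x. conformal_factor (sphere_act A) x powr (\<delta> / 2)"
  have B: "?B \<in> \<Gamma>" by (rule inverse_closed[OF assms(9)])
  obtain L lo where 1: "conformal_transformation \<mu> (limit_set \<Gamma>) \<delta> (sphere_act ?B) (?a ?B) L lo"
    by (rule conformal_transformation_sphere_act[OF space B n])
  obtain L' lo' where 2: "conformal_transformation \<mu> (limit_set \<Gamma>) \<delta> (sphere_act \<gamma>) (?a \<gamma>) L' lo'"
    by (rule conformal_transformation_sphere_act[OF space assms(9) n])
  interpret T: conformal_transformation \<mu> "limit_set \<Gamma>" \<delta> "sphere_act ?B" "?a ?B" L lo by (fact 1)
  interpret I: invertible_conformal_transformation \<mu> "limit_set \<Gamma>" \<delta>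
    "sphere_act ?B" "?a ?B" L lo "sphere_act \<gamma>" "?a \<gamma>" L' lo'
  proof (intro invertible_conformal_transformation.intro 1 2, unfold_locales)
    fix x assume "x \<in> limit_set \<Gamma>"
    then have x: "norm x = 1" by (rule limit_set_norm)
    have y: "norm (sphere_act ?B x) = 1" by (rule norm_sphere_act[OF in_SO_plus[OF B] x])
    show "sphere_act \<gamma> (sphere_act ?B x) = x" by (rule matrix_inv_sphere_act(1)[OF assms(9) x])
    show "?a ?B x * ?a \<gamma> (sphere_act ?B x) = 1"
      unfolding conformal_factor_sphere_act[OF in_SO_plus[OF B] x n]
        conformal_factor_sphere_act[OF in_SO_plus[OF assms(9)] y n]
      using matrix_inv_sphere_act(2)[OF assms(9) x]
      by (simp add: mult.commute flip: powr_mult)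
  qed
  have "T.weighted_composition = boundary_unitary \<delta> \<gamma>"
    by (simp add: fun_eq_iff T.weighted_composition_def boundary_unitary_def)
  then show ?thesis using I.commutator_bounded by simp
qed

end
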